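(* Let $P$ be the powerset of $\{1,2,3\}$ ordered by inclusion, let $X$ be the poset, $\mathbf{F}(X)$ the $P$-scaled Boolean algebra, and $\mathrm{Id}_{c}\vec{A}$ the $P$-indexed commutative diagram of distributive lattices with zero described in the context, and let $\mathbf{B}=\mathbf{F}(X)\otimes\mathrm{Id}_{c}\vec{A}$, computed in the category of distributive lattices with zero and $0$-lattice homomorphisms. Then $\mathbf{B}$ is a non-Cevian completely normal distributive lattice with zero and countably based differences. It has cardinality $\aleph_2$.
   Context: **Lattices.** A distributive lattice $D$ with zero is *completely normal* if for all $x,y\in D$ there are $u,v\in D$ with $x\le y\vee u$, $y\le x\vee v$, $u\wedge v=0$. It has *countably based differences* if for all $a,b\in D$ the set $\{x\in D\mid a\le b\vee x\}$ has a countable (i.e. at most countable) coinitial subset, where a subset $Y$ of a poset $Q$ is coinitial if every element of $Q$ is above some element of $Y$. A binary operation $\smallsetminus$ on $D$ is *Cevian* if for all $x,y,z\in D$: $x\le y\vee(x\smallsetminus y)$; $(x\smallsetminus y)\wedge(y\smallsetminus x)=0$; $x\smallsetminus z\le(x\smallsetminus y)\vee(y\smallsetminus z)$. $D$ is *Cevian* if it has a Cevian operation. A $0$-lattice homomorphism is a lattice homomorphism preserving $0$. **The diagram $\vec A$.** Write $P=\{\varnothing,1,2,3,12,13,23,123\}$, where $12=21=\{1,2\}$, etc. An $\ell$-group is a lattice-ordered group (written additively); $\ell$-homomorphisms are group homomorphisms preserving $\vee,\wedge$. Let $A_{123}$ be the Abelian $\ell$-group defined by generators $a,a',b,c$ and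 relations $0\le a\le a'\le 2a$, $0\le b$, $0\le c$. Let $A_{12},A_{13},A_{23},A_1,A_2,A_3$ be the $\ell$-subgroups of $A_{123}$ generated by $\{a,b\}$, $\{a',c\}$, $\{b,c\}$, $\{a\}$, $\{b\}$, $\{c\}$ respectively, and $A_\varnothing=\{0\}$. The (non-commutative) diagram $\vec A$ assigns to $p\le q$ in $P$ the following nonempty set $\vec A(p,q)$ of $\ell$-homomorphisms $A_p\to A_q$: $\vec A(p,p)=\{\mathrm{id}\}$; $\vec A(\varnothing,p)=\{0\}$; for distinct $i,j\in\{1,2,3\}$, $\vec A(i,ij)=\{\alpha_i^{ij}\}$ with $\alpha_i^{ij}$ the inclusion map, except that $\alpha_1^{13}$ is the unique $\ell$-homomorphism $A_1\to A_{13}$ sending $a$ to $a'$; $\vec A(ij,123)=\{\alpha_{ij}^{123}\}$ with $\alpha_{ij}^{123}$ the inclusion map; $\vec A(2,123)$ and $\vec A(3,123)$ each consist of the inclusion map; $\vec A(1,123)$ consists of the two maps $\alpha_{12}^{123}\circ\alpha_1^{12}$ and $\alpha_{13}^{123}\circ\alpha_1^{13}$. For an Abelian $\ell$-group $G$, $\mathrm{Id}_{c}G$ is the lattice (under inclusion) of all finitely generated $\ell$-ideals (equivalently convex $\ell$-subgroups) of $G$; its elements are the $\langle x\rangle_G=\{y\in G\mid(\exists n<\omega)\ |y|\le n|x|\}$, $x\in G$. For an $\ell$-homomorphism $f\colon G\to H$, $\mathrm{Id}_{c}f$ sends $\langle x\rangle_G$ to $\langle f(x)\rangle_H$. For $p\le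 q$ in $P$, all $f\in\vec A(p,q)$ have the same image $\mathrm{Id}_{c}f$, so $\mathrm{Id}_{c}\vec A$ is a $P$-indexed commutative diagram of distributive lattices with zero and $0$-lattice homomorphisms, with vertices $\mathrm{Id}_{c}A_p$. **$P$-scaled Boolean algebras.** A $P$-scaled Boolean algebra is $\mathbf{A}=(A,(A^{(p)}\mid p\in P))$ where $A$ is a Boolean algebra, each $A^{(p)}$ is an ideal of $A$, $A=\bigvee_{p\in P}A^{(p)}$ in the ideal lattice of $A$, and $A^{(p)}\cap A^{(q)}=\bigvee_{r\ge p,q}A^{(r)}$ for all $p,q\in P$. A morphism $\mathbf{A}\to\mathbf{B}$ is a Boolean homomorphism $f\colon A\to B$ with $f[A^{(p)}]\subseteq B^{(p)}$ for all $p$. This defines a category $\mathbf{Bool}_P$, with all small directed colimits. $\mathbf{A}$ is finitely presented iff $A$ is finite and, for every atom $x$ of $A$, the set $\{p\in P\mid x\in A^{(p)}\}$ has a largest element, denoted $|x|_{\mathbf{A}}$. Every $P$-scaled Boolean algebra is a directed colimit of finitely presented ones. **Condensates.** Let $\mathcal{S}$ be a category with all nonempty finite products and small directed colimits and let $\vec S=(S_p,\sigma_p^q\mid p\le q\text{ in }P)$ be a commutative diagram in $\mathcal{S}$. For finitely presented $\mathbf{A}$ put $\mathbf{A}\otimes\vec S=\prod(S_{|x|_{\mathbf{A}}}\mid x\text{ an atom of }A)$. For a morphism $\varphi\colon\mathbf{A}\to\mathbf{B}$ between finitely presented objects and an atom $y$ of $B$, let $y^\varphi$ be the unique atom of $A$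 with $y\le\varphi(y^\varphi)$; $\varphi\otimes\vec S\colon\mathbf{A}\otimes\vec S\to\mathbf{B}\otimes\vec S$ is the morphism whose $y$-component is the projection onto the $y^\varphi$-factor followed by $\sigma_{|y^\varphi|_{\mathbf{A}}}^{|y|_{\mathbf{B}}}$. This functor extends uniquely, up to isomorphism, to a functor $-\otimes\vec S\colon\mathbf{Bool}_P\to\mathcal{S}$ preserving all small directed colimits. **The poset $X$ and $\mathbf{F}(X)$.** $X$ is the set of all pairs $(p,u)$ where $p\in P$ and $u\colon U\to\omega_2$ is a map with $U\subseteq P$ and $p=\bigvee U$ (join in $P$), ordered by $(p,u)\le(q,v)$ iff $p\le q$ and $v$ extends $u$. Let $\partial\colon X\to P$, $\partial(p,u)=p$. For a finite $Z\subseteq X$, $\bigtriangledown Z$ denotes the (finite) set of all minimal elements of the set of upper bounds of $Z$ in $X$. Let $\mathrm{F}(X)$ be the Boolean algebra defined by generators $\tilde u$ ($u\in X$) and relations: $\tilde v\le\tilde u$ whenever $u\le v$; $\tilde u\wedge\tilde v=\bigvee(\tilde w\mid w\in\bigtriangledown\{u,v\})$ for all $u,v\in X$; $1=\bigvee(\tilde w\mid w\in\bigtriangledown\varnothing)$. For $p\in P$, let $\mathrm{F}(X)^{(p)}$ be the ideal of $\mathrm{F}(X)$ generated by $\{\tilde u\mid u\in X,\ p\le\partial u\}$. Then $\mathbf{F}(X)=(\mathrm{F}(X),(\mathrm{F}(X)^{(p)}\mid p\in P))$ is a $P$-scaled Boolean algebra. *)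

theory Defs
  imports
    "HOL-Algebra.Lattice"
    "HOL-Library.Lattice_Algebras"
    "HOL-Library.Countable_Set"
    "HOL-Library.FuncSet"
begin

unbundle cardinal_syntax

text \<open>Outside index notation, \<open>sup\<close>, \<open>inf\<close>, \<open>top\<close> are those of the type classes.\<close>

hide_const (open) Lattice.sup Lattice.inf Order.top


section \<open>Distributive lattices with zero\<close>

locale distrib_lattice_0 = lattice L + weak_partial_order_bottom L for L (structure) +
  assumes inf_sup_distrib:
    "\<lbrakk>x \<in> carrier L; y \<in> carrier L; z \<in> carrier L\<rbrakk>
      \<Longrightarrow> x \<sqinter> (y \<squnion> z) = (x \<sqinter> y) \<squnion> (x \<sqinter> z)"

definition completely_normal :: "'a gorder \<Rightarrow> bool" where
  "completely_normal D \<longleftrightarrow>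
    (\<forall>x\<in>carrier D. \<forall>y\<in>carrier D. \<exists>u\<in>carrier D. \<exists>v\<in>carrier D.
      x \<sqsubseteq>\<^bsub>D\<^esub> y \<squnion>\<^bsub>D\<^esub> u \<and> y \<sqsubseteq>\<^bsub>D\<^esub> x \<squnion>\<^bsub>D\<^esub> v \<and> u \<sqinter>\<^bsub>D\<^esub> v = \<bottom>\<^bsub>D\<^esub>)"

definition coinitial_in :: "'a gorder \<Rightarrow> 'a set \<Rightarrow> 'a set \<Rightarrow> bool" where
  "coinitial_in D Q Y \<longleftrightarrow> Y \<subseteq> Q \<and> (\<forall>x\<in>Q. \<exists>y\<in>Y. y \<sqsubseteq>\<^bsub>D\<^esub> x)"

definition countably_based_differences :: "'a gorder \<Rightarrow> bool" where
  "countably_based_differences D \<longleftrightarrow>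
    (\<forall>a\<in>carrier D. \<forall>b\<in>carrier D. \<exists>Y. countable Y \<and>
      coinitial_in D {x \<in> carrier D. a \<sqsubseteq>\<^bsub>D\<^esub> b \<squnion>\<^bsub>D\<^esub> x} Y)"

definition cevian_operation :: "'a gorder \<Rightarrow> ('a \<Rightarrow> 'a \<Rightarrow> 'a) \<Rightarrow> bool" where
  "cevian_operation D d \<longleftrightarrow>
    (\<forall>x\<in>carrier D. \<forall>y\<in>carrier D. d x y \<in> carrier D) \<and>
    (\<forall>x\<in>carrier D. \<forall>y\<in>carrier D. x \<sqsubseteq>\<^bsub>D\<^esub> y \<squnion>\<^bsub>D\<^esub> d x y) \<and>
    (\<forall>x\<in>carrier D. \<forall>y\<in>carrier D. d x y \<sqinter>\<^bsub>D\<^esub> d y x = \<bottom>\<^bsub>D\<^esub>) \<and>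
    (\<forall>x\<in>carrier D. \<forall>y\<in>carrier D. \<forall>z\<in>carrier D.
      d x z \<sqsubseteq>\<^bsub>D\<^esub> d x y \<squnion>\<^bsub>D\<^esub> d y z)"

definition cevian :: "'a gorder \<Rightarrow> bool" where
  "cevian D \<longleftrightarrow> (\<exists>d. cevian_operation D d)"

text \<open>
  The product and the directed colimit of distributive lattices with zero.  The latter is the usual
  quotient of the disjoint union of the vertices: two elements are identified iff their images at
  some later stage are equal, and the order is the one computed at a common stage.
\<close>

definition lattice_prod :: "'i set \<Rightarrow> ('i \<Rightarrow> 'a gorder) \<Rightarrow> ('i \<Rightarrow> 'a) gorder" where
  "lattice_prod I L =
    \<lparr>carrier = (\<Pi>\<^sub>E i\<in>I. carrier (L i)), eq = (=), le = (\<lambda>f g. \<forall>i\<in>I. f i \<sqsubseteq>\<^bsub>L i\<^esub> g i)\<rparr>"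

definition colimit_rel ::
    "'i set \<Rightarrow> ('i \<Rightarrow> 'i \<Rightarrow> bool) \<Rightarrow> ('i \<Rightarrow> 'a gorder) \<Rightarrow> ('i \<Rightarrow> 'i \<Rightarrow> 'a \<Rightarrow> 'a) \<Rightarrow> ('i \<times> 'a) rel" where
  "colimit_rel I leq L \<phi> =
    {((i, x), (j, y)) | i x j y. i \<in> I \<and> j \<in> I \<and> x \<in> carrier (L i) \<and> y \<in> carrier (L j) \<and>
      (\<exists>k\<in>I. leq i k \<and> leq j k \<and> \<phi> i k x = \<phi> j k y)}"

definition directed_colimit ::
    "'i set \<Rightarrow> ('i \<Rightarrow> 'i \<Rightarrow> bool) \<Rightarrow> ('i \<Rightarrow> 'a gorder) \<Rightarrow> ('i \<Rightarrow> 'i \<Rightarrow> 'a \<Rightarrow> 'a)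
      \<Rightarrow> ('i \<times> 'a) set gorder" where
  "directed_colimit I leq L \<phi> =
    \<lparr>carrier = (SIGMA i:I. carrier (L i)) // colimit_rel I leq L \<phi>,
     eq = (=),
     le = (\<lambda>C D. \<exists>i\<in>I. \<exists>x y. (i, x) \<in> C \<and> (i, y) \<in> D \<and> x \<sqsubseteq>\<^bsub>L i\<^esub> y)\<rparr>"


section \<open>Scaled Boolean algebras\<close>

text \<open>
  A scaled Boolean algebra lives on a Boolean subalgebra \<open>univ\<close> of an ambient Boolean algebra
  \<^typ>\<open>'a\<close>; for an algebra on the whole type, \<open>univ\<close> is \<^term>\<open>UNIV\<close>.  The poset of
  indices is the type \<^typ>\<open>'p\<close>.
\<close>

record ('a, 'p) scaled =
  univ :: "'a set"
  scale :: "'p \<Rightarrow> 'a set"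

definition bool_subalgebra :: "'a::boolean_algebra set \<Rightarrow> bool" where
  "bool_subalgebra U \<longleftrightarrow> bot \<in> U \<and> top \<in> U \<and> (\<forall>x\<in>U. - x \<in> U) \<and>
    (\<forall>x\<in>U. \<forall>y\<in>U. sup x y \<in> U \<and> inf x y \<in> U)"

definition bool_ideal :: "'a::boolean_algebra set \<Rightarrow> 'a set \<Rightarrow> bool" where
  "bool_ideal U J \<longleftrightarrow> J \<subseteq> U \<and> bot \<in> J \<and> (\<forall>x\<in>J. \<forall>y\<in>J. sup x y \<in> J) \<and>
    (\<forall>x\<in>J. \<forall>y\<in>U. y \<le> x \<longrightarrow> y \<in> J)"

text \<open>The join of a family of ideals is the ideal generated by its union.\<close>

definition scaled_boolean_algebra :: "('a::boolean_algebra, 'p::order) scaled \<Rightarrow> bool" where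
  "scaled_boolean_algebra A \<longleftrightarrow>
    bool_subalgebra (univ A) \<and>
    (\<forall>p. bool_ideal (univ A) (scale A p)) \<and>
    univ A = bool_ideal (univ A) hull (\<Union>p. scale A p) \<and>
    (\<forall>p q. scale A p \<inter> scale A q =
      bool_ideal (univ A) hull (\<Union>r\<in>{r. p \<le> r \<and> q \<le> r}. scale A r))"

definition scaled_morphism ::
    "('a::boolean_algebra, 'p) scaled \<Rightarrow> ('b::boolean_algebra, 'p) scaled \<Rightarrow> ('a \<Rightarrow> 'b) \<Rightarrow> bool" where
  "scaled_morphism A B f \<longleftrightarrow>
    f ` univ A \<subseteq> univ B \<and> f bot = bot \<and> f top = top \<and>
    (\<forall>x\<in>univ A. f (- x) = - f x) \<and>
    (\<forall>x\<in>univ A. \<forall>y\<in>univ A. f (sup x y) = sup (f x) (f y) \<and> f (inf x y) = inf (f x) (f y)) \<and>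
    (\<forall>p. f ` scale A p \<subseteq> scale B p)"

definition atoms :: "('a::boolean_algebra, 'p) scaled \<Rightarrow> 'a set" where
  "atoms A = {x \<in> univ A. x \<noteq> bot \<and> (\<forall>y\<in>univ A. y \<le> x \<longrightarrow> y = bot \<or> y = x)}"

definition finitely_presented :: "('a::boolean_algebra, 'p::order) scaled \<Rightarrow> bool" where
  "finitely_presented A \<longleftrightarrow>
    scaled_boolean_algebra A \<and> finite (univ A) \<and>
    (\<forall>x\<in>atoms A. \<exists>p. x \<in> scale A p \<and> (\<forall>q. x \<in> scale A q \<longrightarrow> q \<le> p))"

definition atom_index :: "('a::boolean_algebra, 'p::order) scaled \<Rightarrow> 'a \<Rightarrow> 'p" where
  "atom_index A x = (GREATEST p. x \<in> scale A p)"


section \<open>Condensates\<close>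

definition fp_tensor ::
    "('a::boolean_algebra, 'p::order) scaled \<Rightarrow> ('p \<Rightarrow> 'l gorder) \<Rightarrow> ('a \<Rightarrow> 'l) gorder" where
  "fp_tensor A S = lattice_prod (atoms A) (\<lambda>x. S (atom_index A x))"

definition fp_tensor_map ::
    "('a::boolean_algebra, 'p::order) scaled \<Rightarrow> ('b::boolean_algebra, 'p) scaled \<Rightarrow> ('a \<Rightarrow> 'b) \<Rightarrow>
      ('p \<Rightarrow> 'p \<Rightarrow> 'l \<Rightarrow> 'l) \<Rightarrow> ('a \<Rightarrow> 'l) \<Rightarrow> ('b \<Rightarrow> 'l)" where
  "fp_tensor_map A B \<phi> \<sigma> f =
    (\<lambda>y\<in>atoms B. let x = (THE x. x \<in> atoms A \<and> y \<le> \<phi> x)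
                 in \<sigma> (atom_index A x) (atom_index B y) (f x))"

text \<open>
  Every scaled Boolean algebra \<open>A\<close> is the directed union, in the category of scaled Boolean
  algebras, of the finitely presented ones \<open>A\<^sub>0\<close> carried by a subalgebra of \<open>A\<close> for which the
  inclusion map into \<open>A\<close> is a morphism; these are ordered by the inclusion being a morphism.  Hence
  the value at \<open>A\<close> of any functor that extends \<open>fp_tensor\<close> and preserves directed colimits is
  the colimit below.
\<close>

definition fp_subobjects ::
    "('a::boolean_algebra, 'p::order) scaled \<Rightarrow> ('a, 'p) scaled set" where
  "fp_subobjects A = {A\<^sub>0. finitely_presented A\<^sub>0 \<and> scaled_morphism A\<^sub>0 A (\<lambda>x. x)}"

definition condensate ::
    "('a::boolean_algebra, 'p::order) scaled \<Rightarrow> ('p \<Rightarrow> 'l gorder) \<Rightarrow> ('p \<Rightarrow> 'p \<Rightarrow> 'l \<Rightarrow> 'l)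
      \<Rightarrow> (('a, 'p) scaled \<times> ('a \<Rightarrow> 'l)) set gorder" where
  "condensate A S \<sigma> =
    directed_colimit (fp_subobjects A) (\<lambda>A\<^sub>0 A\<^sub>1. scaled_morphism A\<^sub>0 A\<^sub>1 (\<lambda>x. x))
      (\<lambda>A\<^sub>0. fp_tensor A\<^sub>0 S) (\<lambda>A\<^sub>0 A\<^sub>1. fp_tensor_map A\<^sub>0 A\<^sub>1 (\<lambda>x. x) \<sigma>)"


section \<open>Abelian lattice-ordered groups by generators and relations\<close>

datatype 'g lterm =
    LGen 'g | LZero | LPlus "'g lterm" "'g lterm" | LNeg "'g lterm"
  | LSup "'g lterm" "'g lterm" | LInf "'g lterm" "'g lterm"

text \<open>The least congruence containing \<open>R\<close> whose quotient is an Abelian lattice-ordered group.\<close>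

inductive lcong :: "('g lterm \<times> 'g lterm) set \<Rightarrow> 'g lterm \<Rightarrow> 'g lterm \<Rightarrow> bool"
  for R where
  rel: "(s, t) \<in> R \<Longrightarrow> lcong R s t"
| refl: "lcong R s s"
| sym: "lcong R s t \<Longrightarrow> lcong R t s"
| trans: "lcong R s t \<Longrightarrow> lcong R t r \<Longrightarrow> lcong R s r"
| plus_cong: "lcong R s s' \<Longrightarrow> lcong R t t' \<Longrightarrow> lcong R (LPlus s t) (LPlus s' t')"
| neg_cong: "lcong R s s' \<Longrightarrow> lcong R (LNeg s) (LNeg s')"
| sup_cong: "lcong R s s' \<Longrightarrow> lcong R t t' \<Longrightarrow> lcong R (LSup s t) (LSup s' t')"
| inf_cong: "lcong R s s' \<Longrightarrow> lcong R t t' \<Longrightarrow> lcong R (LInf s t) (LInf s' t')"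
| plus_assoc: "lcong R (LPlus (LPlus r s) t) (LPlus r (LPlus s t))"
| plus_comm: "lcong R (LPlus s t) (LPlus t s)"
| plus_zero: "lcong R (LPlus LZero s) s"
| plus_neg: "lcong R (LPlus (LNeg s) s) LZero"
| sup_assoc: "lcong R (LSup (LSup r s) t) (LSup r (LSup s t))"
| sup_comm: "lcong R (LSup s t) (LSup t s)"
| inf_assoc: "lcong R (LInf (LInf r s) t) (LInf r (LInf s t))"
| inf_comm: "lcong R (LInf s t) (LInf t s)"
| sup_absorb: "lcong R (LSup s (LInf s t)) s"
| inf_absorb: "lcong R (LInf s (LSup s t)) s"
| plus_sup: "lcong R (LPlus r (LSup s t)) (LSup (LPlus r s) (LPlus r t))"
| plus_inf: "lcong R (LPlus r (LInf s t)) (LInf (LPlus r s) (LPlus r t))"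

lemma equivp_lcong: "equivp (lcong R)"
  by (intro equivpI reflpI sympI transpI) (blast intro: lcong.refl lcong.sym lcong.trans)+

datatype gen = Gen_a | Gen_a' | Gen_b | Gen_c

text \<open>An inequality \<open>s \<le> t\<close> is the relation \<open>s \<and> t = s\<close>.\<close>

definition A123_rels :: "(gen lterm \<times> gen lterm) set" where
  "A123_rels = {(LInf s t, s) | s t. (s, t) \<in>
     {(LZero, LGen Gen_a), (LGen Gen_a, LGen Gen_a'),
      (LGen Gen_a', LPlus (LGen Gen_a) (LGen Gen_a)),
      (LZero, LGen Gen_b), (LZero, LGen Gen_c)}}"

quotient_type A123 = "gen lterm" / "lcong A123_rels" morphisms lterm_of A123_of
  by (rule equivp_lcong)

instantiation A123 :: lattice_ab_group_add_abs
begin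

lift_definition zero_A123 :: A123 is LZero .
lift_definition plus_A123 :: "A123 \<Rightarrow> A123 \<Rightarrow> A123" is LPlus by (rule lcong.plus_cong)
lift_definition uminus_A123 :: "A123 \<Rightarrow> A123" is LNeg by (rule lcong.neg_cong)
lift_definition sup_A123 :: "A123 \<Rightarrow> A123 \<Rightarrow> A123" is LSup by (rule lcong.sup_cong)
lift_definition inf_A123 :: "A123 \<Rightarrow> A123 \<Rightarrow> A123" is LInf by (rule lcong.inf_cong)
definition minus_A123 :: "A123 \<Rightarrow> A123 \<Rightarrow> A123" where "minus_A123 x y = x + - y"
definition less_eq_A123 :: "A123 \<Rightarrow> A123 \<Rightarrow> bool" where "less_eq_A123 x y \<longleftrightarrow> inf x y = x"
definition less_A123 :: "A123 \<Rightarrow> A123 \<Rightarrow> bool" where "less_A123 x y \<longleftrightarrow> x \<le> y \<and> \<not> y \<le> x"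
definition abs_A123 :: "A123 \<Rightarrow> A123" where "abs_A123 x = sup x (- x)"

instance
proof
  fix x y z :: A123
  have ia: "inf (inf x y) z = inf x (inf y z)" for x y z :: A123
    by transfer (rule lcong.inf_assoc)
  have ic: "inf x y = inf y x" for x y :: A123
    by transfer (rule lcong.inf_comm)
  have sa: "sup (sup x y) z = sup x (sup y z)" for x y z :: A123
    by transfer (rule lcong.sup_assoc)
  have sc: "sup x y = sup y x" for x y :: A123
    by transfer (rule lcong.sup_comm)
  have si: "sup x (inf x y) = x" for x y :: A123
    by transfer (rule lcong.sup_absorb)
  have ab: "inf x (sup x y) = x" for x y :: A123
    by transfer (rule lcong.inf_absorb)
  have ii: "inf x x = x" for x :: A123
    by (metis si ab)
  have le_sup: "x \<le> y \<longleftrightarrow> sup x y = y" for x y :: A123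
    unfolding less_eq_A123_def by (metis ic sc si ab)
  show "x + y + z = x + (y + z)" by transfer (rule lcong.plus_assoc)
  show "x + y = y + x" by transfer (rule lcong.plus_comm)
  show "0 + x = x" by transfer (rule lcong.plus_zero)
  show "- x + x = 0" by transfer (rule lcong.plus_neg)
  show "x - y = x + - y" by (rule minus_A123_def)
  show "x < y \<longleftrightarrow> x \<le> y \<and> \<not> y \<le> x" by (rule less_A123_def)
  show "x \<le> x" by (simp add: less_eq_A123_def ii)
  show "x \<le> y \<Longrightarrow> y \<le> z \<Longrightarrow> x \<le> z" unfolding less_eq_A123_def by (metis ia)
  show "x \<le> y \<Longrightarrow> y \<le> x \<Longrightarrow> x = y" unfolding less_eq_A123_def by (metis ic)
  show "inf x y \<le> x" unfolding less_eq_A123_def by (metis ia ic ii)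
  show "inf x y \<le> y" unfolding less_eq_A123_def by (metis ia ii)
  show "x \<le> y \<Longrightarrow> x \<le> z \<Longrightarrow> x \<le> inf y z" unfolding less_eq_A123_def by (metis ia)
  show "x \<le> sup x y" unfolding less_eq_A123_def by (rule ab)
  show "y \<le> sup x y" unfolding less_eq_A123_def by (metis ab sc)
  show "y \<le> x \<Longrightarrow> z \<le> x \<Longrightarrow> sup y z \<le> x" unfolding le_sup by (metis sa)
  show "x \<le> y \<Longrightarrow> z + x \<le> z + y"
  proof -
    have "z + inf x y = inf (z + x) (z + y)" by transfer (rule lcong.plus_inf)
    then show "x \<le> y \<Longrightarrow> z + x \<le> z + y" unfolding less_eq_A123_def by metis
  qed
  show "\<bar>x\<bar> = sup x (- x)" by (rule abs_A123_def)
qed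

end

definition gen_A123 :: "gen \<Rightarrow> A123" where
  "gen_A123 g = A123_of (LGen g)"


section \<open>The diagram of Abelian lattice-ordered groups\<close>

datatype idx = I1 | I2 | I3

type_synonym P = "idx set"

definition lsubgroup :: "'g::lattice_ab_group_add set \<Rightarrow> bool" where
  "lsubgroup H \<longleftrightarrow> 0 \<in> H \<and> (\<forall>x\<in>H. - x \<in> H) \<and>
    (\<forall>x\<in>H. \<forall>y\<in>H. x + y \<in> H \<and> sup x y \<in> H \<and> inf x y \<in> H)"

definition lhom :: "'g::lattice_ab_group_add set \<Rightarrow> 'h::lattice_ab_group_add set \<Rightarrow> ('g \<Rightarrow> 'h) set" where
  "lhom G H = {f \<in> G \<rightarrow>\<^sub>E H. \<forall>x\<in>G. \<forall>y\<in>G.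
    f (x + y) = f x + f y \<and> f (sup x y) = sup (f x) (f y) \<and> f (inf x y) = inf (f x) (f y)}"

definition A_obj :: "P \<Rightarrow> A123 set" where
  "A_obj p =
    (if p = {} then {0}
     else if p = {I1} then lsubgroup hull {gen_A123 Gen_a}
     else if p = {I2} then lsubgroup hull {gen_A123 Gen_b}
     else if p = {I3} then lsubgroup hull {gen_A123 Gen_c}
     else if p = {I1, I2} then lsubgroup hull {gen_A123 Gen_a, gen_A123 Gen_b}
     else if p = {I1, I3} then lsubgroup hull {gen_A123 Gen_a', gen_A123 Gen_c}
     else if p = {I2, I3} then lsubgroup hull {gen_A123 Gen_b, gen_A123 Gen_c}
     else UNIV)"

definition incl :: "P \<Rightarrow> A123 \<Rightarrow> A123" where
  "incl p = (\<lambda>x\<in>A_obj p. x)"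

definition alpha_1_13 :: "A123 \<Rightarrow> A123" where
  "alpha_1_13 = (THE f. f \<in> lhom (A_obj {I1}) (A_obj {I1, I3}) \<and>
    f (gen_A123 Gen_a) = gen_A123 Gen_a')"

definition A_arr :: "P \<Rightarrow> P \<Rightarrow> (A123 \<Rightarrow> A123) set" where
  "A_arr p q =
    (if \<not> p \<subseteq> q then {}
     else if p = q then {incl p}
     else if p = {} then {\<lambda>x\<in>A_obj {}. 0}
     else if p = {I1} \<and> q = {I1, I3} then {alpha_1_13}
     else if p = {I1} \<and> q = {I1, I2, I3} then
       {compose (A_obj {I1}) (incl {I1, I2}) (incl {I1}),
        compose (A_obj {I1}) (incl {I1, I3}) alpha_1_13}
     else {incl p})"


section \<open>Finitely generated ideals\<close>

text \<open>
  \<open>\<Sum>i<n. \<bar>x\<bar>\<close> is the \<open>n\<close>-fold multiple of \<open>\<bar>x\<bar>\<close>.  The finitely generated ideals of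
  \<open>G\<close> are exactly the principal ones, since \<open>x\<^sub>1, \<dots>, x\<^sub>m\<close> generate the same ideal as
  \<open>\<bar>x\<^sub>1\<bar> + \<dots> + \<bar>x\<^sub>m\<bar>\<close>.
\<close>

definition principal_lideal :: "'g::lattice_ab_group_add_abs set \<Rightarrow> 'g \<Rightarrow> 'g set" where
  "principal_lideal G x = {y \<in> G. \<exists>n::nat. \<bar>y\<bar> \<le> (\<Sum>i<n. \<bar>x\<bar>)}"

definition Idc :: "'g::lattice_ab_group_add_abs set \<Rightarrow> 'g set gorder" where
  "Idc G = \<lparr>carrier = principal_lideal G ` G, eq = (=), le = (\<subseteq>)\<rparr>"

definition Idc_map ::
    "'g::lattice_ab_group_add_abs set \<Rightarrow> 'h::lattice_ab_group_add_abs set \<Rightarrow> ('g \<Rightarrow> 'h) \<Rightarrow>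
      'g set \<Rightarrow> 'h set" where
  "Idc_map G H f =
    (\<lambda>J\<in>carrier (Idc G). THE K. \<forall>x\<in>G. J = principal_lideal G x \<longrightarrow> K = principal_lideal H (f x))"

definition IdcA_obj :: "P \<Rightarrow> A123 set gorder" where
  "IdcA_obj p = Idc (A_obj p)"

text \<open>All members of \<^term>\<open>A_arr p q\<close> have the same image under \<^const>\<open>Idc_map\<close>.\<close>

definition IdcA_arr :: "P \<Rightarrow> P \<Rightarrow> A123 set \<Rightarrow> A123 set" where
  "IdcA_arr p q = the_elem (Idc_map (A_obj p) (A_obj q) ` A_arr p q)"


section \<open>The poset X\<close>

text \<open>
  The elements of \<open>\<omega>\<^sub>2\<close> are those of the field of the cardinal \<open>\<aleph>\<^sub>2\<close>; its order plays no role.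
  A map \<open>U \<rightarrow> \<omega>\<^sub>2\<close> with \<open>U \<subseteq> P\<close> is a partial map with domain \<open>U\<close>.
\<close>

definition omega2 :: "nat set set rel" where
  "omega2 = cardSuc (cardSuc natLeq)"

typedef X = "{(p :: P, u :: P \<rightharpoonup> nat set set). ran u \<subseteq> Field omega2 \<and> p = \<Union>(dom u)}"
  by (rule exI[of _ "({}, Map.empty)"]) simp

setup_lifting type_definition_X

text \<open>The map \<open>\<partial>\<close> from \<^typ>\<open>X\<close> to \<^typ>\<open>P\<close>.\<close>

lift_definition bd :: "X \<Rightarrow> P" is fst .

lift_definition X_fun :: "X \<Rightarrow> P \<rightharpoonup> nat set set" is snd .

instantiation X :: order
begin

definition less_eq_X :: "X \<Rightarrow> X \<Rightarrow> bool" where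
  "x \<le> y \<longleftrightarrow> bd x \<subseteq> bd y \<and> X_fun x \<subseteq>\<^sub>m X_fun y"

definition less_X :: "X \<Rightarrow> X \<Rightarrow> bool" where
  "x < y \<longleftrightarrow> x \<le> y \<and> \<not> y \<le> (x :: X)"

instance
proof
  fix x y z :: X
  show "x < y \<longleftrightarrow> x \<le> y \<and> \<not> y \<le> x" by (rule less_X_def)
  show "x \<le> x" by (simp add: less_eq_X_def)
  show "x \<le> y \<Longrightarrow> y \<le> z \<Longrightarrow> x \<le> z"
    unfolding less_eq_X_def by (auto intro: map_le_trans)
  assume "x \<le> y" "y \<le> x"
  then have "bd x = bd y" "X_fun x = X_fun y"
    unfolding less_eq_X_def by (auto intro: map_le_antisym)
  then show "x = y" by transfer (simp add: prod_eq_iff)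
qed

end

definition nabla :: "'x::order set \<Rightarrow> 'x set" where
  "nabla Z = {w. (\<forall>z\<in>Z. z \<le> w) \<and> (\<forall>w'. (\<forall>z\<in>Z. z \<le> w') \<and> w' \<le> w \<longrightarrow> w' = w)}"


section \<open>The scaled Boolean algebra F(X)\<close>

datatype 'g bterm =
    BGen 'g | BBot | BTop | BCompl "'g bterm"
  | BSup "'g bterm" "'g bterm" | BInf "'g bterm" "'g bterm"

text \<open>The least congruence containing \<open>R\<close> whose quotient is a Boolean algebra.\<close>

inductive bcong :: "('g bterm \<times> 'g bterm) set \<Rightarrow> 'g bterm \<Rightarrow> 'g bterm \<Rightarrow> bool"
  for R where
  rel: "(s, t) \<in> R \<Longrightarrow> bcong R s t"
| refl: "bcong R s s"
| sym: "bcong R s t \<Longrightarrow> bcong R t s"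
| trans: "bcong R s t \<Longrightarrow> bcong R t r \<Longrightarrow> bcong R s r"
| compl_cong: "bcong R s s' \<Longrightarrow> bcong R (BCompl s) (BCompl s')"
| sup_cong: "bcong R s s' \<Longrightarrow> bcong R t t' \<Longrightarrow> bcong R (BSup s t) (BSup s' t')"
| inf_cong: "bcong R s s' \<Longrightarrow> bcong R t t' \<Longrightarrow> bcong R (BInf s t) (BInf s' t')"
| sup_assoc: "bcong R (BSup (BSup r s) t) (BSup r (BSup s t))"
| sup_comm: "bcong R (BSup s t) (BSup t s)"
| inf_assoc: "bcong R (BInf (BInf r s) t) (BInf r (BInf s t))"
| inf_comm: "bcong R (BInf s t) (BInf t s)"
| sup_absorb: "bcong R (BSup s (BInf s t)) s"
| inf_absorb: "bcong R (BInf s (BSup s t)) s"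
| sup_distrib: "bcong R (BSup r (BInf s t)) (BInf (BSup r s) (BSup r t))"
| sup_bot: "bcong R (BSup s BBot) s"
| inf_top: "bcong R (BInf s BTop) s"
| inf_compl: "bcong R (BInf s (BCompl s)) BBot"
| sup_compl: "bcong R (BSup s (BCompl s)) BTop"

lemma equivp_bcong: "equivp (bcong R)"
  by (intro equivpI reflpI sympI transpI) (blast intro: bcong.refl bcong.sym bcong.trans)+

text \<open>
  The join of a finite set of generators is formed along a list enumerating it; the relations
  involve all enumerations.
\<close>

definition BJoin :: "'g list \<Rightarrow> 'g bterm" where
  "BJoin ws = foldr (\<lambda>w t. BSup (BGen w) t) ws BBot"

definition F_rels :: "('x::order bterm \<times> 'x bterm) set" where
  "F_rels =
    {(BInf (BGen v) (BGen u), BGen v) | u v. u \<le> v} \<union>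
    {(BInf (BGen u) (BGen v), BJoin ws) | u v ws. set ws = nabla {u, v}} \<union>
    {(BTop, BJoin ws) | ws. set ws = nabla {}}"

quotient_type FX = "X bterm" / "bcong F_rels" morphisms bterm_of FX_of
  by (rule equivp_bcong)

instantiation FX :: boolean_algebra
begin

lift_definition bot_FX :: FX is BBot .
lift_definition top_FX :: FX is BTop .
lift_definition uminus_FX :: "FX \<Rightarrow> FX" is BCompl by (rule bcong.compl_cong)
lift_definition sup_FX :: "FX \<Rightarrow> FX \<Rightarrow> FX" is BSup by (rule bcong.sup_cong)
lift_definition inf_FX :: "FX \<Rightarrow> FX \<Rightarrow> FX" is BInf by (rule bcong.inf_cong)
definition minus_FX :: "FX \<Rightarrow> FX \<Rightarrow> FX" where "minus_FX x y = inf x (- y)"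
definition less_eq_FX :: "FX \<Rightarrow> FX \<Rightarrow> bool" where "less_eq_FX x y \<longleftrightarrow> inf x y = x"
definition less_FX :: "FX \<Rightarrow> FX \<Rightarrow> bool" where "less_FX x y \<longleftrightarrow> x \<le> y \<and> \<not> y \<le> x"

instance
proof
  fix x y z :: FX
  have ia: "inf (inf x y) z = inf x (inf y z)" for x y z :: FX
    by transfer (rule bcong.inf_assoc)
  have ic: "inf x y = inf y x" for x y :: FX
    by transfer (rule bcong.inf_comm)
  have sa: "sup (sup x y) z = sup x (sup y z)" for x y z :: FX
    by transfer (rule bcong.sup_assoc)
  have sc: "sup x y = sup y x" for x y :: FX
    by transfer (rule bcong.sup_comm)
  have si: "sup x (inf x y) = x" for x y :: FX
    by transfer (rule bcong.sup_absorb)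
  have ab: "inf x (sup x y) = x" for x y :: FX
    by transfer (rule bcong.inf_absorb)
  have ii: "inf x x = x" for x :: FX
    by (metis si ab)
  have le_sup: "x \<le> y \<longleftrightarrow> sup x y = y" for x y :: FX
    unfolding less_eq_FX_def by (metis ic sc si ab)
  have sb: "sup x bot = x" for x :: FX
    by transfer (rule bcong.sup_bot)
  show "x < y \<longleftrightarrow> x \<le> y \<and> \<not> y \<le> x" by (rule less_FX_def)
  show "x \<le> x" by (simp add: less_eq_FX_def ii)
  show "x \<le> y \<Longrightarrow> y \<le> z \<Longrightarrow> x \<le> z" unfolding less_eq_FX_def by (metis ia)
  show "x \<le> y \<Longrightarrow> y \<le> x \<Longrightarrow> x = y" unfolding less_eq_FX_def by (metis ic)
  show "inf x y \<le> x" unfolding less_eq_FX_def by (metis ia ic ii)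
  show "inf x y \<le> y" unfolding less_eq_FX_def by (metis ia ii)
  show "x \<le> y \<Longrightarrow> x \<le> z \<Longrightarrow> x \<le> inf y z" unfolding less_eq_FX_def by (metis ia)
  show "x \<le> sup x y" unfolding less_eq_FX_def by (rule ab)
  show "y \<le> sup x y" unfolding less_eq_FX_def by (metis ab sc)
  show "y \<le> x \<Longrightarrow> z \<le> x \<Longrightarrow> sup y z \<le> x" unfolding le_sup by (metis sa)
  show "bot \<le> x" unfolding le_sup by (metis sb sc)
  show "x \<le> top" unfolding less_eq_FX_def by transfer (rule bcong.inf_top)
  show "sup x (inf y z) = inf (sup x y) (sup x z)" by transfer (rule bcong.sup_distrib)
  show "inf x (- x) = bot" by transfer (rule bcong.inf_compl)
  show "sup x (- x) = top" by transfer (rule bcong.sup_compl)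
  show "x - y = inf x (- y)" by (rule minus_FX_def)
qed

end

definition gen_FX :: "X \<Rightarrow> FX" where
  "gen_FX u = FX_of (BGen u)"

definition scaled_FX :: "(FX, P) scaled" where
  "scaled_FX = \<lparr>univ = UNIV, scale = (\<lambda>p. bool_ideal UNIV hull {gen_FX u | u. p \<le> bd u})\<rparr>"

end

theory Submission
  imports Defs
begin

text \<open>
  Sending an ideal of \<open>A\<^sub>p\<close> to the ideal of \<open>A\<^sub>1\<^sub>2\<^sub>3\<close> that it generates embeds each
  \<open>Id\<^sub>c A\<^sub>p\<close> into \<open>Id\<^sub>c A\<^sub>1\<^sub>2\<^sub>3\<close> and turns all arrows of the diagram into inclusions, because
  \<open>a\<close> and \<open>a'\<close> generate the same ideal.  An element of \<open>X\<close> is determined by its partial map, and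
  \<open>F(X)\<close> is the algebra of subsets of \<open>X\<close> generated by the principal upper sets.  Thus the condensate
  consists of step functions \<open>X \<rightarrow> Id\<^sub>c A\<^sub>1\<^sub>2\<^sub>3\<close> whose value on each piece lies in the lattice
  of the label of that piece.  Complete normality and the countably based differences are inherited
  piecewise from the \<open>Id\<^sub>c A\<^sub>p\<close>.

  Given a Cevian operation, apply it to the characteristic functions with values \<open>a\<close>, \<open>b\<close>, \<open>c\<close>
  on the upper sets of \<open>1 \<mapsto> \<xi>\<^sub>1\<close>, \<open>2 \<mapsto> \<xi>\<^sub>2\<close>, \<open>3 \<mapsto> \<xi>\<^sub>3\<close>.  Each of the resulting
  differences involves only finitely many elements of \<open>\<omega>\<^sub>2\<close>, so by Kuratowski's free set theorem
  the \<open>\<xi>\<^sub>i\<close> can be chosen such that the difference for \<open>i\<close>, \<open>j\<close>, evaluated at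
  \<open>(\<xi>\<^sub>1, \<xi>\<^sub>2, \<xi>\<^sub>3)\<close>, comes from \<open>A\<^sub>i\<^sub>j\<close>.  Evaluating ideals at the points of the cone
  \<open>0 \<le> a \<le> a' \<le> 2 a\<close>, \<open>0 \<le> b, c\<close> then gives a contradiction.
\<close>

section \<open>Principal ideals\<close>

text \<open>Each \<open>Idc (A_obj p)\<close> alone is Cevian: with a nonnegative generator chosen
  for every ideal, the positive part of x - y supplies the differences. The obstruction lies in the
  gluing. The pair 12 sees the first generator as \<open>ga\<close>, the pair 13 as
  \<open>ga'\<close>. The ideals coincide, so the lattices cannot tell, but a Cevian operation
  implicitly compares sizes. Its triangle law, used once at each of two points of the cone that
  differ only in the value of a, carries information from 12 to 13 and back.

  To extract elements of A_12, A_13 and A_23 from one operation on step functions, all differences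
  are evaluated at one map defined on the three singletons. If \<xi>3 avoids a finite support,
  removing it from that map does not leave the current piece, and the label of a piece lies below
  the index of each of its points; so the value belongs to A_12. Three such omissions must be
  possible at once, against finite sets attached to pairs, and this is the case of the free set
  theorem that is available at aleph_2.\<close>

definition nmult :: "nat \<Rightarrow> 'a::comm_monoid_add \<Rightarrow> 'a" where
  "nmult n x = (\<Sum>i<n. x)"

lemma nmult_0 [simp]: "nmult 0 x = 0"
  and nmult_Suc [simp]: "nmult (Suc n) x = nmult n x + x"
  by (simp_all add: nmult_def)

lemma nmult_add: "nmult (m + n) x = nmult m x + nmult n x"
  by (induction n) (auto simp: add.assoc)

lemma nmult_distrib: "nmult n (x + y) = nmult n x + nmult n y"
  by (induction n) (auto simp: ac_simps)

lemma nmult_mult: "nmult m (nmult n x) = nmult (m * n) x"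
  by (induction m) (auto simp: nmult_add add.commute)

lemma nmult_mono:
  fixes x y :: "'a::ordered_comm_monoid_add"
  shows "x \<le> y \<Longrightarrow> nmult n x \<le> nmult n y"
  by (induction n) (auto intro: add_mono)

lemma nmult_nonneg:
  fixes x :: "'a::ordered_comm_monoid_add"
  shows "0 \<le> x \<Longrightarrow> 0 \<le> nmult n x"
  by (induction n) (auto intro: add_nonneg_nonneg)

lemma nmult_mono_left:
  fixes x :: "'a::ordered_comm_monoid_add"
  assumes "0 \<le> x" "m \<le> n"
  shows "nmult m x \<le> nmult n x"
proof -
  obtain k where "n = m + k" using assms(2) le_Suc_ex by blast
  then show ?thesis
    using add_mono[OF order_refl nmult_nonneg[OF assms(1), of k], of "nmult m x"]
    by (simp add: nmult_add)
qed

text \<open>Expanding the right side gives the meet of \<open>x + x\<close>, \<open>y + x\<close>,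
  \<open>x + z\<close> and \<open>y + z\<close>; the first three lie above \<open>x\<close>.\<close>

lemma inf_add_le:
  fixes x y z :: "'a::lattice_ab_group_add"
  assumes "0 \<le> x" "0 \<le> y" "0 \<le> z"
  shows "inf x (y + z) \<le> inf x y + inf x z"
proof -
  have "inf x y + inf x z = inf (inf (x + x) (y + x)) (inf (x + z) (y + z))"
    by (simp add: add_inf_distrib_left add_inf_distrib_right)
  moreover have "x \<le> x + x" "x \<le> y + x" "x \<le> x + z"
    using assms by auto
  ultimately show ?thesis
    by (auto intro: le_infI1 le_infI2)
qed

lemma inf_nmult_le:
  fixes x y :: "'a::lattice_ab_group_add"
  assumes "0 \<le> x" "0 \<le> y"
  shows "inf x (nmult n y) \<le> nmult n (inf x y)"
proof (induction n)
  case (Suc n)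
  have "inf x (nmult n y + y) \<le> inf x (nmult n y) + inf x y"
    using assms by (intro inf_add_le nmult_nonneg)
  also have "\<dots> \<le> nmult n (inf x y) + inf x y"
    using Suc by (rule add_right_mono)
  finally show ?case by simp
qed (use assms in auto)

text \<open>Makes the intersection of two principal ideals principal, generated by the meet of the
  absolute values.\<close>

lemma inf_nmult_nmult_le:
  fixes x y :: "'a::lattice_ab_group_add"
  assumes "0 \<le> x" "0 \<le> y"
  shows "inf (nmult m x) (nmult n y) \<le> nmult (n * m) (inf x y)"
proof -
  have "inf (nmult m x) (nmult n y) \<le> nmult n (inf (nmult m x) y)"
    using assms by (intro inf_nmult_le nmult_nonneg)
  also have "inf (nmult m x) y \<le> nmult m (inf x y)"
    using inf_nmult_le[of y x m] assms by (simp add: inf_commute)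
  finally show ?thesis by (metis nmult_mono nmult_mult order.trans)
qed

lemma principal_lideal_nmult:
  "principal_lideal G x = {y \<in> G. \<exists>n. \<bar>y\<bar> \<le> nmult n \<bar>x\<bar>}"
  by (simp add: principal_lideal_def nmult_def)

lemma principal_lideal_self: "x \<in> G \<Longrightarrow> x \<in> principal_lideal G x"
  unfolding principal_lideal_nmult by (auto intro: exI[of _ 1])

text \<open>The criterion on the right does not mention \<open>G\<close>: this is what allows ideals
  of a subgroup to be compared inside the whole group.\<close>

lemma principal_lideal_subset_iff:
  fixes x y :: "'g::lattice_ab_group_add_abs"
  assumes "x \<in> G"
  shows "principal_lideal G x \<subseteq> principal_lideal G y \<longleftrightarrow> (\<exists>n. \<bar>x\<bar> \<le> nmult n \<bar>y\<bar>)"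
proof
  assume "principal_lideal G x \<subseteq> principal_lideal G y"
  then show "\<exists>n. \<bar>x\<bar> \<le> nmult n \<bar>y\<bar>"
    using principal_lideal_self[OF assms] by (auto simp: principal_lideal_nmult)
next
  assume "\<exists>n. \<bar>x\<bar> \<le> nmult n \<bar>y\<bar>"
  then obtain n where n: "\<bar>x\<bar> \<le> nmult n \<bar>y\<bar>" ..
  show "principal_lideal G x \<subseteq> principal_lideal G y"
    unfolding principal_lideal_nmult
  proof clarify
    fix z m assume "\<bar>z\<bar> \<le> nmult m \<bar>x\<bar>"
    also have "\<dots> \<le> nmult (m * n) \<bar>y\<bar>"
      using nmult_mono[OF n, of m] by (simp add: nmult_mult)
    finally show "\<exists>n. \<bar>z\<bar> \<le> nmult n \<bar>y\<bar>" ..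
  qed
qed

section \<open>The distributive lattice of principal ideals of a whole group\<close>

typedef (overloaded) 'g pideal = "range (principal_lideal (UNIV :: 'g::lattice_ab_group_add_abs set))"
  by blast

definition pid :: "'g::lattice_ab_group_add_abs \<Rightarrow> 'g pideal" where
  "pid x = Abs_pideal (principal_lideal UNIV x)"

text \<open>An arbitrary generator. The lattice operations are defined through it, and
  \<open>pid_sup\<close> and \<open>pid_inf\<close> show that the choice is immaterial.\<close>

definition pgen :: "'g::lattice_ab_group_add_abs pideal \<Rightarrow> 'g" where
  "pgen J = (SOME x. J = pid x)"

lemma Rep_pid: "Rep_pideal (pid x) = principal_lideal UNIV x"
  by (simp add: pid_def Abs_pideal_inverse)

lemma pid_surj: "\<exists>x. J = pid x"
  by (metis Rep_pideal Rep_pideal_inverse imageE pid_def)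

lemma pid_pgen [simp]: "pid (pgen J) = J"
  unfolding pgen_def by (metis (mono_tags) pid_surj someI_ex)

instantiation pideal :: (lattice_ab_group_add_abs) "{lattice, order_bot}"
begin

definition less_eq_pideal :: "'a pideal \<Rightarrow> 'a pideal \<Rightarrow> bool" where
  "J \<le> K \<longleftrightarrow> Rep_pideal J \<subseteq> Rep_pideal K"
definition less_pideal :: "'a pideal \<Rightarrow> 'a pideal \<Rightarrow> bool" where
  "J < K \<longleftrightarrow> J \<le> K \<and> \<not> K \<le> (J :: 'a pideal)"
definition bot_pideal :: "'a pideal" where "bot_pideal = pid 0"
definition sup_pideal :: "'a pideal \<Rightarrow> 'a pideal \<Rightarrow> 'a pideal" where
  "sup_pideal J K = pid (\<bar>pgen J\<bar> + \<bar>pgen K\<bar>)"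
definition inf_pideal :: "'a pideal \<Rightarrow> 'a pideal \<Rightarrow> 'a pideal" where
  "inf_pideal J K = pid (inf \<bar>pgen J\<bar> \<bar>pgen K\<bar>)"

lemma pid_le_iff: "pid x \<le> pid y \<longleftrightarrow> (\<exists>n. \<bar>x\<bar> \<le> nmult n \<bar>y\<bar>)" for x y :: 'a
  unfolding less_eq_pideal_def Rep_pid by (simp add: principal_lideal_subset_iff)

lemma pid_leI: "\<bar>x\<bar> \<le> \<bar>y\<bar> \<Longrightarrow> pid x \<le> pid y" for x y :: 'a
  unfolding pid_le_iff by (auto intro: exI[of _ 1])

lemma pid_add_le: "pid x \<le> K \<Longrightarrow> pid y \<le> K \<Longrightarrow> pid (\<bar>x\<bar> + \<bar>y\<bar>) \<le> K" for x y :: 'a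
proof -
  assume "pid x \<le> K" "pid y \<le> K"
  then obtain m n where "\<bar>x\<bar> \<le> nmult m \<bar>pgen K\<bar>" "\<bar>y\<bar> \<le> nmult n \<bar>pgen K\<bar>"
    by (metis pid_le_iff pid_pgen)
  then have "\<bar>\<bar>x\<bar> + \<bar>y\<bar>\<bar> \<le> nmult (m + n) \<bar>pgen K\<bar>"
    by (simp add: nmult_add add_mono)
  then show "pid (\<bar>x\<bar> + \<bar>y\<bar>) \<le> K" by (metis pid_le_iff pid_pgen)
qed

lemma pid_le_inf: "K \<le> pid x \<Longrightarrow> K \<le> pid y \<Longrightarrow> K \<le> pid (inf \<bar>x\<bar> \<bar>y\<bar>)" for x y :: 'a
proof -
  assume "K \<le> pid x" "K \<le> pid y"
  then obtain m n where "\<bar>pgen K\<bar> \<le> nmult m \<bar>x\<bar>" "\<bar>pgen K\<bar> \<le> nmult n \<bar>y\<bar>"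
    by (metis pid_le_iff pid_pgen)
  then have "\<bar>pgen K\<bar> \<le> inf (nmult m \<bar>x\<bar>) (nmult n \<bar>y\<bar>)" by simp
  also have "\<dots> \<le> nmult (n * m) (inf \<bar>x\<bar> \<bar>y\<bar>)"
    by (intro inf_nmult_nmult_le) auto
  also have "inf \<bar>x\<bar> \<bar>y\<bar> = \<bar>inf \<bar>x\<bar> \<bar>y\<bar>\<bar>" by simp
  finally show "K \<le> pid (inf \<bar>x\<bar> \<bar>y\<bar>)" by (metis pid_le_iff pid_pgen)
qed

instance
proof
  fix J K L :: "'a pideal"
  show "J < K \<longleftrightarrow> J \<le> K \<and> \<not> K \<le> J" by (rule less_pideal_def)
  show "J \<le> J" by (simp add: less_eq_pideal_def)
  show "J \<le> K \<Longrightarrow> K \<le> L \<Longrightarrow> J \<le> L" by (auto simp: less_eq_pideal_def)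
  show "J \<le> K \<Longrightarrow> K \<le> J \<Longrightarrow> J = K" by (simp add: less_eq_pideal_def Rep_pideal_inject[symmetric])
  show "J \<le> sup J K" "K \<le> sup J K"
    using pid_leI[of "pgen J" "\<bar>pgen J\<bar> + \<bar>pgen K\<bar>"] pid_leI[of "pgen K" "\<bar>pgen J\<bar> + \<bar>pgen K\<bar>"]
    by (simp_all add: sup_pideal_def)
  show "inf J K \<le> J" "inf J K \<le> K"
    using pid_leI[of "inf \<bar>pgen J\<bar> \<bar>pgen K\<bar>" "pgen J"] pid_leI[of "inf \<bar>pgen J\<bar> \<bar>pgen K\<bar>" "pgen K"]
    by (simp_all add: inf_pideal_def)
  show "K \<le> J \<Longrightarrow> L \<le> J \<Longrightarrow> sup K L \<le> J"
    using pid_add_le[of "pgen K" J "pgen L"] by (simp add: sup_pideal_def)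
  show "J \<le> K \<Longrightarrow> J \<le> L \<Longrightarrow> J \<le> inf K L"
    using pid_le_inf[of J "pgen K" "pgen L"] by (simp add: inf_pideal_def)
  show "bot \<le> J"
    using pid_leI[of 0 "pgen J"] by (simp add: bot_pideal_def)
qed

end

lemma pid_abs: "pid \<bar>x\<bar> = pid x"
  by (intro order.antisym pid_leI) auto

lemma pid_uminus: "pid (- x) = pid x"
  using pid_abs[of x] pid_abs[of "- x"] by simp

lemma pid_sup: "sup (pid x) (pid y) = pid (\<bar>x\<bar> + \<bar>y\<bar>)"
  by (intro order.antisym sup_least pid_add_le sup_ge1 sup_ge2 pid_leI) auto

lemma pid_inf: "inf (pid x) (pid y) = pid (inf \<bar>x\<bar> \<bar>y\<bar>)"
  by (intro order.antisym pid_le_inf inf_greatest inf_le1 inf_le2 pid_leI) auto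

instance pideal :: (lattice_ab_group_add_abs) distrib_lattice
proof
  fix J K L :: "'a pideal"
  have "inf J (sup K L) = sup (inf J K) (inf J L)" for J K L :: "'a pideal"
  proof (rule order.antisym)
    obtain x y z where J: "J = pid x" "K = pid y" "L = pid z"
      using pid_surj by metis
    have "inf \<bar>x\<bar> (\<bar>y\<bar> + \<bar>z\<bar>) \<le> inf \<bar>x\<bar> \<bar>y\<bar> + inf \<bar>x\<bar> \<bar>z\<bar>"
      by (intro inf_add_le) auto
    then show "inf J (sup K L) \<le> sup (inf J K) (inf J L)"
      unfolding J pid_sup pid_inf by (intro pid_leI) simp
  qed (simp add: le_infI2)
  then show "sup J (inf K L) = inf (sup J K) (sup J L)"
    by (rule distrib_imp1)
qed

lemma pid_le_sup_iff: "pid x \<le> sup (pid y) (pid z) \<longleftrightarrow> (\<exists>n. \<bar>x\<bar> \<le> nmult n \<bar>y\<bar> + nmult n \<bar>z\<bar>)"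
  unfolding pid_sup pid_le_iff by (simp add: nmult_distrib)

section \<open>Subgroups and their principal ideals\<close>

lemma lsubgroup_hull: "lsubgroup (lsubgroup hull S)"
  by (rule hull_in) (simp add: lsubgroup_def Ball_def)

lemma lsubgroup_nmult: "lsubgroup H \<Longrightarrow> x \<in> H \<Longrightarrow> nmult n x \<in> H"
  by (induction n) (auto simp: lsubgroup_def)

lemma lsubgroup_minus: "lsubgroup H \<Longrightarrow> x \<in> H \<Longrightarrow> y \<in> H \<Longrightarrow> x - y \<in> H"
  unfolding lsubgroup_def by (metis add_uminus_conv_diff)

lemma abs_eq_sup_uminus: "\<bar>x\<bar> = sup x (- x)" for x :: "'g::lattice_ab_group_add_abs"
  by (rule abs_lattice)

lemma lsubgroup_abs: "lsubgroup H \<Longrightarrow> x \<in> H \<Longrightarrow> \<bar>x\<bar> \<in> H" for x :: "'g::lattice_ab_group_add_abs"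
  unfolding abs_eq_sup_uminus by (simp add: lsubgroup_def)

text \<open>The convex closure of \<open>J\<close> in the whole group. It involves no generator, so
  it is visibly a function of the ideal; it is again principal whenever \<open>J\<close> is
  principal in a subgroup.\<close>

definition emb :: "'g::lattice_ab_group_add_abs set \<Rightarrow> 'g pideal" where
  "emb J = Abs_pideal {y. \<exists>x\<in>J. \<bar>y\<bar> \<le> \<bar>x\<bar>}"

lemma emb_principal_lideal:
  fixes x :: "'g::lattice_ab_group_add_abs"
  assumes "lsubgroup H" "x \<in> H"
  shows "emb (principal_lideal H x) = pid x"
proof -
  have "{y. \<exists>z\<in>principal_lideal H x. \<bar>y\<bar> \<le> \<bar>z\<bar>} = principal_lideal UNIV x"
  proof (intro equalityI subsetI)
    fix y assume "y \<in> {y. \<exists>z\<in>principal_lideal H x. \<bar>y\<bar> \<le> \<bar>z\<bar>}"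
    then show "y \<in> principal_lideal UNIV x"
      unfolding principal_lideal_nmult by (auto intro: order.trans)
  next
    fix y assume "y \<in> principal_lideal UNIV x"
    then obtain n where n: "\<bar>y\<bar> \<le> nmult n \<bar>x\<bar>"
      unfolding principal_lideal_nmult by auto
    \<comment> \<open>The multiple itself lies in \<open>H\<close>, so it is the element of the
      ideal of \<open>H\<close> that dominates \<open>y\<close>.\<close>
    have "nmult n \<bar>x\<bar> \<in> H"
      using assms by (intro lsubgroup_nmult lsubgroup_abs)
    moreover have "\<bar>nmult n \<bar>x\<bar>\<bar> = nmult n \<bar>x\<bar>"
      by (simp add: nmult_nonneg)
    ultimately show "y \<in> {y. \<exists>z\<in>principal_lideal H x. \<bar>y\<bar> \<le> \<bar>z\<bar>}"
      unfolding principal_lideal_nmult using n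
      by (auto intro!: exI[of _ "nmult n \<bar>x\<bar>"])
  qed
  then show ?thesis by (simp add: emb_def pid_def)
qed

lemma emb_le_iff:
  assumes "lsubgroup H" "J \<in> carrier (Idc H)" "K \<in> carrier (Idc H)"
  shows "emb J \<le> emb K \<longleftrightarrow> J \<subseteq> K"
proof -
  obtain x y where "x \<in> H" "J = principal_lideal H x" "y \<in> H" "K = principal_lideal H y"
    using assms by (auto simp: Idc_def)
  then show ?thesis
    using assms(1) by (simp only: emb_principal_lideal pid_le_iff principal_lideal_subset_iff)
qed

lemma emb_eq_iff:
  assumes "lsubgroup H" "J \<in> carrier (Idc H)" "K \<in> carrier (Idc H)"
  shows "emb J = emb K \<longleftrightarrow> J = K"
  using emb_le_iff[OF assms] emb_le_iff[OF assms(1,3,2)] by (simp add: order.eq_iff)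

lemma emb_image_Idc: "lsubgroup H \<Longrightarrow> emb ` carrier (Idc H) = pid ` H"
  by (auto simp: Idc_def emb_principal_lideal image_image)

lemma pid_sup_in:
  assumes "lsubgroup H" "s \<in> pid ` H" "t \<in> pid ` H"
  shows "sup s t \<in> pid ` H"
  using assms by (auto simp: pid_sup) (metis imageI lsubgroup_abs lsubgroup_def)

lemma pid_inf_in:
  assumes "lsubgroup H" "s \<in> pid ` H" "t \<in> pid ` H"
  shows "inf s t \<in> pid ` H"
  using assms by (auto simp: pid_inf) (metis imageI lsubgroup_abs lsubgroup_def)

lemma pid_bot_in: "lsubgroup H \<Longrightarrow> bot \<in> pid ` H"
  by (auto simp: bot_pideal_def lsubgroup_def)

text \<open>Subtracting the common part \<open>z\<close> from both absolute values leaves two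
  orthogonal elements, since meets commute with translations; they are the positive and the negative
  part of the difference.\<close>

lemma pid_completely_normal:
  assumes H: "lsubgroup H" and "s \<in> pid ` H" "t \<in> pid ` H"
  shows "\<exists>u\<in>pid ` H. \<exists>v\<in>pid ` H. s \<le> sup t u \<and> t \<le> sup s v \<and> inf u v = bot"
proof -
  obtain x y where xy: "x \<in> H" "y \<in> H" "s = pid x" "t = pid y" using assms by auto
  define z where "z = inf \<bar>x\<bar> \<bar>y\<bar>"
  have zH: "z \<in> H" using xy H lsubgroup_abs[OF H] by (auto simp: z_def lsubgroup_def)
  have "z \<le> \<bar>x\<bar>" "z \<le> \<bar>y\<bar>" by (simp_all add: z_def)
  then have nn: "0 \<le> \<bar>x\<bar> - z" "0 \<le> \<bar>y\<bar> - z" by (simp_all only: diff_ge_0_iff_ge)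
  have "pid x \<le> sup (pid y) (pid (\<bar>x\<bar> - z))" "pid y \<le> sup (pid x) (pid (\<bar>y\<bar> - z))"
  proof -
    have "\<bar>x\<bar> \<le> \<bar>y\<bar> + (\<bar>x\<bar> - z)" "\<bar>y\<bar> \<le> \<bar>x\<bar> + (\<bar>y\<bar> - z)"
      using \<open>z \<le> \<bar>x\<bar>\<close> \<open>z \<le> \<bar>y\<bar>\<close> by (metis add.commute add_diff_eq add_le_cancel_left le_diff_eq)+
    then show "pid x \<le> sup (pid y) (pid (\<bar>x\<bar> - z))" "pid y \<le> sup (pid x) (pid (\<bar>y\<bar> - z))"
      unfolding pid_le_sup_iff abs_of_nonneg[OF nn(1)] abs_of_nonneg[OF nn(2)]
      by (auto intro!: exI[of _ 1])
  qed
  moreover have "inf (pid (\<bar>x\<bar> - z)) (pid (\<bar>y\<bar> - z)) = bot"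
  proof -
    have "inf (\<bar>x\<bar> - z) (\<bar>y\<bar> - z) = inf \<bar>x\<bar> \<bar>y\<bar> - z"
      unfolding diff_conv_add_uminus by (rule add_inf_distrib_right[symmetric])
    then have "inf (\<bar>x\<bar> - z) (\<bar>y\<bar> - z) = 0" by (simp only: z_def diff_self)
    then show ?thesis
      unfolding pid_inf bot_pideal_def abs_of_nonneg[OF nn(1)] abs_of_nonneg[OF nn(2)] by simp
  qed
  moreover have "\<bar>x\<bar> - z \<in> H" "\<bar>y\<bar> - z \<in> H"
    using lsubgroup_abs[OF H] lsubgroup_minus[OF H] xy zH by auto
  ultimately show ?thesis unfolding xy by blast
qed

text \<open>The witness is \<open>(\<bar>a\<bar> - n \<bar>b\<bar>)\<^sup>+\<close> for large \<open>n\<close>.\<close>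

lemma pid_difference_in_subgroup:
  assumes H: "lsubgroup H" and "s \<in> pid ` H" "t \<in> pid ` H" and le: "s \<le> sup t K"
  shows "\<exists>u\<in>pid ` H. s \<le> sup t u \<and> u \<le> K"
proof -
  obtain a b where ab: "a \<in> H" "b \<in> H" "s = pid a" "t = pid b" using assms by auto
  obtain k where k: "K = pid k" using pid_surj by blast
  obtain n where n: "\<bar>a\<bar> \<le> nmult n \<bar>b\<bar> + nmult n \<bar>k\<bar>"
    using le unfolding ab k pid_le_sup_iff by blast
  define x where "x = sup (\<bar>a\<bar> - nmult n \<bar>b\<bar>) 0"
  have "x \<in> H"
    using ab H lsubgroup_abs[OF H] lsubgroup_nmult[OF H] lsubgroup_minus[OF H]
    by (auto simp: x_def lsubgroup_def)
  moreover have x0: "0 \<le> x" by (simp add: x_def)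
  have "pid x \<le> pid k"
  proof -
    have "x \<le> nmult n \<bar>k\<bar>"
      using n unfolding x_def by (intro sup_least nmult_nonneg) (simp_all add: algebra_simps)
    then show ?thesis unfolding pid_le_iff using x0 by auto
  qed
  moreover have "pid a \<le> sup (pid b) (pid x)"
  proof -
    \<comment> \<open>Both coefficients in \<open>pid_le_sup_iff\<close> must agree, and the one of
      \<open>x\<close> has to be at least 1 even when \<open>n\<close> is 0.\<close>
    define m where "m = max n 1"
    have "\<bar>a\<bar> - nmult n \<bar>b\<bar> \<le> x" by (simp add: x_def)
    then have "\<bar>a\<bar> \<le> nmult n \<bar>b\<bar> + x" by (simp add: algebra_simps)
    also have "\<dots> \<le> nmult m \<bar>b\<bar> + nmult m x"
      using nmult_mono_left[of "\<bar>b\<bar>" n m] nmult_mono_left[OF x0, of 1 m]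
      by (intro add_mono) (auto simp: m_def)
    finally show ?thesis unfolding pid_le_sup_iff using x0 by auto
  qed
  ultimately show ?thesis unfolding ab k by blast
qed

text \<open>The bounds \<open>K\<close> need not be generated in \<open>H\<close>. By distributivity
  the meet of the separate witnesses is again a witness; with no bound at all, \<open>s\<close>
  itself serves.\<close>

lemma pid_common_difference_in_subgroup:
  assumes H: "lsubgroup H" and st: "s \<in> pid ` H" "t \<in> pid ` H"
    and "finite \<K>" "\<And>K. K \<in> \<K> \<Longrightarrow> s \<le> sup t K"
  shows "\<exists>u\<in>pid ` H. s \<le> sup t u \<and> (\<forall>K\<in>\<K>. u \<le> K)"
  using assms(4,5)
proof (induction \<K> rule: finite_induct)
  case empty
  then show ?case using st(1) sup_ge2[of s t] by (intro bexI[of _ s]) auto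
next
  case (insert K \<K>)
  then obtain u where u: "u \<in> pid ` H" "s \<le> sup t u" "\<forall>K\<in>\<K>. u \<le> K" by auto
  obtain v where v: "v \<in> pid ` H" "s \<le> sup t v" "v \<le> K"
    using pid_difference_in_subgroup[OF H st, of K] insert.prems by auto
  have "s \<le> sup t (inf u v)"
    using u v by (simp add: sup_inf_distrib1)
  moreover have "inf u v \<le> L" if "L \<in> insert K \<K>" for L
    using that u(3) v(3) by (auto intro: le_infI1 le_infI2)
  ultimately show ?case
    using pid_inf_in[OF H u(1) v(1)] by blast
qed


section \<open>The diagram of subgroups\<close>

primrec leval :: "('g \<Rightarrow> real) \<Rightarrow> 'g lterm \<Rightarrow> real" where
  "leval v (LGen g) = v g"
| "leval v LZero = 0"
| "leval v (LPlus s t) = leval v s + leval v t"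
| "leval v (LNeg s) = - leval v s"
| "leval v (LSup s t) = max (leval v s) (leval v t)"
| "leval v (LInf s t) = min (leval v s) (leval v t)"

lemma leval_lcong:
  assumes "\<And>s t. (s, t) \<in> R \<Longrightarrow> leval v s = leval v t" "lcong R s t"
  shows "leval v s = leval v t"
  using assms(2,1) by (induction rule: lcong.induct) (auto simp: max_def min_def)

definition cone :: "(gen \<Rightarrow> real) \<Rightarrow> bool" where
  "cone v \<longleftrightarrow> 0 \<le> v Gen_a \<and> v Gen_a \<le> v Gen_a' \<and> v Gen_a' \<le> 2 * v Gen_a \<and> 0 \<le> v Gen_b \<and> 0 \<le> v Gen_c"

definition ev :: "(gen \<Rightarrow> real) \<Rightarrow> A123 \<Rightarrow> real" where
  "ev v x = leval v (lterm_of x)"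

lemma A123_of_lterm_of: "A123_of (lterm_of x) = x"
  by (rule Quotient_abs_rep[OF Quotient_A123])

lemma A123_cases: obtains s where "x = A123_of s"
  by (metis A123_of_lterm_of)

context
  fixes v assumes v: "cone v"
begin

text \<open>The reals form an Abelian l-group in which the defining relations hold at every point of
  the cone, so evaluation respects the congruence.\<close>

lemma ev_A123_of: "ev v (A123_of s) = leval v s"
proof -
  have "lcong A123_rels (lterm_of (A123_of s)) s"
    by (rule Quotient_rep_abs[OF Quotient_A123]) (rule lcong.refl)
  then show ?thesis
    unfolding ev_def
    by (rule leval_lcong[rotated]) (use v in \<open>auto simp: A123_rels_def cone_def min_def\<close>)
qed

lemma ev_0: "ev v 0 = 0"
  by (simp add: zero_A123_def ev_A123_of)

lemma ev_plus: "ev v (x + y) = ev v x + ev v y"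
  by (cases x rule: A123_cases; cases y rule: A123_cases) (simp add: plus_A123.abs_eq ev_A123_of)

lemma ev_uminus: "ev v (- x) = - ev v x"
  by (cases x rule: A123_cases) (simp add: uminus_A123.abs_eq ev_A123_of)

lemma ev_sup: "ev v (sup x y) = max (ev v x) (ev v y)"
  by (cases x rule: A123_cases; cases y rule: A123_cases) (simp add: sup_A123.abs_eq ev_A123_of)

lemma ev_inf: "ev v (inf x y) = min (ev v x) (ev v y)"
  by (cases x rule: A123_cases; cases y rule: A123_cases) (simp add: inf_A123.abs_eq ev_A123_of)

lemma ev_minus: "ev v (x - y) = ev v x - ev v y"
  by (simp only: minus_A123_def ev_plus ev_uminus diff_conv_add_uminus)

lemma ev_abs: "ev v \<bar>x\<bar> = \<bar>ev v x\<bar>"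
  by (simp add: abs_A123_def ev_sup ev_uminus abs_if max_def)

lemma ev_nmult: "ev v (nmult n x) = real n * ev v x"
  by (induction n) (auto simp: ev_0 ev_plus algebra_simps)

lemma ev_mono: "x \<le> y \<Longrightarrow> ev v x \<le> ev v y"
  by (metis ev_inf inf.absorb_iff1 min.cobounded2)

lemma ev_gen: "ev v (gen_A123 g) = v g"
  by (simp add: gen_A123_def ev_A123_of)

text \<open>Whether an element vanishes at a point depends only on its ideal, although its value
  there does not. Every passage from ideals to numbers rests on this.\<close>

lemma ev_nonzero_mono: "pid x \<le> pid y \<Longrightarrow> ev v x \<noteq> 0 \<Longrightarrow> ev v y \<noteq> 0"
  unfolding pid_le_iff using ev_mono[of "\<bar>x\<bar>" "nmult n \<bar>y\<bar>" for n]
  by (force simp: ev_abs ev_nmult)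

end

lemma gen_rel:
  assumes "(s, t) \<in> {(LZero, LGen Gen_a), (LGen Gen_a, LGen Gen_a'),
    (LGen Gen_a', LPlus (LGen Gen_a) (LGen Gen_a)), (LZero, LGen Gen_b), (LZero, LGen Gen_c)}"
  shows "A123_of s \<le> A123_of t"
proof -
  have "(LInf s t, s) \<in> A123_rels" using assms unfolding A123_rels_def by blast
  then have "lcong A123_rels (LInf s t) s" by (rule lcong.rel)
  then show ?thesis
    unfolding less_eq_A123_def inf_A123.abs_eq A123.abs_eq_iff .
qed

lemma gen_rels:
  "0 \<le> gen_A123 Gen_a" "gen_A123 Gen_a \<le> gen_A123 Gen_a'"
  "gen_A123 Gen_a' \<le> gen_A123 Gen_a + gen_A123 Gen_a"
  "0 \<le> gen_A123 Gen_b" "0 \<le> gen_A123 Gen_c"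
  by (auto simp: gen_A123_def zero_A123_def plus_A123.abs_eq intro!: gen_rel)

abbreviation "ga \<equiv> gen_A123 Gen_a"
abbreviation "ga' \<equiv> gen_A123 Gen_a'"
abbreviation "gb \<equiv> gen_A123 Gen_b"
abbreviation "gc \<equiv> gen_A123 Gen_c"

lemma lsubgroup_A_obj: "lsubgroup (A_obj p)"
proof -
  have "lsubgroup ({0} :: A123 set)" "lsubgroup (UNIV :: A123 set)"
    by (auto simp: lsubgroup_def)
  then show ?thesis
    unfolding A_obj_def by (simp add: lsubgroup_hull)
qed

lemma A_obj_simps:
  "A_obj {} = {0}"
  "A_obj {I1} = lsubgroup hull {ga}"
  "A_obj {I2} = lsubgroup hull {gb}"
  "A_obj {I3} = lsubgroup hull {gc}"
  "A_obj {I1, I2} = lsubgroup hull {ga, gb}"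
  "A_obj {I1, I3} = lsubgroup hull {ga', gc}"
  "A_obj {I2, I3} = lsubgroup hull {gb, gc}"
  "A_obj {I1, I2, I3} = UNIV"
  by (simp_all add: A_obj_def doubleton_eq_iff insert_eq_iff)

lemma idx_set_cases:
  fixes p :: P
  shows "p \<in> {{}, {I1}, {I2}, {I3}, {I1, I2}, {I1, I3}, {I2, I3}, {I1, I2, I3}}"
proof -
  have "p \<subseteq> {I1, I2, I3}" using idx.exhaust by blast
  then have "p \<in> Pow {I1, I2, I3}" by simp
  then show ?thesis by (auto simp: Pow_insert)
qed

lemma gen_in_A_obj:
  "ga \<in> A_obj {I1}" "gb \<in> A_obj {I2}" "gc \<in> A_obj {I3}" "ga' \<in> A_obj {I1, I3}"
  unfolding A_obj_simps by (auto intro: hull_inc)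

section \<open>The group A_1 and its map into A_13\<close>

lemma A_obj_ga:
  assumes "x \<in> A_obj {I1}"
  obtains m n where "x = nmult m ga - nmult n ga"
proof -
  \<comment> \<open>Integer multiples of \<open>ga\<close>, written with two naturals. They form a
    chain, which is why they are closed under joins and meets.\<close>
  let ?H = "{nmult m ga - nmult n ga | m n. True}"
  have lin: "nmult m ga - nmult n ga \<le> nmult k ga - nmult l ga" if "m + l \<le> k + n" for m n k l
    using nmult_mono_left[OF gen_rels(1) that] by (simp add: nmult_add algebra_simps)
  have "lsubgroup ?H"
    unfolding lsubgroup_def
  proof (intro conjI ballI)
    show "0 \<in> ?H" by (auto intro!: exI[of _ 0])
    fix x assume "x \<in> ?H"
    then obtain m n where x: "x = nmult m ga - nmult n ga" by blast
    then show "- x \<in> ?H" by auto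
    fix y assume "y \<in> ?H"
    then obtain k l where y: "y = nmult k ga - nmult l ga" by blast
    have "x + y = nmult (m + k) ga - nmult (n + l) ga"
      unfolding x y nmult_add by simp
    then show "x + y \<in> ?H" by blast
    have "x \<le> y \<or> y \<le> x"
      unfolding x y using lin[of m l k n] lin[of k n m l] by linarith
    then have "sup x y \<in> {x, y}" "inf x y \<in> {x, y}"
      by (auto simp: sup.absorb1 sup.absorb2 inf.absorb1 inf.absorb2)
    then show "sup x y \<in> ?H" "inf x y \<in> ?H"
      unfolding x y by auto
  qed
  moreover have "ga \<in> ?H"
  proof -
    have "ga = nmult 1 ga - nmult 0 ga" by simp
    then show ?thesis by blast
  qed
  ultimately have "lsubgroup hull {ga} \<subseteq> ?H"
    by (intro hull_minimal) auto
  then show ?thesis using assms that unfolding A_obj_simps by blast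
qed

definition pt :: "real \<Rightarrow> real \<Rightarrow> real \<Rightarrow> real \<Rightarrow> gen \<Rightarrow> real" where
  "pt \<alpha> \<alpha>' \<beta> \<gamma> g = (case g of Gen_a \<Rightarrow> \<alpha> | Gen_a' \<Rightarrow> \<alpha>' | Gen_b \<Rightarrow> \<beta> | Gen_c \<Rightarrow> \<gamma>)"

lemma pt_simps [simp]:
  "pt \<alpha> \<alpha>' \<beta> \<gamma> Gen_a = \<alpha>" "pt \<alpha> \<alpha>' \<beta> \<gamma> Gen_a' = \<alpha>'" "pt \<alpha> \<alpha>' \<beta> \<gamma> Gen_b = \<beta>" "pt \<alpha> \<alpha>' \<beta> \<gamma> Gen_c = \<gamma>"
  by (simp_all add: pt_def)

lemma cone_pt_iff: "cone (pt \<alpha> \<alpha>' \<beta> \<gamma>) \<longleftrightarrow> 0 \<le> \<alpha> \<and> \<alpha> \<le> \<alpha>' \<and> \<alpha>' \<le> 2 * \<alpha> \<and> 0 \<le> \<beta> \<and> 0 \<le> \<gamma>"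
  by (simp add: cone_def)

text \<open>At a point where \<open>ga\<close> has value 1 the coefficients can be read off. Hence
  A_1 is a faithful copy of the integers, which makes \<open>alpha_1_13\<close> well
  defined.\<close>

lemma nmult_ga_diff_le_iff:
  "nmult m ga - nmult n ga \<le> nmult k ga - nmult l ga \<longleftrightarrow> m + l \<le> k + n"
proof
  assume le: "nmult m ga - nmult n ga \<le> nmult k ga - nmult l ga"
  have v: "cone (pt 1 1 0 0)" by (simp add: cone_pt_iff)
  from ev_mono[OF v le] show "m + l \<le> k + n"
    by (simp add: ev_minus[OF v] ev_nmult[OF v] ev_gen[OF v])
next
  assume "m + l \<le> k + n"
  then show "nmult m ga - nmult n ga \<le> nmult k ga - nmult l ga"
    using nmult_mono_left[OF gen_rels(1), of "m + l" "k + n"] by (simp add: nmult_add algebra_simps)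
qed

lemma ga'_nonneg: "0 \<le> ga'"
  using gen_rels(1,2) by (rule order.trans)

lemma nmult_ga'_diff_le:
  "m + l \<le> k + n \<Longrightarrow> nmult m ga' - nmult n ga' \<le> nmult k ga' - nmult l ga'"
  using nmult_mono_left[OF ga'_nonneg, of "m + l" "k + n"] by (simp add: nmult_add algebra_simps)

lemma lhom_alpha_ex:
  "\<exists>f. f \<in> lhom (A_obj {I1}) (A_obj {I1, I3}) \<and>
    (\<forall>m n. f (nmult m ga - nmult n ga) = nmult m ga' - nmult n ga')"
proof -
  define f where "f = (\<lambda>x\<in>A_obj {I1}.
    let (m, n) = (SOME (m, n). x = nmult m ga - nmult n ga) in nmult m ga' - nmult n ga')"
  have A1: "nmult m ga - nmult n ga \<in> A_obj {I1}" for m n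
    by (intro lsubgroup_minus lsubgroup_nmult lsubgroup_A_obj gen_in_A_obj)
  have f: "f (nmult m ga - nmult n ga) = nmult m ga' - nmult n ga'" for m n
  proof -
    obtain k l where kl: "(SOME (k, l). nmult m ga - nmult n ga = nmult k ga - nmult l ga) = (k, l)"
      by fastforce
    then have eq: "nmult m ga - nmult n ga = nmult k ga - nmult l ga"
      using someI[of "\<lambda>(k, l). nmult m ga - nmult n ga = nmult k ga - nmult l ga" "(m, n)"] by simp
    then have "m + l = k + n"
      using nmult_ga_diff_le_iff[of m n k l] nmult_ga_diff_le_iff[of k l m n] by simp
    then have "nmult m ga' - nmult n ga' = nmult k ga' - nmult l ga'"
      by (intro order.antisym nmult_ga'_diff_le) auto
    then show ?thesis using kl A1 by (simp add: f_def)
  qed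
  have "f \<in> A_obj {I1} \<rightarrow>\<^sub>E A_obj {I1, I3}"
  proof (rule PiE_I)
    fix x assume "x \<in> A_obj {I1}"
    then obtain m n where "x = nmult m ga - nmult n ga" by (rule A_obj_ga)
    then show "f x \<in> A_obj {I1, I3}"
      by (simp add: f) (intro lsubgroup_minus lsubgroup_nmult lsubgroup_A_obj gen_in_A_obj)
  qed (simp add: f_def)
  moreover have "f (x + y) = f x + f y \<and> f (sup x y) = sup (f x) (f y) \<and> f (inf x y) = inf (f x) (f y)"
    if xA: "x \<in> A_obj {I1}" and yA: "y \<in> A_obj {I1}" for x y
  proof -
    obtain m n where x: "x = nmult m ga - nmult n ga" using xA by (rule A_obj_ga)
    obtain k l where y: "y = nmult k ga - nmult l ga" using yA by (rule A_obj_ga)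
    have "x + y = nmult (m + k) ga - nmult (n + l) ga" unfolding x y nmult_add by simp
    then have "f (x + y) = nmult (m + k) ga' - nmult (n + l) ga'" by (simp only: f)
    then have 1: "f (x + y) = f x + f y" unfolding x y f nmult_add by simp
    have "x \<le> y \<and> f x \<le> f y \<or> y \<le> x \<and> f y \<le> f x"
      unfolding x y f nmult_ga_diff_le_iff
      using nmult_ga'_diff_le[of m l k n] nmult_ga'_diff_le[of k n m l] by linarith
    then show ?thesis using 1 by (auto simp: sup.absorb1 sup.absorb2 inf.absorb1 inf.absorb2)
  qed
  ultimately have "f \<in> lhom (A_obj {I1}) (A_obj {I1, I3})" unfolding lhom_def by blast
  then show ?thesis using f by blast
qed

lemma lhom_ga_unique:
  assumes f: "f \<in> lhom (A_obj {I1}) H" and fa: "f ga = h"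
  shows "f (nmult m ga - nmult n ga) = nmult m h - nmult n h"
proof -
  note A1 = lsubgroup_A_obj[of "{I1}"]
  have add: "f (x + y) = f x + f y" if "x \<in> A_obj {I1}" "y \<in> A_obj {I1}" for x y
    using f that unfolding lhom_def by blast
  have z: "0 \<in> A_obj {I1}" using A1 by (simp add: lsubgroup_def)
  have f0: "f 0 = 0" using add[OF z z] by simp
  have fn: "f (nmult n ga) = nmult n h" for n
    by (induction n) (auto simp: f0 fa add lsubgroup_nmult[OF A1] gen_in_A_obj)
  have mem: "nmult m ga - nmult n ga \<in> A_obj {I1}" "nmult n ga \<in> A_obj {I1}"
    by (intro lsubgroup_minus lsubgroup_nmult lsubgroup_A_obj gen_in_A_obj)+
  have "f (nmult m ga - nmult n ga + nmult n ga) = f (nmult m ga - nmult n ga) + f (nmult n ga)"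
    using mem by (rule add)
  then show ?thesis by (simp add: fn)
qed

text \<open>Turns the definite description into a formula: a homomorphism exists by
  \<open>lhom_alpha_ex\<close>, and additivity alone fixes it on integer multiples of
  \<open>ga\<close>.\<close>

lemma alpha_1_13: "alpha_1_13 (nmult m ga - nmult n ga) = nmult m ga' - nmult n ga'"
proof -
  obtain f where f: "f \<in> lhom (A_obj {I1}) (A_obj {I1, I3})"
    "\<And>m n. f (nmult m ga - nmult n ga) = nmult m ga' - nmult n ga'"
    using lhom_alpha_ex by blast
  have fa: "f ga = ga'" using f(2)[of 1 0] by simp
  have "alpha_1_13 = f"
    unfolding alpha_1_13_def
  proof (rule the_equality)
    fix g assume g: "g \<in> lhom (A_obj {I1}) (A_obj {I1, I3}) \<and> g ga = ga'"
    show "g = f"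
    proof (rule PiE_ext[of _ "A_obj {I1}"])
      show "g \<in> A_obj {I1} \<rightarrow>\<^sub>E A_obj {I1, I3}" "f \<in> A_obj {I1} \<rightarrow>\<^sub>E A_obj {I1, I3}"
        using f g by (auto simp: lhom_def)
      fix x assume "x \<in> A_obj {I1}"
      then obtain m n where "x = nmult m ga - nmult n ga" by (rule A_obj_ga)
      then show "g x = f x"
        using lhom_ga_unique[of g "A_obj {I1, I3}" ga' m n] g f(2) by simp
    qed
  qed (use f fa in blast)
  then show ?thesis using f(2) by simp
qed

text \<open>Because of a \<le> a' \<le> 2a; hence the two different arrows from 1 to 123 agree on
  ideals.\<close>

lemma pid_ga_ga': "pid ga' = pid ga"
proof (rule order.antisym)
  show "pid ga' \<le> pid ga"
    unfolding pid_le_iff using gen_rels ga'_nonneg by (auto intro!: exI[of _ 2] simp: numeral_2_eq_2)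
  show "pid ga \<le> pid ga'"
    by (intro pid_leI) (use gen_rels ga'_nonneg in auto)
qed

lemma pid_nmult:
  fixes x :: "'g::lattice_ab_group_add_abs"
  assumes "0 \<le> x" "n > 0"
  shows "pid (nmult n x) = pid x"
proof (rule order.antisym)
  show "pid (nmult n x) \<le> pid x"
    unfolding pid_le_iff using assms by (auto simp: nmult_nonneg)
  show "pid x \<le> pid (nmult n x)"
    using nmult_mono_left[of x 1 n] assms by (intro pid_leI) (auto simp: nmult_nonneg)
qed

lemma pid_nmult_diff:
  fixes x :: "'g::lattice_ab_group_add_abs"
  assumes "0 \<le> x"
  shows "pid (nmult m x - nmult n x) = (if m = n then bot else pid x)"
proof -
  have le: "pid (nmult m x - nmult n x) = pid x" if "n < m" for m n
  proof -
    have "nmult m x - nmult n x = nmult (m - n) x"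
      using that nmult_add[of n "m - n" x] by simp
    then show ?thesis using that assms by (simp add: pid_nmult)
  qed
  show ?thesis
    using le[of n m] le[of m n] pid_uminus[of "nmult n x - nmult m x"]
    by (cases m n rule: linorder_cases) (auto simp: bot_pideal_def)
qed

lemma alpha_1_13_pid:
  assumes "x \<in> A_obj {I1}"
  shows "alpha_1_13 x \<in> A_obj {I1, I3}" "pid (alpha_1_13 x) = pid x"
proof -
  obtain m n where x: "x = nmult m ga - nmult n ga" using assms by (rule A_obj_ga)
  show "alpha_1_13 x \<in> A_obj {I1, I3}"
    unfolding x alpha_1_13
    by (intro lsubgroup_minus lsubgroup_nmult lsubgroup_A_obj gen_in_A_obj)
  show "pid (alpha_1_13 x) = pid x"
    unfolding x alpha_1_13 by (simp add: pid_nmult_diff gen_rels ga'_nonneg pid_ga_ga')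
qed

text \<open>The excluded pair is the one step where the arrow is not an inclusion:
  \<open>A_obj {I1, I3}\<close> is generated from \<open>ga'\<close> instead of
  \<open>ga\<close>.\<close>

lemma A_obj_mono:
  assumes "p \<subseteq> q" "\<not> (p = {I1} \<and> q = {I1, I3})"
  shows "A_obj p \<subseteq> A_obj q"
proof -
  have "A_obj {} \<subseteq> A_obj q"
    using lsubgroup_A_obj[of q] by (auto simp: A_obj_simps lsubgroup_def)
  moreover have "A_obj p \<subseteq> A_obj {I1, I2, I3}" by (simp add: A_obj_simps)
  moreover have "A_obj {I1} \<subseteq> A_obj {I1, I2}" "A_obj {I2} \<subseteq> A_obj {I1, I2}"
    "A_obj {I2} \<subseteq> A_obj {I2, I3}" "A_obj {I3} \<subseteq> A_obj {I2, I3}" "A_obj {I3} \<subseteq> A_obj {I1, I3}"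
    unfolding A_obj_simps by (intro hull_mono; simp)+
  moreover have "p \<in> {{}, {I1}, {I2}, {I3}, {I1, I2}, {I1, I3}, {I2, I3}, {I1, I2, I3}}"
    "q \<in> {{}, {I1}, {I2}, {I3}, {I1, I2}, {I1, I3}, {I2, I3}, {I1, I2, I3}}"
    by (rule idx_set_cases)+
  ultimately show ?thesis
    using assms by (elim insertE emptyE; hypsubst) (simp_all, auto?)
qed

text \<open>On multiples of \<open>ga\<close>, replacing \<open>ga\<close> by \<open>ga'\<close>
  does not change the ideal; the other arrows are inclusions, composites of these, or the zero map
  on the zero group.\<close>

lemma A_arr_pid:
  assumes "p \<subseteq> q" "f \<in> A_arr p q" "x \<in> A_obj p"
  shows "f x \<in> A_obj q" "pid (f x) = pid x"
proof -
  have "f x \<in> A_obj q \<and> pid (f x) = pid x"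
  proof (cases "p = {I1} \<and> q = {I1, I3}")
    case True
    then show ?thesis using assms alpha_1_13_pid[of x] by (simp add: A_arr_def)
  next
    case False
    then have sub: "A_obj p \<subseteq> A_obj q" by (rule A_obj_mono[OF assms(1)])
    show ?thesis
    proof (cases "p = {I1} \<and> q = {I1, I2, I3}")
      case True
      then have "f \<in> {compose (A_obj {I1}) (incl {I1, I2}) (incl {I1}),
          compose (A_obj {I1}) (incl {I1, I3}) alpha_1_13}"
        using assms(2) by (simp add: A_arr_def insert_eq_iff)
      moreover have "x \<in> A_obj {I1, I2}" using assms(3) True A_obj_mono[of "{I1}" "{I1, I2}"] by auto
      ultimately have "f x \<in> {x, alpha_1_13 x}"
        using assms(3) True alpha_1_13_pid[of x] by (auto simp: compose_def incl_def)
      then show ?thesis using assms(3) True alpha_1_13_pid[of x] by (auto simp: A_obj_simps)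
    next
      case 2: False
      have "f x = x"
      proof (cases "p = {} \<and> p \<noteq> q")
        case True
        then have "f = (\<lambda>x\<in>A_obj {}. 0)"
          using assms(2) unfolding A_arr_def by (auto split: if_splits)
        moreover have "x = 0" using True assms(3) by (simp add: A_obj_simps)
        ultimately show ?thesis by (simp add: A_obj_simps)
      next
        case 3: False
        then have "f = incl p" using assms(1,2) False 2 unfolding A_arr_def by (auto split: if_splits)
        then show ?thesis using assms(3) by (simp add: incl_def)
      qed
      then show ?thesis using assms(3) sub by auto
    qed
  qed
  then show "f x \<in> A_obj q" "pid (f x) = pid x" by auto
qed

lemma A_arr_nonempty: "p \<subseteq> q \<Longrightarrow> A_arr p q \<noteq> {}"
  by (simp add: A_arr_def)

text \<open>The definite description needs the image ideal to be independent of the generator;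
  passing to \<open>emb\<close> reduces this to the preservation of \<open>pid\<close>.\<close>

lemma Idc_map_eq:
  assumes f: "\<And>x. x \<in> G \<Longrightarrow> f x \<in> H \<and> pid (f x) = pid x" and G: "lsubgroup G" and H: "lsubgroup H"
    and x: "x \<in> G"
  shows "Idc_map G H f (principal_lideal G x) = principal_lideal H (f x)"
proof -
  have "principal_lideal H (f y) = principal_lideal H (f x)"
    if "y \<in> G" "principal_lideal G x = principal_lideal G y" for y
  proof -
    have "pid y = pid x" using that x G by (metis emb_principal_lideal)
    then have "emb (principal_lideal H (f y)) = emb (principal_lideal H (f x))"
      using f that x H by (simp add: emb_principal_lideal)
    moreover have "principal_lideal H (f y) \<in> carrier (Idc H)" "principal_lideal H (f x) \<in> carrier (Idc H)"
      using f that x by (auto simp: Idc_def)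
    ultimately show ?thesis using emb_eq_iff[OF H] by blast
  qed
  then have "(THE K. \<forall>y\<in>G. principal_lideal G x = principal_lideal G y \<longrightarrow> K = principal_lideal H (f y))
      = principal_lideal H (f x)"
    using x by (intro the_equality) blast+
  then show ?thesis using x by (simp add: Idc_map_def Idc_def)
qed

text \<open>\<open>the_elem\<close> is meaningful only once all arrows are known to induce the same
  map; the case at stake is that of the two arrows from 1 to 123.\<close>

lemma IdcA_arr_eq:
  assumes "p \<subseteq> q" "f \<in> A_arr p q" "x \<in> A_obj p"
  shows "IdcA_arr p q (principal_lideal (A_obj p) x) = principal_lideal (A_obj q) (f x)"
proof -
  have eq: "Idc_map (A_obj p) (A_obj q) g (principal_lideal (A_obj p) y) = principal_lideal (A_obj q) (g y)"
    if "g \<in> A_arr p q" "y \<in> A_obj p" for g y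
    using that A_arr_pid[OF assms(1)] by (intro Idc_map_eq lsubgroup_A_obj) auto
  have "Idc_map (A_obj p) (A_obj q) g = Idc_map (A_obj p) (A_obj q) f" if g: "g \<in> A_arr p q" for g
  proof (rule extensionalityI[of _ "carrier (Idc (A_obj p))"])
    fix J assume "J \<in> carrier (Idc (A_obj p))"
    then obtain y where y: "y \<in> A_obj p" "J = principal_lideal (A_obj p) y" by (auto simp: Idc_def)
    have "emb (principal_lideal (A_obj q) (g y)) = emb (principal_lideal (A_obj q) (f y))"
      using A_arr_pid[OF assms(1)] g assms(2) y lsubgroup_A_obj by (simp add: emb_principal_lideal)
    moreover have "principal_lideal (A_obj q) (g y) \<in> carrier (Idc (A_obj q))"
      "principal_lideal (A_obj q) (f y) \<in> carrier (Idc (A_obj q))"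
      using A_arr_pid[OF assms(1)] g assms(2) y by (auto simp: Idc_def)
    ultimately have "principal_lideal (A_obj q) (g y) = principal_lideal (A_obj q) (f y)"
      using emb_eq_iff[OF lsubgroup_A_obj] by blast
    then show "Idc_map (A_obj p) (A_obj q) g J = Idc_map (A_obj p) (A_obj q) f J"
      using eq[OF g y(1)] eq[OF assms(2) y(1)] y(2) by metis
  qed (simp_all add: Idc_map_def)
  then have "Idc_map (A_obj p) (A_obj q) ` A_arr p q = {Idc_map (A_obj p) (A_obj q) f}"
    using assms(2) by blast
  then have "IdcA_arr p q = Idc_map (A_obj p) (A_obj q) f"
    by (simp add: IdcA_arr_def)
  then show ?thesis using eq[OF assms(2,3)] by simp
qed

lemma IdcA_arr_emb:
  assumes "p \<subseteq> q" "J \<in> carrier (IdcA_obj p)"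
  shows "IdcA_arr p q J \<in> carrier (IdcA_obj q)" "emb (IdcA_arr p q J) = emb J"
proof -
  obtain x where x: "x \<in> A_obj p" "J = principal_lideal (A_obj p) x"
    using assms(2) by (auto simp: IdcA_obj_def Idc_def)
  obtain f where f: "f \<in> A_arr p q" using A_arr_nonempty[OF assms(1)] by blast
  show "IdcA_arr p q J \<in> carrier (IdcA_obj q)" "emb (IdcA_arr p q J) = emb J"
    using IdcA_arr_eq[OF assms(1) f x(1)] A_arr_pid[OF assms(1) f x(1)] x lsubgroup_A_obj
    by (auto simp: IdcA_obj_def Idc_def emb_principal_lideal)
qed

text \<open>In contrast to \<open>A_obj_mono\<close> there is no exception, since \<open>ga\<close>
  and \<open>ga'\<close> generate the same ideal.\<close>

lemma pid_A_obj_mono: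
  assumes "p \<subseteq> q"
  shows "pid ` A_obj p \<subseteq> pid ` A_obj q"
  using A_arr_pid[OF assms] A_arr_nonempty[OF assms] by (metis ex_in_conv image_subsetI imageI)

section \<open>Countability of the group A_123\<close>

instance lterm :: (countable) countable
  by countable_datatype

instance gen :: countable
  by countable_datatype

instance A123 :: countable
proof
  have "inj lterm_of" by (metis A123_of_lterm_of injI)
  then have "inj (to_nat \<circ> lterm_of)" by (simp add: inj_compose)
  then show "\<exists>f :: A123 \<Rightarrow> nat. inj f" by blast
qed

section \<open>The points of F(X)\<close>

lemma X_fun_ran: "ran (X_fun x) \<subseteq> Field omega2"
  and bd_eq: "bd x = \<Union>(dom (X_fun x))"
  by (transfer; auto)+

lemma X_le_iff: "x \<le> y \<longleftrightarrow> X_fun x \<subseteq>\<^sub>m X_fun y" for x y :: X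
  unfolding less_eq_X_def bd_eq by (auto simp: map_le_def dom_def) (metis option.distinct(1))

lemma bd_mono: "x \<le> y \<Longrightarrow> bd x \<subseteq> bd y" for x y :: X
  by (simp add: less_eq_X_def)

definition mkX :: "(P \<rightharpoonup> nat set set) \<Rightarrow> X" where
  "mkX u = Abs_X (\<Union>(dom u), u)"

lemma X_fun_mkX: "ran u \<subseteq> Field omega2 \<Longrightarrow> X_fun (mkX u) = u"
  by (simp add: mkX_def X_fun.rep_eq Abs_X_inverse)

lemma X_fun_inject: "X_fun x = X_fun y \<Longrightarrow> x = y"
  by (rule order.antisym) (simp_all add: X_le_iff)

lemma nabla_empty: "nabla {} = {mkX Map.empty}"
proof -
  have "mkX Map.empty \<le> x" for x
    by (simp add: X_le_iff X_fun_mkX)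
  then show ?thesis unfolding nabla_def by (auto intro: order.antisym)
qed

text \<open>A common upper bound makes the two maps agree on the common domain, so their union is a
  least upper bound. Thus a nonempty \<open>nabla\<close> of a pair is a singleton.\<close>

lemma nabla_pair:
  fixes u v z :: X
  assumes "u \<le> z" "v \<le> z"
  obtains j where "nabla {u, v} = {j}" "u \<le> j" "v \<le> j" "\<And>w. u \<le> w \<Longrightarrow> v \<le> w \<Longrightarrow> j \<le> w"
    "bd j = bd u \<union> bd v"
proof -
  define j where "j = mkX (X_fun u ++ X_fun v)"
  have "ran (X_fun u ++ X_fun v) \<subseteq> Field omega2"
    using X_fun_ran[of u] X_fun_ran[of v] by (auto simp: ran_def map_add_Some_iff)
  then have j: "X_fun j = X_fun u ++ X_fun v"
    unfolding j_def by (rule X_fun_mkX)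
  have "X_fun u \<subseteq>\<^sub>m X_fun u ++ X_fun v"
    using assms unfolding X_le_iff map_le_def
    by (auto simp: map_add_def split: option.splits) (metis domI option.inject)
  then have 1: "u \<le> j" "v \<le> j"
    by (simp_all add: X_le_iff j)
  have 2: "j \<le> w" if "u \<le> w" "v \<le> w" for w
    using that by (simp add: X_le_iff j map_add_le_mapI)
  have "nabla {u, v} = {j}"
    unfolding nabla_def using 1 2 by (auto intro: order.antisym)
  moreover have "bd j = bd u \<union> bd v"
    unfolding bd_eq j by auto
  ultimately show ?thesis using that 1 2 by blast
qed

lemma nabla_pair_unbounded: "\<nexists>z. u \<le> z \<and> v \<le> z \<Longrightarrow> nabla {u, v} = {}"
  by (auto simp: nabla_def)

section \<open>Elements of F(X) as sets of points\<close>

primrec bext :: "'x::order bterm \<Rightarrow> 'x set" where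
  "bext (BGen u) = {v. u \<le> v}"
| "bext BBot = {}"
| "bext BTop = UNIV"
| "bext (BCompl s) = - bext s"
| "bext (BSup s t) = bext s \<union> bext t"
| "bext (BInf s t) = bext s \<inter> bext t"

lemma bext_bcong:
  assumes "\<And>s t. (s, t) \<in> R \<Longrightarrow> bext s = bext t" "bcong R s t"
  shows "bext s = bext t"
  using assms(2,1) by (induction rule: bcong.induct) auto

lemma bext_BJoin: "bext (BJoin ws) = (\<Union>w\<in>set ws. {v. w \<le> v})"
  by (induction ws) (auto simp: BJoin_def)

lemma bext_F_rels:
  assumes "(s, t) \<in> (F_rels :: (X bterm \<times> X bterm) set)"
  shows "bext s = bext t"
proof -
  have pair: "{w. u \<le> w} \<inter> {w. v \<le> w} = (\<Union>w\<in>nabla {u, v}. {v. w \<le> v})" for u v :: X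
  proof (cases "\<exists>z. u \<le> z \<and> v \<le> z")
    case True
    then obtain z where "u \<le> z" "v \<le> z" by blast
    then obtain j where "nabla {u, v} = {j}" "u \<le> j" "v \<le> j" "\<And>w. u \<le> w \<Longrightarrow> v \<le> w \<Longrightarrow> j \<le> w"
      using nabla_pair by metis
    then show ?thesis by (auto intro: order.trans)
  next
    case False
    then show ?thesis using nabla_pair_unbounded[OF False] by auto
  qed
  have le: "mkX Map.empty \<le> x" for x
    by (simp add: X_le_iff X_fun_mkX)
  have "{w. v \<le> w} \<inter> {w. u \<le> w} = {w. v \<le> w}" if "u \<le> v" for u v :: X
    using that by (auto intro: order.trans)
  then show ?thesis
    using assms pair unfolding F_rels_def by (force simp: bext_BJoin nabla_empty le)
qed

definition ext :: "FX \<Rightarrow> X set" where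
  "ext b = bext (bterm_of b)"

lemma FX_of_bterm_of: "FX_of (bterm_of b) = b"
  by (rule Quotient_abs_rep[OF Quotient_FX])

lemma FX_cases: obtains s where "b = FX_of s"
  by (metis FX_of_bterm_of)

lemma ext_FX_of: "ext (FX_of s) = bext s"
proof -
  have "bcong F_rels (bterm_of (FX_of s)) s"
    by (rule Quotient_rep_abs[OF Quotient_FX]) (rule bcong.refl)
  then show ?thesis
    unfolding ext_def by (rule bext_bcong[rotated]) (rule bext_F_rels)
qed

lemma ext_bot [simp]: "ext bot = {}"
  by (simp add: bot_FX_def ext_FX_of)

lemma ext_top [simp]: "ext top = UNIV"
  by (simp add: top_FX_def ext_FX_of)

lemma ext_uminus [simp]: "ext (- b) = - ext b"
  by (cases b rule: FX_cases) (simp add: uminus_FX.abs_eq ext_FX_of)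

lemma ext_sup [simp]: "ext (sup b c) = ext b \<union> ext c"
  by (cases b rule: FX_cases; cases c rule: FX_cases) (simp add: sup_FX.abs_eq ext_FX_of)

lemma ext_inf [simp]: "ext (inf b c) = ext b \<inter> ext c"
  by (cases b rule: FX_cases; cases c rule: FX_cases) (simp add: inf_FX.abs_eq ext_FX_of)

lemma ext_gen [simp]: "ext (gen_FX u) = {v. u \<le> v}"
  by (simp add: gen_FX_def ext_FX_of)

lemma gen_FX_antimono: "u \<le> v \<Longrightarrow> gen_FX v \<le> gen_FX u"
  unfolding less_eq_FX_def gen_FX_def inf_FX.abs_eq FX.abs_eq_iff
  by (rule bcong.rel) (auto simp: F_rels_def)

lemma FX_of_BJoin_single: "FX_of (BJoin [j]) = gen_FX j"
proof -
  have "FX_of (BJoin [j]) = sup (gen_FX j) bot"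
    by (simp add: BJoin_def gen_FX_def bot_FX_def sup_FX.abs_eq)
  then show ?thesis by simp
qed

lemma gen_FX_inf:
  "inf (gen_FX u) (gen_FX v) = FX_of (BJoin ws)" if "set ws = nabla {u, v}"
  unfolding gen_FX_def inf_FX.abs_eq FX.abs_eq_iff
  by (rule bcong.rel) (use that in \<open>auto simp: F_rels_def\<close>)

text \<open>The generators together with \<open>bot\<close> are closed under meets, so the positive
  generators in a meet can always be merged into one.\<close>

lemma gen_FX_inf_cases: "inf (gen_FX u) (gen_FX v) = bot \<or> (\<exists>j. inf (gen_FX u) (gen_FX v) = gen_FX j)"
proof (cases "\<exists>z. u \<le> z \<and> v \<le> z")
  case True
  then obtain z where "u \<le> z" "v \<le> z" by blast
  then obtain j where "nabla {u, v} = {j}" using nabla_pair by metis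
  then show ?thesis using gen_FX_inf[of "[j]" u v] by (auto simp: FX_of_BJoin_single)
next
  case False
  then show ?thesis
    using gen_FX_inf[of "[]" u v] nabla_pair_unbounded[OF False] by (auto simp: BJoin_def bot_FX_def)
qed

lemma top_eq_gen_FX: "top = gen_FX (mkX Map.empty)"
proof -
  have "top = FX_of (BJoin [mkX Map.empty])"
    unfolding top_FX_def FX.abs_eq_iff map_fun_def id_apply comp_apply
    by (rule bcong.rel) (auto simp: F_rels_def nabla_empty intro: exI[of _ "[mkX Map.empty]"])
  then show ?thesis by (simp add: FX_of_BJoin_single)
qed

text \<open>
  A cell \<open>\<tilde>u \<and> \<not>\<tilde>w\<^sub>1 \<and> \<dots> \<and> \<not>\<tilde>w\<^sub>n\<close> with no \<open>w\<^sub>i\<close> below \<open>u\<close>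
  contains the point \<open>u\<close>.  Since the elements of \<open>F(X)\<close> are finite joins of cells, \<open>ext\<close> embeds
  \<open>F(X)\<close> into the powerset of \<open>X\<close>.
\<close>

inductive cell :: "X \<Rightarrow> FX \<Rightarrow> bool" for u where
  "cell u (gen_FX u)"
| "cell u b \<Longrightarrow> \<not> w \<le> u \<Longrightarrow> cell u (inf b (- gen_FX w))"

inductive cell_join :: "FX \<Rightarrow> bool" where
  bot: "cell_join bot"
| sup: "cell u b \<Longrightarrow> cell_join c \<Longrightarrow> cell_join (sup b c)"

lemma cell_point: "cell u b \<Longrightarrow> u \<in> ext b"
  by (induction rule: cell.induct) auto

lemma cell_le: "cell u b \<Longrightarrow> b \<le> gen_FX u"
  by (induction rule: cell.induct) (auto intro: le_infI1)

lemma cell_join_cell: "cell u b \<Longrightarrow> cell_join b"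
  using cell_join.sup[OF _ cell_join.bot] by simp

lemma cell_join_sup: "cell_join b \<Longrightarrow> cell_join c \<Longrightarrow> cell_join (sup b c)"
  by (induction rule: cell_join.induct) (auto simp: sup.assoc intro: cell_join.sup)

lemma cell_join_diff_gen: "cell_join b \<Longrightarrow> cell_join (inf b (- gen_FX w))"
proof (induction rule: cell_join.induct)
  case (sup u b c)
  have "cell_join (inf b (- gen_FX w))"
  proof (cases "w \<le> u")
    case True
    then have "b \<le> gen_FX w" using cell_le[OF sup.hyps(1)] gen_FX_antimono order.trans by blast
    then have "inf b (- gen_FX w) = bot" by (simp add: inf_shunt)
    then show ?thesis by (simp add: cell_join.bot)
  next
    case False
    then show ?thesis using cell_join_cell[OF cell.intros(2)[OF sup.hyps(1)]] by blast
  qed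
  then show ?case using sup.IH by (simp add: inf_sup_distrib2 cell_join_sup)
qed (simp add: cell_join.bot)

lemma cell_join_inf_gen: "cell_join b \<Longrightarrow> cell_join (inf b (gen_FX w))"
proof (induction rule: cell_join.induct)
  case (sup u b c)
  from sup.hyps(1) have "cell_join (inf b (gen_FX w))"
  proof (induction rule: cell.induct)
    case 1
    then show ?case
      using gen_FX_inf_cases[of u w] cell_join.bot cell_join_cell[OF cell.intros(1)] by metis
  next
    case (2 b w')
    then show ?case
      using cell_join_diff_gen[of "inf b (gen_FX w)" w'] by (simp add: ac_simps)
  qed
  then show ?case using sup.IH by (simp add: inf_sup_distrib2 cell_join_sup)
qed (simp add: cell_join.bot)

text \<open>Both claims go together because complementation swaps them; \<open>b\<close> stays
  arbitrary so that the factors of a meet can be absorbed one after the other.\<close>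

lemma cell_join_inf_FX_of:
  "cell_join b \<Longrightarrow> cell_join (inf b (FX_of s)) \<and> cell_join (inf b (- FX_of s))"
proof (induction s arbitrary: b)
  case (BGen u)
  then show ?case
    using cell_join_inf_gen cell_join_diff_gen by (simp add: gen_FX_def)
next
  case BBot
  then show ?case by (simp add: bot_FX_def[symmetric] cell_join.bot)
next
  case BTop
  then show ?case by (simp add: top_FX_def[symmetric] cell_join.bot)
next
  case (BCompl s)
  then show ?case by (simp add: uminus_FX.abs_eq[symmetric])
next
  case (BSup s t)
  have "cell_join (inf (inf b (- FX_of s)) (- FX_of t))"
    using BSup by blast
  then show ?case
    using BSup by (simp add: sup_FX.abs_eq[symmetric] inf_sup_distrib1 cell_join_sup inf.assoc[symmetric])
next
  case (BInf s t)
  have "cell_join (inf (inf b (FX_of s)) (FX_of t))"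
    using BInf by blast
  then show ?case
    using BInf by (simp add: inf_FX.abs_eq[symmetric] inf_sup_distrib1 cell_join_sup inf.assoc[symmetric])
qed

lemma cell_join_FX: "cell_join b"
proof -
  have "cell_join top"
    unfolding top_eq_gen_FX by (rule cell_join_cell[OF cell.intros(1)])
  then show ?thesis
    using cell_join_inf_FX_of[of top] by (cases b rule: FX_cases) simp
qed

lemma ext_eq_empty_iff: "ext b = {} \<longleftrightarrow> b = bot"
  using cell_join_FX[of b] by (cases rule: cell_join.cases) (auto dest: cell_point)

lemma ext_subset_iff: "ext b \<subseteq> ext c \<longleftrightarrow> b \<le> c"
proof -
  have "ext b \<subseteq> ext c \<longleftrightarrow> ext (inf b (- c)) = {}" by auto
  also have "\<dots> \<longleftrightarrow> b \<le> c" unfolding ext_eq_empty_iff by (rule inf_shunt[symmetric, of b "- c", simplified, symmetric])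
  finally show ?thesis .
qed

lemma ext_eq_iff: "ext b = ext c \<longleftrightarrow> b = c"
  by (simp add: set_eq_subset ext_subset_iff order.eq_iff)

text \<open>For the converse, a cell contains its own point \<open>u\<close>; so \<open>p\<close>
  lies below \<open>bd u\<close>, and the cell lies below a generator of the ideal.\<close>

lemma scaled_FX_iff: "b \<in> scale scaled_FX p \<longleftrightarrow> (\<forall>v\<in>ext b. p \<subseteq> bd v)"
proof
  have "bool_ideal UNIV {b. \<forall>v\<in>ext b. p \<subseteq> bd v}"
    unfolding bool_ideal_def by (auto simp flip: ext_subset_iff)
  moreover have "{gen_FX u | u. p \<subseteq> bd u} \<subseteq> {b. \<forall>v\<in>ext b. p \<subseteq> bd v}"
    using bd_mono order.trans by fastforce
  ultimately have "bool_ideal UNIV hull {gen_FX u | u. p \<subseteq> bd u} \<subseteq> {b. \<forall>v\<in>ext b. p \<subseteq> bd v}"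
    by (intro hull_minimal)
  then show "b \<in> scale scaled_FX p \<Longrightarrow> \<forall>v\<in>ext b. p \<subseteq> bd v"
    by (auto simp: scaled_FX_def)
next
  have id: "bool_ideal UNIV (scale scaled_FX p)"
    unfolding scaled_FX_def scaled.simps
    by (rule hull_in) (unfold bool_ideal_def, blast)
  show "\<forall>v\<in>ext b. p \<subseteq> bd v \<Longrightarrow> b \<in> scale scaled_FX p"
    using cell_join_FX[of b]
  proof (induction rule: cell_join.induct)
    case bot
    then show ?case using id by (simp add: bool_ideal_def)
  next
    case (sup u b c)
    then have "p \<subseteq> bd u" using cell_point by auto
    then have "gen_FX u \<in> scale scaled_FX p"
      unfolding scaled_FX_def by (auto intro: hull_inc)
    then have "b \<in> scale scaled_FX p"
      using cell_le[OF sup.hyps(1)] id by (auto simp: bool_ideal_def)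
    moreover have "c \<in> scale scaled_FX p" using sup by auto
    ultimately show ?case using id by (auto simp: bool_ideal_def)
  qed
qed

lemma UNIV_idx: "(UNIV :: idx set) = {I1, I2, I3}"
  using idx.exhaust by blast

lemma finite_P: "finite (A :: P set)"
proof -
  have "finite (UNIV :: idx set)" by (simp add: UNIV_idx)
  then have "finite (UNIV :: P set)" by (simp add: Finite_Set.finite_set)
  then show ?thesis by (rule finite_subset[rotated]) simp
qed

text \<open>The condition on \<open>u\<close> says that every value of \<open>w'\<close> in
  \<open>E\<close> is already taken by \<open>w\<close> at the same argument. So \<open>w'\<close>
  extends \<open>w\<close> by values outside \<open>E\<close>, and \<open>b\<close> must not
  notice.\<close>

definition supports :: "nat set set set \<Rightarrow> FX \<Rightarrow> bool" where
  "supports E b \<longleftrightarrow> (\<forall>w w'. w \<le> w' \<and> (\<forall>u. ran (X_fun u) \<subseteq> E \<longrightarrow> u \<le> w' \<longrightarrow> u \<le> w) \<longrightarrow>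
    (w \<in> ext b \<longleftrightarrow> w' \<in> ext b))"

lemma supports_mono: "supports E b \<Longrightarrow> E \<subseteq> E' \<Longrightarrow> supports E' b"
  unfolding supports_def by (meson order.trans)

lemma finite_support: "\<exists>E. finite E \<and> E \<subseteq> Field omega2 \<and> supports E b"
proof -
  have "\<exists>E. finite E \<and> E \<subseteq> Field omega2 \<and> supports E (FX_of s)" for s
  proof (induction s)
    case (BGen u)
    have "supports (ran (X_fun u)) (gen_FX u)"
      unfolding supports_def by (auto intro: order.trans)
    moreover have "finite (ran (X_fun u))" by (intro finite_ran finite_P)
    ultimately show ?case using X_fun_ran unfolding gen_FX_def by blast
  next
    case (BSup s t)
    then obtain E E' where "finite E" "E \<subseteq> Field omega2" "supports E (FX_of s)"
      "finite E'" "E' \<subseteq> Field omega2" "supports E' (FX_of t)" by blast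
    then have "supports (E \<union> E') (FX_of s)" "supports (E \<union> E') (FX_of t)"
      by (auto intro: supports_mono)
    then have "supports (E \<union> E') (FX_of (BSup s t))"
      unfolding supports_def sup_FX.abs_eq[symmetric] ext_sup by blast
    then show ?case using \<open>finite E\<close> \<open>finite E'\<close> \<open>E \<subseteq> Field omega2\<close> \<open>E' \<subseteq> Field omega2\<close> by (intro exI[of _ "E \<union> E'"]) simp
  next
    case (BInf s t)
    then obtain E E' where "finite E" "E \<subseteq> Field omega2" "supports E (FX_of s)"
      "finite E'" "E' \<subseteq> Field omega2" "supports E' (FX_of t)" by blast
    then have "supports (E \<union> E') (FX_of s)" "supports (E \<union> E') (FX_of t)"
      by (auto intro: supports_mono)
    then have "supports (E \<union> E') (FX_of (BInf s t))"
      unfolding supports_def inf_FX.abs_eq[symmetric] ext_inf by blast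
    then show ?case using \<open>finite E\<close> \<open>finite E'\<close> \<open>E \<subseteq> Field omega2\<close> \<open>E' \<subseteq> Field omega2\<close> by (intro exI[of _ "E \<union> E'"]) simp
  qed (auto simp: supports_def ext_FX_of uminus_FX.abs_eq[symmetric])
  then show ?thesis by (metis FX_of_bterm_of)
qed

lemma finite_common_support:
  assumes "finite A"
  shows "\<exists>E. finite E \<and> E \<subseteq> Field omega2 \<and> (\<forall>b\<in>A. supports E b)"
proof -
  obtain E where E: "\<And>b. finite (E b) \<and> E b \<subseteq> Field omega2 \<and> supports (E b) b"
    using finite_support by metis
  then have "finite (\<Union>b\<in>A. E b) \<and> (\<Union>b\<in>A. E b) \<subseteq> Field omega2 \<and> (\<forall>b\<in>A. supports (\<Union>b\<in>A. E b) b)"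
    using assms by (auto intro: supports_mono)
  then show ?thesis by blast
qed

section \<open>Finitely presented subobjects of F(X)\<close>

abbreviation "fpX \<equiv> fp_subobjects scaled_FX"

lemma fpX_D:
  assumes "A \<in> fpX"
  shows "bool_subalgebra (univ A)" "finite (univ A)" "bool_ideal (univ A) (scale A p)"
    "scale A p \<subseteq> scale scaled_FX p"
    "scale A p \<inter> scale A q = bool_ideal (univ A) hull (\<Union>r\<in>{r. p \<le> r \<and> q \<le> r}. scale A r)"
    "x \<in> atoms A \<Longrightarrow> \<exists>p. x \<in> scale A p \<and> (\<forall>q. x \<in> scale A q \<longrightarrow> q \<le> p)"
  using assms
  by (auto simp: fp_subobjects_def finitely_presented_def scaled_boolean_algebra_def scaled_morphism_def)

lemma atoms_unique:
  assumes A: "A \<in> fpX" and "x \<in> atoms A" "y \<in> atoms A" "v \<in> ext x" "v \<in> ext y"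
  shows "x = y"
proof -
  have "inf x y \<in> univ A"
    using fpX_D(1)[OF A] assms by (auto simp: atoms_def bool_subalgebra_def)
  moreover have "inf x y \<noteq> bot" using assms by (auto simp flip: ext_eq_empty_iff)
  ultimately have "inf x y = x" "inf x y = y"
    using assms(2,3) unfolding atoms_def by (metis (mono_tags, lifting) inf_le1 inf_le2 mem_Collect_eq)+
  then show ?thesis by simp
qed

text \<open>Finiteness supplies a minimal element containing \<open>v\<close>; a smaller one
  avoiding \<open>v\<close> could be subtracted from it.\<close>

lemma atom_ex:
  assumes A: "A \<in> fpX"
  shows "\<exists>x\<in>atoms A. v \<in> ext x"
proof -
  let ?U = "{b \<in> univ A. v \<in> ext b}"
  have "finite ?U" "top \<in> ?U"
    using fpX_D(1,2)[OF A] by (auto simp: bool_subalgebra_def)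
  then have "\<exists>x\<in>?U. \<forall>y\<in>?U. y \<le> x \<longrightarrow> x = y"
    using finite_has_minimal[of ?U] by blast
  then obtain x where x: "x \<in> ?U" "\<And>y. y \<in> ?U \<Longrightarrow> y \<le> x \<Longrightarrow> y = x"
    by blast
  have "y = bot \<or> y = x" if y: "y \<in> univ A" "y \<le> x" for y
  proof (cases "v \<in> ext y")
    case True
    then show ?thesis using x y by auto
  next
    case False
    have "inf x (- y) \<in> ?U"
      using False x(1) y fpX_D(1)[OF A] by (auto simp: bool_subalgebra_def)
    then have "inf x (- y) = x" using x(2) by simp
    then have "ext x \<inter> - ext y = ext x" by (metis ext_inf ext_uminus)
    then have "ext y = {}" using y(2) unfolding ext_subset_iff[symmetric] by blast
    then show ?thesis by (simp add: ext_eq_empty_iff)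
  qed
  moreover have "x \<noteq> bot" using x(1) by auto
  ultimately have "x \<in> atoms A" using x(1) unfolding atoms_def by blast
  then show ?thesis using x(1) by blast
qed

definition atom_at :: "(FX, P) scaled \<Rightarrow> X \<Rightarrow> FX" where
  "atom_at A v = (THE x. x \<in> atoms A \<and> v \<in> ext x)"

lemma atom_at:
  assumes "A \<in> fpX"
  shows "atom_at A v \<in> atoms A" "v \<in> ext (atom_at A v)"
proof -
  have "\<exists>!x. x \<in> atoms A \<and> v \<in> ext x"
    using atom_ex[OF assms, of v] atoms_unique[OF assms] by blast
  from theI'[OF this] show "atom_at A v \<in> atoms A" "v \<in> ext (atom_at A v)"
    unfolding atom_at_def by auto
qed

lemma atom_at_eq: "A \<in> fpX \<Longrightarrow> x \<in> atoms A \<Longrightarrow> v \<in> ext x \<Longrightarrow> atom_at A v = x"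
  using atoms_unique atom_at by blast

lemma atom_point: "x \<in> atoms A \<Longrightarrow> \<exists>v. v \<in> ext x"
  using ext_eq_empty_iff[of x] by (auto simp: atoms_def)

lemma atom_decides:
  assumes "bool_subalgebra (univ A)" "x \<in> atoms A" "b \<in> univ A"
  shows "x \<le> b \<or> inf x b = bot"
proof -
  have "inf x b \<in> univ A" using assms by (auto simp: atoms_def bool_subalgebra_def)
  then have "inf x b = bot \<or> inf x b = x" using assms(2) by (auto simp: atoms_def)
  then show ?thesis by (auto simp: inf.absorb_iff1)
qed

lemma finite_atoms: "A \<in> fpX \<Longrightarrow> finite (atoms A)"
  using fpX_D(2) by (auto simp: atoms_def)

text \<open>Follows from the intersection axiom: \<open>scale A q\<close> is one of the ideals
  joined on its right side.\<close>

lemma scale_antimono: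
  assumes "A \<in> fpX" "p \<subseteq> q"
  shows "scale A q \<subseteq> scale A p"
proof -
  have "scale A q \<subseteq> scale A p \<inter> scale A q"
    unfolding fpX_D(5)[OF assms(1)]
    by (rule order.trans[OF _ hull_subset]) (use assms(2) in blast)
  then show ?thesis by blast
qed

lemma le_atom_index_iff:
  assumes A: "A \<in> fpX" and x: "x \<in> atoms A"
  shows "p \<subseteq> atom_index A x \<longleftrightarrow> x \<in> scale A p"
proof -
  obtain q where q: "x \<in> scale A q" "\<And>r. x \<in> scale A r \<Longrightarrow> r \<le> q"
    using fpX_D(6)[OF A x] by blast
  then have "atom_index A x = q"
    unfolding atom_index_def by (intro Greatest_equality)
  then show ?thesis using q scale_antimono[OF A, of p q] by blast
qed

text \<open>The scale of a subobject is contained in that of F(X). This inequality later confines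
  the value at a point to the lattice of the index of that point.\<close>

lemma atom_index_le_bd:
  assumes A: "A \<in> fpX" and "x \<in> atoms A" "v \<in> ext x"
  shows "atom_index A x \<subseteq> bd v"
proof -
  have "x \<in> scale scaled_FX (atom_index A x)"
    using le_atom_index_iff[OF assms(1,2), of "atom_index A x"] fpX_D(4)[OF A] by auto
  then show ?thesis using assms(3) scaled_FX_iff by blast
qed

section \<open>Subobjects from labelled partitions\<close>

definition partition_algebra :: "FX set \<Rightarrow> (FX \<Rightarrow> P) \<Rightarrow> (FX, P) scaled" where
  "partition_algebra Q lab =
    \<lparr>univ = {b. \<forall>x\<in>Q. x \<le> b \<or> inf x b = bot},
     scale = (\<lambda>p. {b. \<forall>x\<in>Q. x \<le> b \<and> p \<subseteq> lab x \<or> inf x b = bot})\<rparr>"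

text \<open>The last clause keeps the label of a block below the index of all its points; it makes
  the inclusion into F(X) a morphism.\<close>

definition labelled_partition :: "FX set \<Rightarrow> (FX \<Rightarrow> P) \<Rightarrow> bool" where
  "labelled_partition Q lab \<longleftrightarrow> finite Q \<and> bot \<notin> Q \<and> (\<forall>v. \<exists>x\<in>Q. v \<in> ext x) \<and>
    (\<forall>x\<in>Q. \<forall>y\<in>Q. x \<noteq> y \<longrightarrow> inf x y = bot) \<and> (\<forall>x\<in>Q. \<forall>v\<in>ext x. lab x \<subseteq> bd v)"

context
  fixes Q :: "FX set" and lab :: "FX \<Rightarrow> P"
  assumes labelled: "labelled_partition Q lab"
begin

lemma labelled_partition_D:
  "finite Q" "bot \<notin> Q" "\<exists>x\<in>Q. v \<in> ext x"
  "x \<in> Q \<Longrightarrow> y \<in> Q \<Longrightarrow> x \<noteq> y \<Longrightarrow> inf x y = bot"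
  "x \<in> Q \<Longrightarrow> v \<in> ext x \<Longrightarrow> lab x \<subseteq> bd v"
  using labelled unfolding labelled_partition_def by blast+

private abbreviation (input) "A \<equiv> partition_algebra Q lab"

lemma decided_ext: "x \<le> b \<or> inf x b = bot \<longleftrightarrow> ext x \<subseteq> ext b \<or> ext x \<inter> ext b = {}"
  by (simp add: ext_subset_iff flip: ext_inf ext_eq_empty_iff)

lemma bool_subalgebra_partition: "bool_subalgebra (univ A)"
  unfolding bool_subalgebra_def partition_algebra_def
  by (simp add: decided_ext) blast

lemma scale_partition_ext:
  "b \<in> scale A p \<longleftrightarrow> (\<forall>x\<in>Q. ext x \<subseteq> ext b \<and> p \<subseteq> lab x \<or> ext x \<inter> ext b = {})"
  by (simp add: partition_algebra_def ext_subset_iff flip: ext_inf ext_eq_empty_iff)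

lemma univ_partition_ext:
  "b \<in> univ A \<longleftrightarrow> (\<forall>x\<in>Q. ext x \<subseteq> ext b \<or> ext x \<inter> ext b = {})"
  by (simp add: partition_algebra_def ext_subset_iff flip: ext_inf ext_eq_empty_iff)

lemma bool_ideal_partition: "bool_ideal (univ A) (scale A p)"
  unfolding bool_ideal_def
proof (intro conjI ballI impI subsetI)
  fix x assume "x \<in> scale A p"
  then show "x \<in> univ A" by (auto simp: scale_partition_ext univ_partition_ext)
next
  fix x y assume "x \<in> scale A p" "y \<in> scale A p"
  then show "sup x y \<in> scale A p"
    unfolding scale_partition_ext ext_sup by blast
next
  fix x y assume "x \<in> scale A p" "y \<in> univ A" "y \<le> x"
  then show "y \<in> scale A p"
    unfolding scale_partition_ext univ_partition_ext ext_subset_iff[symmetric] by blast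
qed (simp add: scale_partition_ext)

lemma atoms_partition: "atoms A = Q"
proof (intro equalityI subsetI)
  fix x assume x: "x \<in> Q"
  have "x \<in> univ A"
    using x labelled_partition_D(4) by (force simp: partition_algebra_def)
  moreover have "y = bot \<or> y = x" if "y \<in> univ A" "y \<le> x" for y
    using that x by (auto simp: partition_algebra_def inf.absorb2 intro: order.antisym)
  ultimately show "x \<in> atoms A" using x labelled_partition_D(2) by (auto simp: atoms_def)
next
  fix x assume x: "x \<in> atoms A"
  then obtain v where v: "v \<in> ext x" using atom_point by blast
  obtain y where y: "y \<in> Q" "v \<in> ext y" using labelled_partition_D(3) by blast
  have "y \<le> x" using x y v unfolding atoms_def univ_partition_ext ext_subset_iff[symmetric] by blast
  moreover have "y \<in> univ A" using y labelled_partition_D(4) by (force simp: partition_algebra_def)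
  ultimately have "y = x" using x y labelled_partition_D(2) by (auto simp: atoms_def)
  then show "x \<in> Q" using y by simp
qed

lemma scale_partition_atom: "x \<in> Q \<Longrightarrow> x \<in> scale A p \<longleftrightarrow> p \<subseteq> lab x"
  using labelled_partition_D(2,4) by (force simp: partition_algebra_def)

lemma atom_index_partition: "x \<in> Q \<Longrightarrow> atom_index A x = lab x"
  unfolding atom_index_def by (intro Greatest_equality) (auto simp: scale_partition_atom)

lemma finite_univ_partition: "finite (univ A)"
proof (rule finite_imageD)
  show "finite ((\<lambda>b. {x \<in> Q. ext x \<subseteq> ext b}) ` univ A)"
    by (rule finite_subset[of _ "Pow Q"]) (use labelled_partition_D(1) in auto)
  show "inj_on (\<lambda>b. {x \<in> Q. ext x \<subseteq> ext b}) (univ A)"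
  proof (rule inj_onI)
    fix b c assume bc: "b \<in> univ A" "c \<in> univ A"
      and eq: "{x \<in> Q. ext x \<subseteq> ext b} = {x \<in> Q. ext x \<subseteq> ext c}"
    have "v \<in> ext b \<longleftrightarrow> v \<in> ext c" for v
    proof -
      obtain x where x: "x \<in> Q" "v \<in> ext x" using labelled_partition_D(3) by blast
      then have "v \<in> ext b \<longleftrightarrow> ext x \<subseteq> ext b" "v \<in> ext c \<longleftrightarrow> ext x \<subseteq> ext c"
        using bc unfolding univ_partition_ext by blast+
      then show ?thesis using eq x by blast
    qed
    then show "b = c" using ext_eq_iff by blast
  qed
qed

lemma partition_algebra_fpX: "A \<in> fpX"
proof -
  have univ: "bool_ideal (univ A) (univ A)"
    using bool_subalgebra_partition by (auto simp: bool_subalgebra_def bool_ideal_def)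
  have sub: "scale A p \<subseteq> univ A" for p
    using bool_ideal_partition by (auto simp: bool_ideal_def)
  have "scale A {} = univ A"
    by (auto simp: scale_partition_ext univ_partition_ext)
  then have un: "(\<Union>p. scale A p) = univ A" using sub by blast
  have int: "scale A p \<inter> scale A q = scale A (p \<union> q)" for p q
    by (intro equalityI subsetI; simp only: Int_iff scale_partition_ext Un_subset_iff; blast)
  have mono: "b \<in> scale A q" if "b \<in> scale A r" "q \<subseteq> r" for b q r
    using that unfolding scale_partition_ext by blast
  have "(\<Union>r\<in>{r. p \<le> r \<and> q \<le> r}. scale A r) = scale A (p \<union> q)" for p q
    by (rule equalityI) (use mono in \<open>blast, blast\<close>)
  then have "scaled_boolean_algebra A"
    unfolding scaled_boolean_algebra_def un int
    by (auto simp: bool_subalgebra_partition bool_ideal_partition univ hull_same)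
  then have "finitely_presented A"
    unfolding finitely_presented_def atoms_partition
    by (auto simp: finite_univ_partition scale_partition_atom)
  moreover have "scale A p \<subseteq> scale scaled_FX p" for p
  proof
    fix b assume b: "b \<in> scale A p"
    show "b \<in> scale scaled_FX p"
      unfolding scaled_FX_iff
    proof
      fix v assume v: "v \<in> ext b"
      obtain x where "x \<in> Q" "v \<in> ext x" using labelled_partition_D(3) by blast
      then show "p \<subseteq> bd v" using b v labelled_partition_D(5)[of x v] unfolding scale_partition_ext by blast
    qed
  qed
  ultimately show ?thesis
    by (auto simp: fp_subobjects_def scaled_morphism_def) (simp add: scaled_FX_def)
qed

end

definition refines :: "(FX, P) scaled \<Rightarrow> (FX, P) scaled \<Rightarrow> bool" where
  "refines A C \<longleftrightarrow> scaled_morphism A C (\<lambda>x. x)"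

lemma refines_iff: "refines A C \<longleftrightarrow> univ A \<subseteq> univ C \<and> (\<forall>p. scale A p \<subseteq> scale C p)"
  by (auto simp: refines_def scaled_morphism_def)

text \<open>The blocks are the nonzero meets of atoms. A block needs a label above those of both
  atoms; their union works, because both lie below the index of every point of the block.\<close>

lemma common_refinement:
  assumes A: "A \<in> fpX" and B: "B \<in> fpX"
  obtains C where "C \<in> fpX" "refines A C" "refines B C"
proof -
  define Q where "Q = {inf x y | x y. x \<in> atoms A \<and> y \<in> atoms B} - {bot}"
  \<comment> \<open>For a block \<open>z\<close> each of the two unions has a single term; this form
    avoids choosing it.\<close>
  define lab where "lab z = \<Union>(atom_index A ` {x \<in> atoms A. z \<le> x}) \<union> \<Union>(atom_index B ` {y \<in> atoms B. z \<le> y})" for z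
  have "Q \<subseteq> (\<lambda>(x, y). inf x y) ` (atoms A \<times> atoms B)" by (auto simp: Q_def)
  then have Q1: "finite Q" by (rule finite_subset) (simp add: finite_atoms A B)
  have Q2: "bot \<notin> Q" by (simp add: Q_def)
  have Q3: "\<exists>x\<in>Q. v \<in> ext x" for v
  proof -
    have "inf (atom_at A v) (atom_at B v) \<in> Q"
      using atom_at[OF A, of v] atom_at[OF B, of v] by (auto simp: Q_def simp flip: ext_eq_empty_iff)
    moreover have "v \<in> ext (inf (atom_at A v) (atom_at B v))"
      using atom_at(2)[OF A] atom_at(2)[OF B] by simp
    ultimately show ?thesis by blast
  qed
  have Q4: "inf z z' = bot" if zz: "z \<in> Q" "z' \<in> Q" "z \<noteq> z'" for z z'
  proof -
    obtain x y x' y' where xy: "z = inf x y" "z' = inf x' y'"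
      "x \<in> atoms A" "y \<in> atoms B" "x' \<in> atoms A" "y' \<in> atoms B"
      using zz unfolding Q_def by blast
    have "False" if "v \<in> ext (inf z z')" for v
    proof -
      have "x = x'" using atoms_unique[OF A, of x x' v] xy that by auto
      moreover have "y = y'" using atoms_unique[OF B, of y y' v] xy that by auto
      ultimately show False using \<open>z \<noteq> z'\<close> xy by simp
    qed
    then show ?thesis by (auto simp flip: ext_eq_empty_iff)
  qed
  have L: "lab z \<subseteq> bd v" if "z \<in> Q" "v \<in> ext z" for z v
    using atom_index_le_bd[OF A] atom_index_le_bd[OF B] that
    unfolding lab_def ext_subset_iff[symmetric] by blast
  have part: "labelled_partition Q lab"
    unfolding labelled_partition_def using Q1 Q2 Q3 Q4 L by blast
  have ref: "refines D (partition_algebra Q lab)"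
    if D: "D \<in> fpX" and sub: "\<And>z. z \<in> Q \<Longrightarrow> \<exists>x\<in>atoms D. z \<le> x \<and> atom_index D x \<subseteq> lab z" for D
    unfolding refines_iff
  proof (intro conjI allI subsetI)
    fix b assume b: "b \<in> univ D"
    have "z \<le> b \<or> inf z b = bot" if z: "z \<in> Q" for z
    proof -
      obtain x where "x \<in> atoms D" "z \<le> x" using sub[OF z] by blast
      then show ?thesis
        using atom_decides[OF fpX_D(1)[OF D] _ b] by (metis bot.extremum_uniqueI inf_mono order.trans order_refl)
    qed
    then show "b \<in> univ (partition_algebra Q lab)" by (simp add: partition_algebra_def)
  next
    fix p b assume b: "b \<in> scale D p"
    then have bu: "b \<in> univ D" using fpX_D(3)[OF D, of p] by (auto simp: bool_ideal_def)
    have "z \<le> b \<and> p \<subseteq> lab z \<or> inf z b = bot" if z: "z \<in> Q" for z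
    proof -
      obtain x where x: "x \<in> atoms D" "z \<le> x" "atom_index D x \<subseteq> lab z" using sub[OF z] by blast
      show ?thesis
      proof (cases "x \<le> b")
        case True
        then have "x \<in> scale D p"
          using b x fpX_D(3)[OF D, of p] by (auto simp: bool_ideal_def atoms_def)
        then have "p \<subseteq> atom_index D x" using le_atom_index_iff[OF D x(1)] by simp
        then show ?thesis using x True by auto
      next
        case False
        then have "inf x b = bot" using atom_decides[OF fpX_D(1)[OF D] x(1) bu] by simp
        then show ?thesis using x by (metis bot.extremum_uniqueI inf_mono order_refl)
      qed
    qed
    then show "b \<in> scale (partition_algebra Q lab) p" by (simp add: partition_algebra_def)
  qed
  show thesis
  proof (rule that)
    show "partition_algebra Q lab \<in> fpX" by (rule partition_algebra_fpX[OF part])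
    show "refines A (partition_algebra Q lab)"
      by (rule ref[OF A]) (auto simp: Q_def lab_def intro: le_infI1)
    show "refines B (partition_algebra Q lab)"
      by (rule ref[OF B]) (auto simp: Q_def lab_def intro: le_infI2)
  qed
qed

text \<open>Identifies the atom that \<open>fp_tensor_map\<close> describes by \<open>THE\<close>,
  through a point that the two atoms share.\<close>

lemma refines_atom:
  assumes A: "A \<in> fpX" and C: "C \<in> fpX" and ref: "refines A C"
  shows "atom_at C v \<le> atom_at A v"
    "(THE x. x \<in> atoms A \<and> atom_at C v \<le> x) = atom_at A v"
    "atom_index A (atom_at A v) \<subseteq> atom_index C (atom_at C v)"
proof -
  let ?x = "atom_at A v" and ?y = "atom_at C v"
  have xu: "?x \<in> univ C"
    using ref atom_at(1)[OF A] by (auto simp: refines_iff atoms_def)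
  have "inf ?y ?x \<noteq> bot"
    using atom_at(2)[OF A, of v] atom_at(2)[OF C, of v] by (auto simp flip: ext_eq_empty_iff)
  then show le: "?y \<le> ?x"
    using atom_decides[OF fpX_D(1)[OF C] atom_at(1)[OF C] xu] by blast
  show "(THE x. x \<in> atoms A \<and> ?y \<le> x) = ?x"
  proof (rule the_equality)
    fix x assume "x \<in> atoms A \<and> ?y \<le> x"
    then show "x = ?x"
      using atom_at(2)[OF C, of v] atom_at_eq[OF A, of x v] unfolding ext_subset_iff[symmetric] by blast
  qed (use le atom_at(1)[OF A] in simp)
  have "?x \<in> scale A (atom_index A ?x)"
    using le_atom_index_iff[OF A atom_at(1)[OF A]] by blast
  then have "?x \<in> scale C (atom_index A ?x)" using ref by (auto simp: refines_iff)
  then have "?y \<in> scale C (atom_index A ?x)"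
    using le fpX_D(3)[OF C, of "atom_index A ?x"] atom_at(1)[OF C, of v] by (auto simp: bool_ideal_def atoms_def)
  then show "atom_index A ?x \<subseteq> atom_index C ?y"
    using le_atom_index_iff[OF C atom_at(1)[OF C]] by blast
qed


section \<open>The condensate as a lattice of step functions\<close>

definition adapted :: "(FX, P) scaled \<Rightarrow> (X \<Rightarrow> A123 pideal) \<Rightarrow> bool" where
  "adapted A F \<longleftrightarrow> (\<forall>x\<in>atoms A. \<exists>t\<in>pid ` A_obj (atom_index A x). \<forall>v\<in>ext x. F v = t)"

definition step_functions :: "(X \<Rightarrow> A123 pideal) set" where
  "step_functions = {F. \<exists>A\<in>fpX. adapted A F}"

abbreviation "tensor A \<equiv> fp_tensor A IdcA_obj"

definition realize :: "(FX, P) scaled \<times> (FX \<Rightarrow> A123 set) \<Rightarrow> X \<Rightarrow> A123 pideal" where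
  "realize = (\<lambda>(A, f) v. emb (f (atom_at A v)))"

lemma tensor_D: "f \<in> carrier (tensor A) \<Longrightarrow> x \<in> atoms A \<Longrightarrow> f x \<in> carrier (Idc (A_obj (atom_index A x)))"
  by (auto simp: fp_tensor_def lattice_prod_def IdcA_obj_def)

lemma realize_le_iff:
  assumes A: "A \<in> fpX" and f: "f \<in> carrier (tensor A)" and g: "g \<in> carrier (tensor A)"
  shows "realize (A, f) \<le> realize (A, g) \<longleftrightarrow> f \<sqsubseteq>\<^bsub>tensor A\<^esub> g"
proof -
  have "realize (A, f) \<le> realize (A, g) \<longleftrightarrow> (\<forall>x\<in>atoms A. emb (f x) \<le> emb (g x))"
    unfolding realize_def le_fun_def using atom_at[OF A] atom_point atom_at_eq[OF A]
    by (metis case_prod_conv)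
  also have "\<dots> \<longleftrightarrow> (\<forall>x\<in>atoms A. f x \<subseteq> g x)"
    using tensor_D[OF f] tensor_D[OF g] emb_le_iff[OF lsubgroup_A_obj] by blast
  also have "\<dots> \<longleftrightarrow> f \<sqsubseteq>\<^bsub>tensor A\<^esub> g"
    by (simp add: fp_tensor_def lattice_prod_def IdcA_obj_def Idc_def)
  finally show ?thesis .
qed

lemma realize_inj:
  assumes A: "A \<in> fpX" and f: "f \<in> carrier (tensor A)" and g: "g \<in> carrier (tensor A)"
    and eq: "realize (A, f) = realize (A, g)"
  shows "f = g"
proof -
  have "f \<sqsubseteq>\<^bsub>tensor A\<^esub> g" "g \<sqsubseteq>\<^bsub>tensor A\<^esub> f"
    using realize_le_iff[OF A f g] realize_le_iff[OF A g f] eq by simp_all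
  then have "f x = g x" if "x \<in> atoms A" for x
    using that by (auto simp: fp_tensor_def lattice_prod_def IdcA_obj_def Idc_def)
  then show ?thesis
    using f g by (intro PiE_ext[of f "atoms A"]) (auto simp: fp_tensor_def lattice_prod_def)
qed

lemma adapted_iff_realize:
  assumes A: "A \<in> fpX"
  shows "adapted A F \<longleftrightarrow> (\<exists>f\<in>carrier (tensor A). F = realize (A, f))"
proof
  assume "adapted A F"
  then have "\<forall>x\<in>atoms A. \<exists>J\<in>carrier (IdcA_obj (atom_index A x)). \<forall>v\<in>ext x. F v = emb J"
    unfolding adapted_def IdcA_obj_def emb_image_Idc[OF lsubgroup_A_obj, symmetric] by blast
  then obtain f where f: "\<And>x. x \<in> atoms A \<Longrightarrow> f x \<in> carrier (IdcA_obj (atom_index A x)) \<and> (\<forall>v\<in>ext x. F v = emb (f x))"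
    by metis
  then have "restrict f (atoms A) \<in> carrier (tensor A)"
    by (auto simp: fp_tensor_def lattice_prod_def)
  moreover have "F = realize (A, restrict f (atoms A))"
    using f atom_at[OF A] by (auto simp: realize_def)
  ultimately show "\<exists>f\<in>carrier (tensor A). F = realize (A, f)" by blast
next
  assume "\<exists>f\<in>carrier (tensor A). F = realize (A, f)"
  then obtain f where f: "f \<in> carrier (tensor A)" "F = realize (A, f)" by blast
  show "adapted A F"
    unfolding adapted_def
  proof
    fix x assume x: "x \<in> atoms A"
    then have "emb (f x) \<in> pid ` A_obj (atom_index A x)"
      using tensor_D[OF f(1)] emb_image_Idc[OF lsubgroup_A_obj] by blast
    moreover have "\<forall>v\<in>ext x. F v = emb (f x)"
      using f(2) atom_at_eq[OF A x] by (simp add: realize_def)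
    ultimately show "\<exists>t\<in>pid ` A_obj (atom_index A x). \<forall>v\<in>ext x. F v = t" by blast
  qed
qed

text \<open>Arrows are invisible after \<open>emb\<close>, so passing to a finer subobject changes
  the representation but not the function.\<close>

lemma realize_tensor_map:
  assumes A: "A \<in> fpX" and C: "C \<in> fpX" and ref: "refines A C" and f: "f \<in> carrier (tensor A)"
  shows "fp_tensor_map A C (\<lambda>x. x) IdcA_arr f \<in> carrier (tensor C)" (is "?f \<in> _")
    "realize (C, fp_tensor_map A C (\<lambda>x. x) IdcA_arr f) = realize (A, f)"
proof -
  have val: "?f (atom_at C v) \<in> carrier (IdcA_obj (atom_index C (atom_at C v))) \<and>
      emb (?f (atom_at C v)) = emb (f (atom_at A v))" for v
    using IdcA_arr_emb[OF refines_atom(3)[OF A C ref, of v], of "f (atom_at A v)"]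
      tensor_D[OF f atom_at(1)[OF A]]
    by (simp add: fp_tensor_map_def Let_def atom_at[OF C] refines_atom(2)[OF A C ref] IdcA_obj_def)
  have "?f y \<in> carrier (IdcA_obj (atom_index C y))" if "y \<in> atoms C" for y
    using val atom_point[OF that] atom_at_eq[OF C that] by metis
  moreover have "?f \<in> extensional (atoms C)"
    by (simp add: fp_tensor_map_def)
  ultimately show "?f \<in> carrier (tensor C)"
    by (simp add: fp_tensor_def lattice_prod_def PiE_iff)
  show "realize (C, ?f) = realize (A, f)"
    using val by (simp add: realize_def)
qed

lemma adapted_refines:
  assumes "A \<in> fpX" "C \<in> fpX" "refines A C" "adapted A F"
  shows "adapted C F"
  using assms realize_tensor_map[OF assms(1-3)] unfolding adapted_iff_realize[OF assms(1)] adapted_iff_realize[OF assms(2)]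
  by metis

lemma common_adapted:
  assumes "F \<in> step_functions" "G \<in> step_functions"
  obtains A where "A \<in> fpX" "adapted A F" "adapted A G"
proof -
  obtain A B where A: "A \<in> fpX" "adapted A F" and B: "B \<in> fpX" "adapted B G"
    using assms unfolding step_functions_def by blast
  obtain C where C: "C \<in> fpX" "refines A C" "refines B C"
    using common_refinement[OF A(1) B(1)] .
  show thesis
    using that[OF C(1)] adapted_refines[OF A(1) C(1,2) A(2)] adapted_refines[OF B(1) C(1,3) B(2)] .
qed

abbreviation "fp_elements \<equiv> (SIGMA A:fpX. carrier (tensor A))"

text \<open>For the converse, equal functions are compared over a common refinement, where
  \<open>realize\<close> is injective. Hence the colimit classes are the fibers of
  \<open>realize\<close>.\<close>

lemma colimit_rel_iff:
  "((A, f), (B, g)) \<in> colimit_rel fpX refines tensor (\<lambda>A C. fp_tensor_map A C (\<lambda>x. x) IdcA_arr) \<longleftrightarrow>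
    (A, f) \<in> fp_elements \<and> (B, g) \<in> fp_elements \<and> realize (A, f) = realize (B, g)"
proof
  assume "((A, f), (B, g)) \<in> colimit_rel fpX refines tensor (\<lambda>A C. fp_tensor_map A C (\<lambda>x. x) IdcA_arr)"
  then show "(A, f) \<in> fp_elements \<and> (B, g) \<in> fp_elements \<and> realize (A, f) = realize (B, g)"
    unfolding colimit_rel_def by auto (metis realize_tensor_map(2))
next
  assume *: "(A, f) \<in> fp_elements \<and> (B, g) \<in> fp_elements \<and> realize (A, f) = realize (B, g)"
  then have A: "A \<in> fpX" and B: "B \<in> fpX" and fg: "f \<in> carrier (tensor A)" "g \<in> carrier (tensor B)" by auto
  obtain C where C: "C \<in> fpX" "refines A C" "refines B C"
    using common_refinement[OF A B] .
  have "fp_tensor_map A C (\<lambda>x. x) IdcA_arr f = fp_tensor_map B C (\<lambda>x. x) IdcA_arr g"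
    using * realize_tensor_map[OF A C(1,2) fg(1)] realize_tensor_map[OF B C(1,3) fg(2)]
    by (intro realize_inj[OF C(1)]) auto
  then show "((A, f), (B, g)) \<in> colimit_rel fpX refines tensor (\<lambda>A C. fp_tensor_map A C (\<lambda>x. x) IdcA_arr)"
    unfolding colimit_rel_def using A B fg C by blast
qed

abbreviation (input) "condensateB \<equiv> condensate scaled_FX IdcA_obj IdcA_arr"

lemma condensateB_eq:
  "condensateB = directed_colimit fpX refines tensor (\<lambda>A C. fp_tensor_map A C (\<lambda>x. x) IdcA_arr)"
  unfolding condensate_def refines_def ..

definition fiber :: "(X \<Rightarrow> A123 pideal) \<Rightarrow> ((FX, P) scaled \<times> (FX \<Rightarrow> A123 set)) set" where
  "fiber F = {e \<in> fp_elements. realize e = F}"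

lemma carrier_condensateB: "carrier condensateB = fiber ` step_functions"
proof -
  let ?R = "colimit_rel fpX refines tensor (\<lambda>A C. fp_tensor_map A C (\<lambda>x. x) IdcA_arr)"
  have "?R `` {e} = fiber (realize e)" if "e \<in> fp_elements" for e
    using that colimit_rel_iff by (cases e) (auto simp: fiber_def)
  then have "carrier condensateB = (fiber \<circ> realize) ` fp_elements"
    unfolding condensateB_eq directed_colimit_def quotient_def by auto
  moreover have "realize ` fp_elements = step_functions"
    unfolding step_functions_def using adapted_iff_realize by fastforce
  ultimately show ?thesis by (metis image_comp)
qed

lemma fiber_le_iff:
  assumes F: "F \<in> step_functions" and G: "G \<in> step_functions"
  shows "fiber F \<sqsubseteq>\<^bsub>condensateB\<^esub> fiber G \<longleftrightarrow> F \<le> G"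
proof -
  have "fiber F \<sqsubseteq>\<^bsub>condensateB\<^esub> fiber G \<longleftrightarrow>
      (\<exists>A\<in>fpX. \<exists>f g. (A, f) \<in> fiber F \<and> (A, g) \<in> fiber G \<and> f \<sqsubseteq>\<^bsub>tensor A\<^esub> g)"
    unfolding condensateB_eq directed_colimit_def by simp
  also have "\<dots> \<longleftrightarrow> F \<le> G"
  proof
    show "\<exists>A\<in>fpX. \<exists>f g. (A, f) \<in> fiber F \<and> (A, g) \<in> fiber G \<and> f \<sqsubseteq>\<^bsub>tensor A\<^esub> g \<Longrightarrow> F \<le> G"
      unfolding fiber_def using realize_le_iff by auto
    assume le: "F \<le> G"
    obtain A where A: "A \<in> fpX" "adapted A F" "adapted A G" using common_adapted[OF F G] .
    then obtain f g where "f \<in> carrier (tensor A)" "g \<in> carrier (tensor A)"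
      "F = realize (A, f)" "G = realize (A, g)" using adapted_iff_realize by meson
    then show "\<exists>A\<in>fpX. \<exists>f g. (A, f) \<in> fiber F \<and> (A, g) \<in> fiber G \<and> f \<sqsubseteq>\<^bsub>tensor A\<^esub> g"
      using A(1) le realize_le_iff[OF A(1)] unfolding fiber_def by blast
  qed
  finally show ?thesis .
qed

lemma eq_condensateB: "eq condensateB = (=)"
  by (simp add: condensateB_eq directed_colimit_def)

lemma step_functions_binop:
  assumes op: "\<And>H s t. lsubgroup H \<Longrightarrow> s \<in> pid ` H \<Longrightarrow> t \<in> pid ` H \<Longrightarrow> op s t \<in> pid ` H"
    and "F \<in> step_functions" "G \<in> step_functions"
  shows "(\<lambda>v. op (F v) (G v)) \<in> step_functions"
proof -
  obtain A where A: "A \<in> fpX" "adapted A F" "adapted A G"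
    using common_adapted[OF assms(2,3)] .
  have "adapted A (\<lambda>v. op (F v) (G v))"
    unfolding adapted_def
  proof
    fix x assume x: "x \<in> atoms A"
    obtain s t where "s \<in> pid ` A_obj (atom_index A x)" "\<forall>v\<in>ext x. F v = s"
      "t \<in> pid ` A_obj (atom_index A x)" "\<forall>v\<in>ext x. G v = t"
      using A x unfolding adapted_def by meson
    then show "\<exists>t\<in>pid ` A_obj (atom_index A x). \<forall>v\<in>ext x. op (F v) (G v) = t"
      using op[OF lsubgroup_A_obj] by (intro bexI[of _ "op s t"]) auto
  qed
  then show ?thesis using A(1) by (auto simp: step_functions_def)
qed

lemma step_functions_sup: "F \<in> step_functions \<Longrightarrow> G \<in> step_functions \<Longrightarrow> sup F G \<in> step_functions"
  using step_functions_binop[of sup F G, OF pid_sup_in] by (simp add: sup_fun_def)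

lemma step_functions_inf: "F \<in> step_functions \<Longrightarrow> G \<in> step_functions \<Longrightarrow> inf F G \<in> step_functions"
  using step_functions_binop[of inf F G, OF pid_inf_in] by (simp add: inf_fun_def)

lemma bot_step_function:
  assumes "A \<in> fpX"
  shows "adapted A bot"
  unfolding adapted_def using pid_bot_in[OF lsubgroup_A_obj] by auto

section \<open>Transfer between sublattices of a type and lattice records\<close>

locale lattice_image =
  fixes L :: "'a gorder" and C :: "'b::{distrib_lattice,order_bot} set" and \<phi> :: "'b \<Rightarrow> 'a"
  assumes eq: "eq L = (=)"
    and carrier: "carrier L = \<phi> ` C"
    and le: "F \<in> C \<Longrightarrow> G \<in> C \<Longrightarrow> \<phi> F \<sqsubseteq>\<^bsub>L\<^esub> \<phi> G \<longleftrightarrow> F \<le> G"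
    and sup_in: "F \<in> C \<Longrightarrow> G \<in> C \<Longrightarrow> sup F G \<in> C"
    and inf_in: "F \<in> C \<Longrightarrow> G \<in> C \<Longrightarrow> inf F G \<in> C"
    and bot_in: "bot \<in> C"
begin

lemma inj: "inj_on \<phi> C"
  by (rule inj_onI) (metis le order.antisym order_refl)

lemma partial_order: "partial_order L"
proof
  fix x y z
  assume "x \<in> carrier L"
  then obtain F where F: "F \<in> C" "x = \<phi> F" by (auto simp: carrier)
  show "x \<sqsubseteq>\<^bsub>L\<^esub> x" using F le by simp
  assume "y \<in> carrier L"
  then obtain G where G: "G \<in> C" "y = \<phi> G" by (auto simp: carrier)
  show "x .=\<^bsub>L\<^esub> y" if "x \<sqsubseteq>\<^bsub>L\<^esub> y" "y \<sqsubseteq>\<^bsub>L\<^esub> x"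
    using that F G le by (simp add: eq order.antisym)
  assume "z \<in> carrier L"
  then obtain H where H: "H \<in> C" "z = \<phi> H" by (auto simp: carrier)
  show "x \<sqsubseteq>\<^bsub>L\<^esub> z" if "x \<sqsubseteq>\<^bsub>L\<^esub> y" "y \<sqsubseteq>\<^bsub>L\<^esub> z"
    using that F G H le by simp
qed (simp_all add: eq)

sublocale partial_order L by (rule partial_order)

lemma least_sup:
  assumes "F \<in> C" "G \<in> C"
  shows "least L (\<phi> (sup F G)) (Upper L {\<phi> F, \<phi> G})"
  unfolding least_def Upper_def using assms sup_in by (auto simp: carrier le)

lemma greatest_inf:
  assumes "F \<in> C" "G \<in> C"
  shows "greatest L (\<phi> (inf F G)) (Lower L {\<phi> F, \<phi> G})"
  unfolding greatest_def Lower_def using assms inf_in by (auto simp: carrier le)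

lemma least_bot: "least L (\<phi> bot) (carrier L)"
  unfolding least_def using bot_in by (auto simp: carrier le)

lemma join: "F \<in> C \<Longrightarrow> G \<in> C \<Longrightarrow> \<phi> F \<squnion>\<^bsub>L\<^esub> \<phi> G = \<phi> (sup F G)"
  unfolding join_def Lattice.sup_def by (rule some_equality) (auto intro: least_sup least_unique)

lemma meet: "F \<in> C \<Longrightarrow> G \<in> C \<Longrightarrow> \<phi> F \<sqinter>\<^bsub>L\<^esub> \<phi> G = \<phi> (inf F G)"
  unfolding meet_def Lattice.inf_def by (rule some_equality) (auto intro: greatest_inf greatest_unique)

lemma bottom: "\<bottom>\<^bsub>L\<^esub> = \<phi> bot"
  unfolding bottom_def by (rule some_equality) (auto intro: least_bot least_unique)

lemma distrib_lattice_0: "distrib_lattice_0 L"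
proof
  fix x y assume "x \<in> carrier L" "y \<in> carrier L"
  then obtain F G where FG: "F \<in> C" "G \<in> C" "x = \<phi> F" "y = \<phi> G" by (auto simp: carrier)
  show "\<exists>s. least L s (Upper L {x, y})" using FG least_sup by blast
  show "\<exists>s. greatest L s (Lower L {x, y})" using FG greatest_inf by blast
  fix z assume "z \<in> carrier L"
  then obtain H where H: "H \<in> C" "z = \<phi> H" by (auto simp: carrier)
  show "x \<sqinter>\<^bsub>L\<^esub> (y \<squnion>\<^bsub>L\<^esub> z) = (x \<sqinter>\<^bsub>L\<^esub> y) \<squnion>\<^bsub>L\<^esub> (x \<sqinter>\<^bsub>L\<^esub> z)"
    using FG H by (simp add: join meet sup_in inf_in inf_sup_distrib1)
next
  show "\<exists>x. least L x (carrier L)" using least_bot by blast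
qed

lemma completely_normalI:
  assumes "\<And>F G. F \<in> C \<Longrightarrow> G \<in> C \<Longrightarrow> \<exists>U\<in>C. \<exists>V\<in>C. F \<le> sup G U \<and> G \<le> sup F V \<and> inf U V = bot"
  shows "completely_normal L"
  unfolding completely_normal_def
proof (intro ballI)
  fix x y assume "x \<in> carrier L" "y \<in> carrier L"
  then obtain F G where FG: "F \<in> C" "G \<in> C" "x = \<phi> F" "y = \<phi> G" by (auto simp: carrier)
  then obtain U V where UV: "U \<in> C" "V \<in> C" "F \<le> sup G U" "G \<le> sup F V" "inf U V = bot"
    using assms by blast
  then show "\<exists>u\<in>carrier L. \<exists>v\<in>carrier L. x \<sqsubseteq>\<^bsub>L\<^esub> y \<squnion>\<^bsub>L\<^esub> u \<and> y \<sqsubseteq>\<^bsub>L\<^esub> x \<squnion>\<^bsub>L\<^esub> v \<and> u \<sqinter>\<^bsub>L\<^esub> v = \<bottom>\<^bsub>L\<^esub>"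
    using FG by (intro bexI[of _ "\<phi> U"] bexI[of _ "\<phi> V"])
      (auto simp: carrier join meet bottom le sup_in)
qed

lemma countably_based_differencesI:
  assumes "\<And>F G. F \<in> C \<Longrightarrow> G \<in> C \<Longrightarrow> \<exists>Y. countable Y \<and> Y \<subseteq> {H \<in> C. F \<le> sup G H} \<and>
    (\<forall>H\<in>C. F \<le> sup G H \<longrightarrow> (\<exists>K\<in>Y. K \<le> H))"
  shows "countably_based_differences L"
  unfolding countably_based_differences_def
proof (intro ballI)
  fix x y assume "x \<in> carrier L" "y \<in> carrier L"
  then obtain F G where FG: "F \<in> C" "G \<in> C" "x = \<phi> F" "y = \<phi> G" by (auto simp: carrier)
  then obtain Y where Y: "countable Y" "Y \<subseteq> {H \<in> C. F \<le> sup G H}"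
    "\<And>H. H \<in> C \<Longrightarrow> F \<le> sup G H \<Longrightarrow> \<exists>K\<in>Y. K \<le> H" using assms[of F G] by blast
  have "coinitial_in L {z \<in> carrier L. x \<sqsubseteq>\<^bsub>L\<^esub> y \<squnion>\<^bsub>L\<^esub> z} (\<phi> ` Y)"
    unfolding coinitial_in_def
  proof (intro conjI ballI subsetI)
    fix z assume "z \<in> \<phi> ` Y"
    then show "z \<in> {z \<in> carrier L. x \<sqsubseteq>\<^bsub>L\<^esub> y \<squnion>\<^bsub>L\<^esub> z}"
      using Y(2) FG by (auto simp: carrier join le sup_in subset_eq)
  next
    fix z assume "z \<in> {z \<in> carrier L. x \<sqsubseteq>\<^bsub>L\<^esub> y \<squnion>\<^bsub>L\<^esub> z}"
    then obtain H where H: "H \<in> C" "z = \<phi> H" "F \<le> sup G H"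
      using FG by (auto simp: carrier join le sup_in)
    then obtain K where "K \<in> Y" "K \<le> H" using Y(3) by blast
    then show "\<exists>k\<in>\<phi> ` Y. k \<sqsubseteq>\<^bsub>L\<^esub> z" using H Y(2) le by blast
  qed
  then show "\<exists>Y. countable Y \<and> coinitial_in L {z \<in> carrier L. x \<sqsubseteq>\<^bsub>L\<^esub> y \<squnion>\<^bsub>L\<^esub> z} Y"
    using Y(1) by blast
qed

text \<open>Pulls the operation back along the injection \<open>\<phi>\<close>, so that for step
  functions it can be evaluated at points of X.\<close>

lemma cevianE:
  assumes "cevian L"
  obtains d where "\<And>F G. F \<in> C \<Longrightarrow> G \<in> C \<Longrightarrow> d F G \<in> C"
    "\<And>F G. F \<in> C \<Longrightarrow> G \<in> C \<Longrightarrow> F \<le> sup G (d F G)"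
    "\<And>F G. F \<in> C \<Longrightarrow> G \<in> C \<Longrightarrow> inf (d F G) (d G F) = bot"
    "\<And>F G H. F \<in> C \<Longrightarrow> G \<in> C \<Longrightarrow> H \<in> C \<Longrightarrow> d F H \<le> sup (d F G) (d G H)"
proof -
  obtain d where d: "cevian_operation L d" using assms by (auto simp: cevian_def)
  define e where "e F G = inv_into C \<phi> (d (\<phi> F) (\<phi> G))" for F G
  have e: "e F G \<in> C \<and> \<phi> (e F G) = d (\<phi> F) (\<phi> G)" if "F \<in> C" "G \<in> C" for F G
  proof -
    have "d (\<phi> F) (\<phi> G) \<in> \<phi> ` C"
      using d that unfolding cevian_operation_def carrier by blast
    then show ?thesis unfolding e_def by (simp add: inv_into_into f_inv_into_f)
  qed
  show thesis
  proof (rule that[of e])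
    fix F G assume FG: "F \<in> C" "G \<in> C"
    show "e F G \<in> C" using e FG by blast
    have "\<phi> F \<sqsubseteq>\<^bsub>L\<^esub> \<phi> G \<squnion>\<^bsub>L\<^esub> d (\<phi> F) (\<phi> G)" "d (\<phi> F) (\<phi> G) \<sqinter>\<^bsub>L\<^esub> d (\<phi> G) (\<phi> F) = \<bottom>\<^bsub>L\<^esub>"
      using d FG unfolding cevian_operation_def carrier by blast+
    then have "\<phi> F \<sqsubseteq>\<^bsub>L\<^esub> \<phi> G \<squnion>\<^bsub>L\<^esub> \<phi> (e F G)" "\<phi> (e F G) \<sqinter>\<^bsub>L\<^esub> \<phi> (e G F) = \<phi> bot"
      by (simp_all only: e FG bottom)
    moreover have eC: "e F G \<in> C" "e G F \<in> C" using e FG by blast+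
    ultimately show "F \<le> sup G (e F G)" "inf (e F G) (e G F) = bot"
      using FG inj_onD[OF inj, of "inf (e F G) (e G F)" bot]
      by (simp_all add: join meet le sup_in inf_in bot_in)
    fix H assume H: "H \<in> C"
    have "d (\<phi> F) (\<phi> H) \<sqsubseteq>\<^bsub>L\<^esub> d (\<phi> F) (\<phi> G) \<squnion>\<^bsub>L\<^esub> d (\<phi> G) (\<phi> H)"
      using d FG H unfolding cevian_operation_def carrier by blast
    then have "\<phi> (e F H) \<sqsubseteq>\<^bsub>L\<^esub> \<phi> (e F G) \<squnion>\<^bsub>L\<^esub> \<phi> (e G H)"
      by (simp only: e FG H)
    moreover have "e F H \<in> C" "e F G \<in> C" "e G H \<in> C" using e FG H by blast+
    ultimately show "e F H \<le> sup (e F G) (e G H)"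
      by (simp add: join le sup_in)
  qed
qed

end

section \<open>Complete normality and countably based differences\<close>

lemma adaptedI:
  assumes A: "A \<in> fpX" and "\<And>x. x \<in> atoms A \<Longrightarrow> u x \<in> pid ` A_obj (atom_index A x)"
  shows "adapted A (\<lambda>v. u (atom_at A v))"
  unfolding adapted_def
proof
  fix x assume "x \<in> atoms A"
  then show "\<exists>t\<in>pid ` A_obj (atom_index A x). \<forall>v\<in>ext x. u (atom_at A v) = t"
    using assms(2) atom_at_eq[OF A] by (intro bexI[of _ "u x"]) auto
qed

lemma adapted_atom_at:
  assumes A: "A \<in> fpX" and "adapted A F"
  obtains s where "\<And>x. x \<in> atoms A \<Longrightarrow> s x \<in> pid ` A_obj (atom_index A x)"
    "\<And>x v. x \<in> atoms A \<Longrightarrow> v \<in> ext x \<Longrightarrow> F v = s x" "F = (\<lambda>v. s (atom_at A v))"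
proof -
  obtain s where s: "\<And>x. x \<in> atoms A \<Longrightarrow> s x \<in> pid ` A_obj (atom_index A x) \<and> (\<forall>v\<in>ext x. F v = s x)"
    using assms(2) unfolding adapted_def by metis
  then have "F = (\<lambda>v. s (atom_at A v))" using atom_at[OF A] by blast
  then show thesis using that s by blast
qed

lemma trivial_partition: "\<exists>A. A \<in> fpX"
proof -
  have "labelled_partition {top} (\<lambda>_. {})"
    using ext_eq_empty_iff[of top] by (auto simp: labelled_partition_def)
  then show ?thesis using partition_algebra_fpX by blast
qed

interpretation condensateB: lattice_image condensateB step_functions fiber
proof
  show "bot \<in> step_functions"
    using trivial_partition bot_step_function by (auto simp: step_functions_def)
qed (simp_all add: eq_condensateB carrier_condensateB fiber_le_iff step_functions_sup step_functions_inf)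

lemma completely_normal_condensateB: "completely_normal condensateB"
proof (rule condensateB.completely_normalI)
  fix F G assume "F \<in> step_functions" "G \<in> step_functions"
  then obtain A where A: "A \<in> fpX" "adapted A F" "adapted A G" by (rule common_adapted)
  obtain s where s: "\<And>x. x \<in> atoms A \<Longrightarrow> s x \<in> pid ` A_obj (atom_index A x)" "F = (\<lambda>v. s (atom_at A v))"
    using adapted_atom_at[OF A(1,2)] by metis
  obtain t where t: "\<And>x. x \<in> atoms A \<Longrightarrow> t x \<in> pid ` A_obj (atom_index A x)" "G = (\<lambda>v. t (atom_at A v))"
    using adapted_atom_at[OF A(1,3)] by metis
  have "\<forall>x\<in>atoms A. \<exists>u v. u \<in> pid ` A_obj (atom_index A x) \<and> v \<in> pid ` A_obj (atom_index A x) \<and>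
      s x \<le> sup (t x) u \<and> t x \<le> sup (s x) v \<and> inf u v = bot"
    using pid_completely_normal[OF lsubgroup_A_obj s(1) t(1)] by blast
  then obtain u v where uv: "\<And>x. x \<in> atoms A \<Longrightarrow> u x \<in> pid ` A_obj (atom_index A x) \<and>
      v x \<in> pid ` A_obj (atom_index A x) \<and> s x \<le> sup (t x) (u x) \<and> t x \<le> sup (s x) (v x) \<and> inf (u x) (v x) = bot"
    by metis
  have "(\<lambda>p. u (atom_at A p)) \<in> step_functions" "(\<lambda>p. v (atom_at A p)) \<in> step_functions"
    using adaptedI[OF A(1), of u] adaptedI[OF A(1), of v] uv A(1) by (auto simp: step_functions_def)
  then show "\<exists>U\<in>step_functions. \<exists>V\<in>step_functions. F \<le> sup G U \<and> G \<le> sup F V \<and> inf U V = bot"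
    using uv atom_at(1)[OF A(1)] s(2) t(2)
    by (intro bexI[of _ "\<lambda>p. u (atom_at A p)"] bexI[of _ "\<lambda>p. v (atom_at A p)"])
      (auto simp: le_fun_def fun_eq_iff)
qed

instance pideal :: ("{countable,lattice_ab_group_add_abs}") countable
proof
  have "inj (pgen :: 'a pideal \<Rightarrow> 'a)" by (metis injI pid_pgen)
  then have "inj (to_nat \<circ> (pgen :: 'a pideal \<Rightarrow> 'a))" by (simp add: inj_compose)
  then show "\<exists>f :: 'a pideal \<Rightarrow> nat. inj f" by blast
qed

text \<open>Decodes the finite table of blocks and values of a step function. Such tables give both
  the countability for fixed blocks and the upper bound for the cardinality of the
  condensate.\<close>

definition step_of :: "(FX \<times> A123 pideal) list \<Rightarrow> X \<Rightarrow> A123 pideal" where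
  "step_of l v = (THE t. \<exists>x. (x, t) \<in> set l \<and> v \<in> ext x)"

lemma adapted_step_of:
  assumes A: "A \<in> fpX" and "adapted A F"
  shows "F \<in> step_of ` lists (atoms A \<times> UNIV)"
proof -
  obtain s where s: "F = (\<lambda>v. s (atom_at A v))" using adapted_atom_at[OF assms] by blast
  obtain xs where xs: "set xs = atoms A" using finite_list[OF finite_atoms[OF A]] by blast
  define l where "l = map (\<lambda>x. (x, s x)) xs"
  have l: "set l = (\<lambda>x. (x, s x)) ` atoms A" by (simp add: l_def xs)
  have "step_of l v = F v" for v
    unfolding step_of_def
  proof (rule the_equality)
    show "\<exists>x. (x, F v) \<in> set l \<and> v \<in> ext x"
      using atom_at[OF A, of v] by (auto simp: l s)
  next
    fix t assume "\<exists>x. (x, t) \<in> set l \<and> v \<in> ext x"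
    then show "t = F v" using atom_at_eq[OF A] by (auto simp: l s)
  qed
  then have "F = step_of l" by (simp add: fun_eq_iff)
  moreover have "l \<in> lists (atoms A \<times> UNIV)" using l by auto
  ultimately show ?thesis by blast
qed

lemma countable_adapted:
  assumes A: "A \<in> fpX"
  shows "countable {F. adapted A F}"
proof (rule countable_subset)
  show "{F. adapted A F} \<subseteq> step_of ` lists (atoms A \<times> UNIV)"
    using adapted_step_of[OF A] by blast
  show "countable (step_of ` lists (atoms A \<times> UNIV))"
    using countable_finite[OF finite_atoms[OF A]]
    by (intro countable_image countable_lists countable_SIGMA countableI_type)
qed

lemma finite_range_step_function:
  assumes "F \<in> step_functions"
  shows "finite (range F)"
proof -
  obtain A where A: "A \<in> fpX" "adapted A F" using assms by (auto simp: step_functions_def)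
  obtain s where "F = (\<lambda>v. s (atom_at A v))" using adapted_atom_at[OF A] by blast
  then have "range F \<subseteq> s ` atoms A" using atom_at(1)[OF A(1)] by auto
  then show ?thesis using finite_atoms[OF A(1)] finite_surj by blast
qed

text \<open>The coinitial set consists of the solutions adapted to a subobject \<open>A\<close> that
  serves both arguments. An arbitrary solution \<open>H\<close> may need finer pieces, but it takes
  finitely many values, so on each atom of \<open>A\<close> a single ideal from the required lattice
  lies below all of them.\<close>

lemma countably_based_differences_condensateB: "countably_based_differences condensateB"
proof (rule condensateB.countably_based_differencesI)
  fix F G assume "F \<in> step_functions" "G \<in> step_functions"
  then obtain A where A: "A \<in> fpX" "adapted A F" "adapted A G" by (rule common_adapted)
  obtain s where s: "\<And>x. x \<in> atoms A \<Longrightarrow> s x \<in> pid ` A_obj (atom_index A x)"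
    "\<And>x v. x \<in> atoms A \<Longrightarrow> v \<in> ext x \<Longrightarrow> F v = s x"
    using adapted_atom_at[OF A(1,2)] by metis
  obtain t where t: "\<And>x. x \<in> atoms A \<Longrightarrow> t x \<in> pid ` A_obj (atom_index A x)"
    "\<And>x v. x \<in> atoms A \<Longrightarrow> v \<in> ext x \<Longrightarrow> G v = t x"
    using adapted_atom_at[OF A(1,3)] by metis
  define Y where "Y = {H. adapted A H \<and> F \<le> sup G H}"
  have "countable Y"
    using countable_adapted[OF A(1)] countable_subset[of Y "{F. adapted A F}"] by (auto simp: Y_def)
  moreover have "Y \<subseteq> {H \<in> step_functions. F \<le> sup G H}"
    using A(1) by (auto simp: Y_def step_functions_def)
  moreover have "\<exists>K\<in>Y. K \<le> H" if H: "H \<in> step_functions" "F \<le> sup G H" for H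
  proof -
    have "\<exists>u\<in>pid ` A_obj (atom_index A x). s x \<le> sup (t x) u \<and> (\<forall>K\<in>H ` ext x. u \<le> K)"
      if x: "x \<in> atoms A" for x
    proof (rule pid_common_difference_in_subgroup[OF lsubgroup_A_obj s(1)[OF x] t(1)[OF x]])
      show "finite (H ` ext x)"
        using finite_range_step_function[OF H(1)] by (rule finite_subset[rotated]) auto
      fix K assume "K \<in> H ` ext x"
      then obtain v where "v \<in> ext x" "K = H v" by blast
      then show "s x \<le> sup (t x) K" using H(2) s(2)[OF x] t(2)[OF x] by (metis le_funD sup_apply)
    qed
    then obtain u where u: "\<And>x. x \<in> atoms A \<Longrightarrow> u x \<in> pid ` A_obj (atom_index A x)"
      "\<And>x. x \<in> atoms A \<Longrightarrow> s x \<le> sup (t x) (u x)" "\<And>x v. x \<in> atoms A \<Longrightarrow> v \<in> ext x \<Longrightarrow> u x \<le> H v"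
      by (metis imageI)
    have "(\<lambda>v. u (atom_at A v)) \<in> Y"
      using adaptedI[OF A(1) u(1)] u(2)[OF atom_at(1)[OF A(1)]]
      by (auto simp: Y_def le_fun_def s(2)[OF atom_at[OF A(1)]] t(2)[OF atom_at[OF A(1)]])
    moreover have "(\<lambda>v. u (atom_at A v)) \<le> H"
      using u(3) atom_at[OF A(1)] by (simp add: le_fun_def)
    ultimately show ?thesis by blast
  qed
  ultimately show "\<exists>Y. countable Y \<and> Y \<subseteq> {H \<in> step_functions. F \<le> sup G H} \<and>
      (\<forall>H\<in>step_functions. F \<le> sup G H \<longrightarrow> (\<exists>K\<in>Y. K \<le> H))" by blast
qed

section \<open>Cardinality\<close>

lemma card_order_omega2: "Card_order omega2"
  and infinite_omega2: "infinite (Field omega2)"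
proof -
  have 1: "Card_order (cardSuc natLeq)" by (rule cardSuc_Card_order[OF natLeq_Card_order])
  then show "Card_order omega2" unfolding omega2_def by (rule cardSuc_Card_order)
  show "infinite (Field omega2)"
    unfolding omega2_def cardSuc_finite[OF 1] cardSuc_finite[OF natLeq_Card_order]
    by (simp add: Field_natLeq)
qed

lemma countable_ordLeq_omega2: "|UNIV :: 'a::countable set| \<le>o omega2"
proof -
  have "|UNIV :: 'a set| \<le>o |UNIV :: nat set|"
    unfolding card_of_ordLeq[symmetric] using inj_to_nat by (intro exI[of _ to_nat]) simp
  also have "|UNIV :: nat set| \<le>o |Field omega2|"
    using infinite_omega2 infinite_iff_card_of_nat by blast
  also have "|Field omega2| =o omega2"
    by (rule card_of_Field_ordIso[OF card_order_omega2])
  finally show ?thesis .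
qed

lemma card_of_lists_ordLeq:
  assumes A: "|A| \<le>o r" and r: "Card_order r" "infinite (Field r)"
  shows "|lists A| \<le>o r"
proof -
  have r': "|Field r| =o r" by (rule card_of_Field_ordIso[OF r(1)])
  have "|{l \<in> lists A. length l = n}| \<le>o r" for n
  proof (induction n)
    case 0
    have "{l \<in> lists A. length l = 0} = {[]}" by auto
    moreover have "|{[] :: 'a list}| \<le>o |Field r|"
      using r(2) by (intro card_of_singl_ordLeq) auto
    ultimately show ?case using ordLeq_ordIso_trans[OF _ r'] by simp
  next
    case (Suc n)
    have "{l \<in> lists A. length l = Suc n} \<subseteq> (\<lambda>(x, l). x # l) ` (A \<times> {l \<in> lists A. length l = n})"
      by (auto simp: length_Suc_conv image_iff)
    then have "|{l \<in> lists A. length l = Suc n}| \<le>o |(\<lambda>(x, l). x # l) ` (A \<times> {l \<in> lists A. length l = n})|"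
      by (rule card_of_mono1)
    also have "|(\<lambda>(x, l). x # l) ` (A \<times> {l \<in> lists A. length l = n})| \<le>o |A \<times> {l \<in> lists A. length l = n}|"
      by (rule card_of_image)
    also have "|A \<times> {l \<in> lists A. length l = n}| \<le>o r" using Suc A r by (intro card_of_Times_ordLeq_infinite_Field)
    finally show ?case .
  qed
  moreover have "|UNIV :: nat set| \<le>o r"
    using infinite_iff_card_of_nat r(2) ordLeq_ordIso_trans[OF _ r'] by blast
  ultimately have "|\<Union>n. {l \<in> lists A. length l = n}| \<le>o r"
    using r by (intro card_of_UNION_ordLeq_infinite_Field) auto
  moreover have "lists A = (\<Union>n. {l \<in> lists A. length l = n})" by auto
  ultimately show ?thesis by simp
qed

text \<open>Prefix notation, with the numbers 0 to 4 marking constants and operations. It embeds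
  terms into lists, whose number \<open>card_of_lists_ordLeq\<close> bounds.\<close>

primrec polish :: "'g bterm \<Rightarrow> ('g + nat) list" where
  "polish (BGen g) = [Inl g]"
| "polish BBot = [Inr 0]"
| "polish BTop = [Inr 1]"
| "polish (BCompl s) = Inr 2 # polish s"
| "polish (BSup s t) = Inr 3 # polish s @ polish t"
| "polish (BInf s t) = Inr 4 # polish s @ polish t"

text \<open>Unique readability; the tails let the induction pass from the first operand of a binary
  operation to the second.\<close>

lemma polish_append_inject: "polish s @ xs = polish t @ ys \<Longrightarrow> s = t \<and> xs = ys"
proof (induction s arbitrary: t xs ys)
  case (BCompl s)
  from BCompl.prems obtain t' where t: "t = BCompl t'" by (cases t) auto
  from t have "polish s @ xs = polish t' @ ys" using BCompl.prems by simp
  then show ?case using BCompl.IH[of xs t' ys] t by simp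
next
  case (BSup s1 s2)
  from BSup.prems obtain t1 t2 where t: "t = BSup t1 t2" by (cases t) auto
  from t have "polish s1 @ polish s2 @ xs = polish t1 @ polish t2 @ ys" using BSup.prems by simp
  then have "s1 = t1 \<and> polish s2 @ xs = polish t2 @ ys" by (rule BSup.IH(1))
  then show ?case using BSup.IH(2)[of xs t2 ys] t by simp
next
  case (BInf s1 s2)
  from BInf.prems obtain t1 t2 where t: "t = BInf t1 t2" by (cases t) auto
  from t have "polish s1 @ polish s2 @ xs = polish t1 @ polish t2 @ ys" using BInf.prems by simp
  then have "s1 = t1 \<and> polish s2 @ xs = polish t2 @ ys" by (rule BInf.IH(1))
  then show ?case using BInf.IH(2)[of xs t2 ys] t by simp
qed (rename_tac t xs ys, case_tac t, auto)+

lemma inj_polish: "inj polish"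
  using polish_append_inject[of _ "[]" _ "[]"] by (auto intro: injI)

text \<open>P is finite, so a partial map is coded by the list of its values along a fixed
  enumeration of P, with \<open>None\<close> outside the domain.\<close>

lemma card_X: "|UNIV :: X set| \<le>o omega2"
proof -
  obtain ps :: "P list" where ps: "set ps = UNIV" using finite_list[OF finite_P] by blast
  let ?V = "{None} \<union> Some ` Field omega2"
  have "|Some ` Field omega2| \<le>o omega2"
    using ordLeq_ordIso_trans[OF card_of_image card_of_Field_ordIso[OF card_order_omega2]] .
  moreover have "|{None :: nat set set option}| \<le>o omega2"
    using infinite_omega2 by (intro ordLeq_ordIso_trans[OF card_of_singl_ordLeq card_of_Field_ordIso[OF card_order_omega2]]) auto
  ultimately have "|?V| \<le>o omega2"
    using card_order_omega2 infinite_omega2 by (intro card_of_Un_ordLeq_infinite_Field)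
  then have "|lists ?V| \<le>o omega2"
    by (rule card_of_lists_ordLeq[OF _ card_order_omega2 infinite_omega2])
  moreover have "|UNIV :: X set| \<le>o |lists ?V|"
    unfolding card_of_ordLeq[symmetric]
  proof (intro exI conjI)
    show "inj (\<lambda>x. map (X_fun x) ps)"
      by (rule injI) (auto simp: ps intro: X_fun_inject)
    show "range (\<lambda>x. map (X_fun x) ps) \<subseteq> lists ?V"
    proof clarsimp
      fix x p assume "X_fun x p \<notin> Some ` Field omega2"
      then show "X_fun x p = None"
        using X_fun_ran[of x] by (cases "X_fun x p") (auto simp: ran_def)
    qed
  qed
  ultimately show ?thesis by (rule ordLeq_transitive[rotated])
qed

lemma card_FX: "|UNIV :: FX set| \<le>o omega2"
proof -
  have "|(UNIV :: X set) <+> (UNIV :: nat set)| \<le>o omega2"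
    using card_X countable_ordLeq_omega2 card_order_omega2 infinite_omega2
    by (intro card_of_Plus_ordLeq_infinite_Field)
  then have "|UNIV :: (X + nat) set| \<le>o omega2" by simp
  then have "|lists (UNIV :: (X + nat) set)| \<le>o omega2"
    by (rule card_of_lists_ordLeq[OF _ card_order_omega2 infinite_omega2])
  moreover have "|UNIV :: FX set| \<le>o |lists (UNIV :: (X + nat) set)|"
    unfolding card_of_ordLeq[symmetric]
  proof (intro exI conjI)
    have "inj bterm_of" by (metis FX_of_bterm_of injI)
    then show "inj (polish \<circ> bterm_of)" by (rule inj_compose[OF inj_polish])
  qed auto
  ultimately show ?thesis by (rule ordLeq_transitive[rotated])
qed

lemma card_condensateB_le: "|carrier condensateB| \<le>o omega2"
proof -
  let ?L = "lists (UNIV :: (FX \<times> A123 pideal) set)"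
  have "|(UNIV :: FX set) \<times> (UNIV :: A123 pideal set)| \<le>o omega2"
    using card_FX countable_ordLeq_omega2 card_order_omega2 infinite_omega2
    by (intro card_of_Times_ordLeq_infinite_Field)
  then have "|?L| \<le>o omega2"
    by (intro card_of_lists_ordLeq[OF _ card_order_omega2 infinite_omega2]) simp
  moreover have "carrier condensateB \<subseteq> (fiber \<circ> step_of) ` ?L"
    unfolding carrier_condensateB step_functions_def using adapted_step_of by fastforce
  then have "|carrier condensateB| \<le>o |?L|"
    by (rule ordLeq_transitive[OF card_of_mono1 card_of_image])
  ultimately show ?thesis by (rule ordLeq_transitive[rotated])
qed

section \<open>Characteristic functions and the lower bound for the cardinality\<close>

definition char_step :: "X \<Rightarrow> A123 pideal \<Rightarrow> X \<Rightarrow> A123 pideal" where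
  "char_step u t w = (if u \<le> w then t else bot)"

text \<open>The first hypothesis puts the empty map outside the upper set of \<open>u\<close>, so
  the complement is a nonzero block; it gets the label \<open>{}\<close>, whose group is
  zero.\<close>

lemma char_step_in:
  assumes "\<not> u \<le> mkX Map.empty" "t \<in> pid ` A_obj (bd u)"
  shows "char_step u t \<in> step_functions"
proof -
  define lab where "lab b = (if b = gen_FX u then bd u else {})" for b
  let ?Q = "{gen_FX u, - gen_FX u}"
  have "mkX Map.empty \<notin> ext (gen_FX u)" "u \<in> ext (gen_FX u)" using assms(1) by simp_all
  then have ne: "gen_FX u \<noteq> bot" "- gen_FX u \<noteq> bot" "- gen_FX u \<noteq> gen_FX u"
    by (metis empty_iff ext_bot, metis ComplI empty_iff ext_bot ext_uminus, metis ComplD ext_uminus)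
  have Q: "labelled_partition ?Q lab"
    unfolding labelled_partition_def
  proof (intro conjI allI ballI impI)
    show "bot \<notin> ?Q" using ne(1,2) by (metis empty_iff insert_iff)
    fix x y v
    show "\<exists>x\<in>?Q. v \<in> ext x" by simp
    assume x: "x \<in> ?Q"
    show "inf x y = bot" if "y \<in> ?Q" "x \<noteq> y"
      using that x by auto
    show "lab x \<subseteq> bd v" if "v \<in> ext x"
      using that x ne(3) bd_mono[of u v] by (auto simp: lab_def)
  qed simp
  have "adapted (partition_algebra ?Q lab) (char_step u t)"
    unfolding adapted_def atoms_partition[OF Q]
  proof
    fix x assume x: "x \<in> ?Q"
    show "\<exists>t'\<in>pid ` A_obj (atom_index (partition_algebra ?Q lab) x). \<forall>v\<in>ext x. char_step u t v = t'"
      unfolding atom_index_partition[OF Q x]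
    proof (cases "x = gen_FX u")
      case True
      then show "\<exists>t'\<in>pid ` A_obj (lab x). \<forall>v\<in>ext x. char_step u t v = t'"
        using assms(2) by (intro bexI[of _ t]) (auto simp: lab_def char_step_def)
    next
      case False
      then show "\<exists>t'\<in>pid ` A_obj (lab x). \<forall>v\<in>ext x. char_step u t v = t'"
        using x pid_bot_in[OF lsubgroup_A_obj] by (intro bexI[of _ bot]) (auto simp: char_step_def)
    qed
  qed
  then show ?thesis
    using partition_algebra_fpX[OF Q] by (auto simp: step_functions_def)
qed

definition single :: "idx \<Rightarrow> nat set set \<Rightarrow> X" where
  "single i \<xi> = mkX [{i} \<mapsto> \<xi>]"

lemma X_fun_single: "\<xi> \<in> Field omega2 \<Longrightarrow> X_fun (single i \<xi>) = [{i} \<mapsto> \<xi>]"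
  unfolding single_def by (rule X_fun_mkX) simp

lemma single_le_iff: "\<xi> \<in> Field omega2 \<Longrightarrow> single i \<xi> \<le> w \<longleftrightarrow> X_fun w {i} = Some \<xi>"
  by (auto simp: X_le_iff X_fun_single map_le_def)

lemma char_step_single_in:
  assumes "\<xi> \<in> Field omega2" "t \<in> pid ` A_obj {i}"
  shows "char_step (single i \<xi>) t \<in> step_functions"
proof (rule char_step_in)
  show "\<not> single i \<xi> \<le> mkX Map.empty"
    using assms(1) by (simp add: single_le_iff X_fun_mkX)
  show "t \<in> pid ` A_obj (bd (single i \<xi>))"
    using assms by (simp add: bd_eq X_fun_single)
qed

lemma pid_ga_neq_bot: "pid ga \<noteq> bot"
proof
  have v: "cone (pt 1 1 0 0)" by (simp add: cone_pt_iff)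
  assume "pid ga = bot"
  then have "pid ga \<le> pid 0" by (simp add: bot_pideal_def)
  from ev_nonzero_mono[OF v this] show False by (simp add: ev_gen[OF v] ev_0[OF v])
qed

lemma card_condensateB: "|carrier condensateB| =o omega2"
proof -
  let ?f = "\<lambda>\<xi>. fiber (char_step (single I1 \<xi>) (pid ga))"
  have in_step: "char_step (single I1 \<xi>) (pid ga) \<in> step_functions" if "\<xi> \<in> Field omega2" for \<xi>
    using that gen_in_A_obj by (intro char_step_single_in) auto
  have "inj_on ?f (Field omega2)"
  proof (rule inj_onI)
    fix \<xi> \<eta> assume *: "\<xi> \<in> Field omega2" "\<eta> \<in> Field omega2" "?f \<xi> = ?f \<eta>"
    then have "char_step (single I1 \<xi>) (pid ga) = char_step (single I1 \<eta>) (pid ga)"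
      using inj_onD[OF condensateB.inj] in_step by blast
    then have "char_step (single I1 \<xi>) (pid ga) (single I1 \<xi>) = char_step (single I1 \<eta>) (pid ga) (single I1 \<xi>)"
      by simp
    then show "\<xi> = \<eta>"
      using * pid_ga_neq_bot by (auto simp: char_step_def single_le_iff X_fun_single split: if_splits)
  qed
  moreover have "?f ` Field omega2 \<subseteq> carrier condensateB"
    unfolding carrier_condensateB using in_step by blast
  ultimately have "|Field omega2| \<le>o |carrier condensateB|"
    unfolding card_of_ordLeq[symmetric] by blast
  then have "omega2 \<le>o |carrier condensateB|"
    using card_of_Field_ordIso[OF card_order_omega2] ordIso_ordLeq_trans ordIso_symmetric by blast
  then show ?thesis using card_condensateB_le ordIso_iff_ordLeq by blast
qed

section \<open>No Cevian operation\<close>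

lemma omega2_subset_card_succ_natLeq:
  obtains Z where "Z \<subseteq> Field omega2" "|Z| =o cardSuc natLeq"
proof -
  let ?r = "cardSuc natLeq"
  have r: "Card_order ?r" by (rule cardSuc_Card_order[OF natLeq_Card_order])
  have "|Field ?r| =o ?r" by (rule card_of_Field_ordIso[OF r])
  moreover have "?r \<le>o omega2" unfolding omega2_def by (rule cardSuc_ordLeq[OF r])
  moreover have "omega2 =o |Field omega2|"
    using card_of_Field_ordIso[OF card_order_omega2] ordIso_symmetric by blast
  ultimately have "|Field ?r| \<le>o |Field omega2|"
    using ordIso_ordLeq_trans ordLeq_ordIso_trans by blast
  then obtain f where f: "inj_on f (Field ?r)" "f ` Field ?r \<subseteq> Field omega2"
    unfolding card_of_ordLeq[symmetric] by blast
  have "|Field ?r| =o |f ` Field ?r|"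
    using f(1) card_of_ordIsoI inj_on_imp_bij_betw by blast
  then have "|f ` Field ?r| =o ?r"
    using \<open>|Field ?r| =o ?r\<close> ordIso_symmetric ordIso_transitive by blast
  then show thesis using that f(2) by blast
qed

text \<open>An instance of Kuratowski's free set theorem.\<close>

lemma free_triple:
  fixes E12 E13 E23 :: "nat set set \<Rightarrow> nat set set \<Rightarrow> nat set set set"
  assumes fin: "\<And>x y. finite (E12 x y)" "\<And>x y. finite (E13 x y)" "\<And>x y. finite (E23 x y)"
  obtains \<xi>1 \<xi>2 \<xi>3 where "\<xi>1 \<in> Field omega2" "\<xi>2 \<in> Field omega2" "\<xi>3 \<in> Field omega2"
    "\<xi>3 \<notin> E12 \<xi>1 \<xi>2" "\<xi>2 \<notin> E13 \<xi>1 \<xi>3" "\<xi>1 \<notin> E23 \<xi>2 \<xi>3"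
proof -
  let ?r = "cardSuc natLeq"
  have r: "Card_order ?r" "infinite (Field ?r)"
    using cardSuc_Card_order[OF natLeq_Card_order] cardSuc_finite[OF natLeq_Card_order]
    by (auto simp: Field_natLeq)
  obtain Z where Z: "Z \<subseteq> Field omega2" "|Z| =o ?r"
    using omega2_subset_card_succ_natLeq .
  have natLeq_r: "natLeq \<le>o ?r" by (rule cardSuc_ordLeq[OF natLeq_Card_order])
  have small: "|E| \<le>o natLeq" if "finite E" for E :: "nat set set set"
    using finite_iff_ordLess_natLeq[of E] that ordLess_imp_ordLeq by blast
  have Zr: "|Z| \<le>o ?r" using Z(2) ordIso_imp_ordLeq by blast
  have "|E12 x y| \<le>o ?r" for x y
    using small[OF fin(1)] natLeq_r by (rule ordLeq_transitive)
  then have "|\<Union>(x, y)\<in>Z \<times> Z. E12 x y| \<le>o ?r"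
    using r Zr
    by (intro card_of_UNION_ordLeq_infinite_Field card_of_Times_ordLeq_infinite_Field) auto
  \<comment> \<open>\<xi>3 comes first: aleph_1 many finite sets cannot cover the field of
    \<open>omega2\<close>, so one value escapes the sets of all pairs from \<open>Z\<close>, which
    has size aleph_1.\<close>
  have "\<not> Field omega2 \<subseteq> (\<Union>(x, y)\<in>Z \<times> Z. E12 x y)"
  proof
    assume "Field omega2 \<subseteq> (\<Union>(x, y)\<in>Z \<times> Z. E12 x y)"
    then have "|Field omega2| \<le>o |\<Union>(x, y)\<in>Z \<times> Z. E12 x y|" by (rule card_of_mono1)
    then have "|Field omega2| \<le>o ?r"
      using \<open>|\<Union>(x, y)\<in>Z \<times> Z. E12 x y| \<le>o ?r\<close> by (rule ordLeq_transitive)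
    then have "omega2 \<le>o ?r"
      using card_of_Field_ordIso[OF card_order_omega2] ordIso_symmetric ordIso_ordLeq_trans by blast
    moreover have "?r <o omega2"
      unfolding omega2_def by (rule cardSuc_greater[OF r(1)])
    ultimately show False using not_ordLess_ordLeq by blast
  qed
  then obtain \<xi>3 where x3: "\<xi>3 \<in> Field omega2" "\<And>x y. x \<in> Z \<Longrightarrow> y \<in> Z \<Longrightarrow> \<xi>3 \<notin> E12 x y"
    by blast
  have natZ: "natLeq <o |Z|"
    using cardSuc_greater[OF natLeq_Card_order] Z(2) ordIso_symmetric ordLess_ordIso_trans by blast
  have "infinite Z"
    using natZ finite_iff_ordLess_natLeq[of Z] ordLess_transitive ordLess_irreflexive by blast
  then obtain e :: "nat \<Rightarrow> nat set set" where e: "inj e" "range e \<subseteq> Z"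
    using infinite_countable_subset by blast
  \<comment> \<open>With \<open>x\<close> restricted to a countable infinite part of
    \<open>Z\<close>, the sets \<open>E13 x \<xi>3\<close> have a countable union, so \<xi>2 can be
    found in \<open>Z\<close>. For \<xi>1 an infinite set then faces a single finite one.\<close>
  define Z0 where "Z0 = range e"
  have Z0: "infinite Z0" "Z0 \<subseteq> Z"
    using e range_inj_infinite by (auto simp: Z0_def)
  have "|Z0| \<le>o natLeq"
    unfolding Z0_def using card_of_image card_of_nat ordLeq_ordIso_trans by blast
  then have "|\<Union>x\<in>Z0. E13 x \<xi>3| \<le>o natLeq"
    using small[OF fin(2)] natLeq_Card_order
    by (intro card_of_UNION_ordLeq_infinite_Field) (auto simp: Field_natLeq)
  then have "\<not> Z \<subseteq> (\<Union>x\<in>Z0. E13 x \<xi>3)"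
    using natZ card_of_mono1 not_ordLess_ordLeq ordLeq_transitive by blast
  then obtain \<xi>2 where x2: "\<xi>2 \<in> Z" "\<And>x. x \<in> Z0 \<Longrightarrow> \<xi>2 \<notin> E13 x \<xi>3" by blast
  have "\<not> Z0 \<subseteq> E23 \<xi>2 \<xi>3" using Z0(1) fin(3) finite_subset by blast
  then obtain \<xi>1 where x1: "\<xi>1 \<in> Z0" "\<xi>1 \<notin> E23 \<xi>2 \<xi>3" by blast
  show thesis using that[of \<xi>1 \<xi>2 \<xi>3] x1 x2 x3 Z Z0 by blast
qed

section \<open>Vanishing of elements along paths in the cone\<close>

lemma first_zero:
  fixes f g :: "real \<Rightarrow> real"
  assumes cont: "continuous_on {0..1} f" "continuous_on {0..1} g"
    and ends: "f 0 \<noteq> 0" "g 1 \<noteq> 0" and disj: "\<And>t. t \<in> {0..1} \<Longrightarrow> f t = 0 \<or> g t = 0"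
  obtains t where "0 < t" "t < 1" "f t = 0" "g t = 0" "\<And>s. 0 \<le> s \<Longrightarrow> s < t \<Longrightarrow> f s \<noteq> 0"
proof -
  \<comment> \<open>The desired point is the least zero of \<open>f\<close>, which exists because
    the zero set is closed. Below it \<open>f\<close> is nonzero, so \<open>g\<close> vanishes
    there, and by continuity also at the point itself.\<close>
  let ?Z = "f -` {0} \<inter> {0..1}"
  have "closed ?Z" using cont(1) continuous_on_closed_vimage[of "{0..1}" f] by simp
  then have "compact ({0..1} \<inter> ?Z)" using compact_Icc compact_Int_closed by blast
  moreover have "1 \<in> {0..1} \<inter> ?Z" using disj[of 1] ends by auto
  ultimately have "\<exists>t\<in>{0..1} \<inter> ?Z. \<forall>s\<in>{0..1} \<inter> ?Z. t \<le> s"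
    using compact_attains_inf[of "{0..1} \<inter> ?Z"] by blast
  then obtain t where t: "t \<in> {0..1}" "f t = 0" "\<And>s. s \<in> {0..1} \<Longrightarrow> f s = 0 \<Longrightarrow> t \<le> s" by auto
  have t0: "0 < t" using t ends by (cases "t = 0") auto
  have below: "f s \<noteq> 0" if "0 \<le> s" "s < t" for s using that t by force
  have "g t = 0"
  proof (rule ccontr)
    assume "g t \<noteq> 0"
    then obtain \<delta> where \<delta>: "\<delta> > 0" "\<And>s. s \<in> {0..1} \<Longrightarrow> dist s t < \<delta> \<Longrightarrow> dist (g s) (g t) < \<bar>g t\<bar>"
    proof -
      have "(g \<longlongrightarrow> g t) (at t within {0..1})"
        using cont(2) t(1) by (simp add: continuous_on_def)
      then have "\<forall>\<^sub>F s in at t within {0..1}. dist (g s) (g t) < \<bar>g t\<bar>"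
        using \<open>g t \<noteq> 0\<close> by (intro tendstoD) auto
      then obtain \<delta> where "\<delta> > 0"
        "\<And>s. s \<in> {0..1} \<Longrightarrow> s \<noteq> t \<Longrightarrow> dist s t < \<delta> \<Longrightarrow> dist (g s) (g t) < \<bar>g t\<bar>"
        unfolding eventually_at by blast
      then show thesis using that[of \<delta>] \<open>g t \<noteq> 0\<close> by (metis dist_self zero_less_abs_iff)
    qed
    define s where "s = max 0 (t - \<delta> / 2)"
    have s: "0 \<le> s" "s < t" "s \<in> {0..1}" "dist s t < \<delta>"
      using t0 t(1) \<delta>(1) by (auto simp: s_def dist_real_def)
    then have "g s = 0" using disj[of s] below[of s] by blast
    then show False using \<delta>(2)[OF s(3,4)] by (simp add: dist_real_def)
  qed
  moreover have "t < 1" using t(1) \<open>g t = 0\<close> ends(2) by (cases "t = 1") auto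
  ultimately show thesis using that t0 t(2) below by blast
qed

lemma leval_continuous:
  assumes "\<And>g. continuous_on S (\<lambda>t. v t g)"
  shows "continuous_on S (\<lambda>t. leval (v t) s)"
  by (induction s) (auto intro!: continuous_intros assms)

text \<open>Lattice terms are positively homogeneous, so only the ratios of the coordinates matter
  for vanishing.\<close>

lemma leval_scale:
  assumes "0 \<le> c"
  shows "leval (\<lambda>g. c * v g) s = c * leval v s"
  using assms
  by (induction s) (auto simp: algebra_simps max_def min_def mult_le_cancel_left)

text \<open>Elements generated from \<open>S\<close> do not see the other coordinates; a point may
  be moved in those as long as it stays in the cone.\<close>

lemma ev_hull_cong:
  assumes "cone v" "cone w" "\<And>g. g \<in> S \<Longrightarrow> v g = w g" "x \<in> lsubgroup hull (gen_A123 ` S)"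
  shows "ev v x = ev w x"
proof -
  have "lsubgroup {x. ev v x = ev w x}"
    by (simp add: lsubgroup_def ev_0 ev_plus ev_uminus ev_sup ev_inf assms(1,2))
  moreover have "gen_A123 ` S \<subseteq> {x. ev v x = ev w x}"
    using assms(1-3) by (auto simp: ev_gen)
  ultimately have "lsubgroup hull (gen_A123 ` S) \<subseteq> {x. ev v x = ev w x}"
    by (intro hull_minimal)
  then show ?thesis using assms(4) by blast
qed

lemma ev_nonzero_sup:
  assumes v: "cone v" and "pid x \<le> sup (pid y) (pid z)" "ev v x \<noteq> 0"
  shows "ev v y \<noteq> 0 \<or> ev v z \<noteq> 0"
  using ev_nonzero_mono[OF v, of x "\<bar>y\<bar> + \<bar>z\<bar>"] assms(2,3)
  by (auto simp: pid_sup ev_plus[OF v] ev_abs[OF v])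

lemma ev_zero_inf:
  assumes v: "cone v" and "inf (pid x) (pid y) = bot"
  shows "ev v x = 0 \<or> ev v y = 0"
proof -
  have "pid (inf \<bar>x\<bar> \<bar>y\<bar>) \<le> pid 0"
    using assms(2) by (simp add: pid_inf bot_pideal_def)
  then have "ev v (inf \<bar>x\<bar> \<bar>y\<bar>) = 0"
    using ev_nonzero_mono[OF v, of "inf \<bar>x\<bar> \<bar>y\<bar>" 0] ev_0[OF v] by blast
  then show ?thesis by (auto simp: ev_inf[OF v] ev_abs[OF v] min_def split: if_splits)
qed

lemma ev_pt_continuous:
  assumes "continuous_on S \<alpha>" "continuous_on S \<alpha>'" "continuous_on S \<beta>" "continuous_on S \<gamma>"
  shows "continuous_on S (\<lambda>t. ev (pt (\<alpha> t) (\<alpha>' t) (\<beta> t) (\<gamma> t)) x)"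
  unfolding ev_def
proof (rule leval_continuous)
  show "continuous_on S (\<lambda>t. pt (\<alpha> t) (\<alpha>' t) (\<beta> t) (\<gamma> t) g)" for g
    by (cases g) (simp_all add: assms)
qed

lemma ev_pt_scale:
  assumes "0 \<le> c"
  shows "ev (pt (c * \<alpha>) (c * \<alpha>') (c * \<beta>) (c * \<gamma>)) x = c * ev (pt \<alpha> \<alpha>' \<beta> \<gamma>) x"
proof -
  have "pt (c * \<alpha>) (c * \<alpha>') (c * \<beta>) (c * \<gamma>) = (\<lambda>g. c * pt \<alpha> \<alpha>' \<beta> \<gamma> g)"
    by (rule ext) (simp add: pt_def split: gen.split)
  then show ?thesis unfolding ev_def by (simp add: leval_scale[OF assms])
qed

text \<open>
  Here \<open>xba\<close> stands for \<open>b \<setminus> a\<close>, and so on.  As \<open>a : b\<close> grows from \<open>0\<close>, the element \<open>xba\<close> vanishes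
  first at some ratio \<open>t : 1 - t\<close>.  The slack \<open>a \<le> a' \<le> 2 a\<close> allows to decrease \<open>a\<close>, hence to
  enter the region where \<open>xba\<close> does not vanish, without changing the values of \<open>a'\<close>, \<open>b\<close>, \<open>c\<close>.
\<close>

lemma no_coherent_differences:
  assumes xab: "xab \<in> A_obj {I1, I2}" and xba: "xba \<in> A_obj {I1, I2}"
    and xbc: "xbc \<in> A_obj {I2, I3}" and xcb: "xcb \<in> A_obj {I2, I3}"
    and xca: "xca \<in> A_obj {I1, I3}"
    and ab: "pid ga \<le> sup (pid gb) (pid xab)" "pid gb \<le> sup (pid ga) (pid xba)"
      "inf (pid xab) (pid xba) = bot"
    and bc: "pid gb \<le> sup (pid gc) (pid xbc)" "pid gc \<le> sup (pid gb) (pid xcb)"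
      "inf (pid xbc) (pid xcb) = bot"
    and ca: "pid xca \<le> sup (pid xcb) (pid xba)"
    and ba: "pid xba \<le> sup (pid xbc) (pid xca)"
  shows False
proof -
  have cong_ab: "ev (pt \<alpha> \<alpha>' \<beta> \<gamma>) x = ev (pt \<alpha> \<delta> \<beta> \<epsilon>) x"
    if "x \<in> A_obj {I1, I2}" "cone (pt \<alpha> \<alpha>' \<beta> \<gamma>)" "cone (pt \<alpha> \<delta> \<beta> \<epsilon>)" for x \<alpha> \<alpha>' \<beta> \<gamma> \<delta> \<epsilon>
    using that by (intro ev_hull_cong[where S = "{Gen_a, Gen_b}"]) (auto simp: A_obj_simps)
  have cong_bc: "ev (pt \<alpha> \<alpha>' \<beta> \<gamma>) x = ev (pt \<delta> \<epsilon> \<beta> \<gamma>) x"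
    if "x \<in> A_obj {I2, I3}" "cone (pt \<alpha> \<alpha>' \<beta> \<gamma>)" "cone (pt \<delta> \<epsilon> \<beta> \<gamma>)" for x \<alpha> \<alpha>' \<beta> \<gamma> \<delta> \<epsilon>
    using that by (intro ev_hull_cong[where S = "{Gen_b, Gen_c}"]) (auto simp: A_obj_simps)
  have cong_ac: "ev (pt \<alpha> \<alpha>' \<beta> \<gamma>) x = ev (pt \<delta> \<alpha>' \<epsilon> \<gamma>) x"
    if "x \<in> A_obj {I1, I3}" "cone (pt \<alpha> \<alpha>' \<beta> \<gamma>)" "cone (pt \<delta> \<alpha>' \<epsilon> \<gamma>)" for x \<alpha> \<alpha>' \<beta> \<gamma> \<delta> \<epsilon>
    using that by (intro ev_hull_cong[where S = "{Gen_a', Gen_c}"]) (auto simp: A_obj_simps)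
  \<comment> \<open>Each path runs through all ratios of two coordinates normalised to sum 1: a to b
    for \<open>?f\<close>, with a' = a, and c to b for \<open>?g\<close>.\<close>
  let ?f = "\<lambda>x t. ev (pt t t (1 - t) 0) x" and ?g = "\<lambda>x t. ev (pt 0 0 (1 - t) t) x"
  have contf: "continuous_on {0..1} (?f x)" and contg: "continuous_on {0..1} (?g x)" for x
    by (auto intro!: ev_pt_continuous continuous_intros)
  have cf: "cone (pt t t (1 - t) 0)" and cg: "cone (pt 0 0 (1 - t) t)" if "t \<in> {0..1}" for t
    using that by (auto simp: cone_pt_iff)
  obtain t where t: "0 < t" "t < 1" "?f xba t = 0" "?f xab t = 0" "\<And>s. 0 \<le> s \<Longrightarrow> s < t \<Longrightarrow> ?f xba s \<noteq> 0"
  proof (rule first_zero[OF contf contf, of xba xab])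
    show "?f xba 0 \<noteq> 0"
      using ev_nonzero_sup[OF cf[of 0] ab(2)] ev_gen[OF cf[of 0], of Gen_a] ev_gen[OF cf[of 0], of Gen_b] by simp
    show "?f xab 1 \<noteq> 0"
      using ev_nonzero_sup[OF cf[of 1] ab(1)] ev_gen[OF cf[of 1], of Gen_a] ev_gen[OF cf[of 1], of Gen_b] by simp
    show "?f xba s = 0 \<or> ?f xab s = 0" if "s \<in> {0..1}" for s
      using ev_zero_inf[OF cf[OF that] ab(3)] by blast
  qed blast
  obtain r where r: "0 < r" "r < 1" "?g xbc r = 0" "?g xcb r = 0"
  proof (rule first_zero[OF contg contg, of xbc xcb])
    show "?g xbc 0 \<noteq> 0"
      using ev_nonzero_sup[OF cg[of 0] bc(1)] ev_gen[OF cg[of 0], of Gen_b] ev_gen[OF cg[of 0], of Gen_c] by simp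
    show "?g xcb 1 \<noteq> 0"
      using ev_nonzero_sup[OF cg[of 1] bc(2)] ev_gen[OF cg[of 1], of Gen_b] ev_gen[OF cg[of 1], of Gen_c] by simp
    show "?g xbc s = 0 \<or> ?g xcb s = 0" if "s \<in> {0..1}" for s
      using ev_zero_inf[OF cg[OF that] bc(3)] by blast
  qed blast
  \<comment> \<open>Chosen so that (1 - t) : \<gamma> = (1 - r) : r, the ratio of b to c at which
    \<open>xbc\<close> and \<open>xcb\<close> both vanish.\<close>
  define \<gamma> where "\<gamma> = (1 - t) * r / (1 - r)"
  have \<gamma>0: "0 \<le> \<gamma>" using t r by (simp add: \<gamma>_def)
  \<comment> \<open>The value 3/2 t of a' is admissible for a = t and also for a = 3/4 t, where a' =
    2a. Hence elements of A_13 and A_23 do not distinguish \<open>?Q0\<close> from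
    \<open>?Q1\<close>.\<close>
  let ?Q0 = "pt t (3/2 * t) (1 - t) \<gamma>" and ?Q1 = "pt (3/4 * t) (3/2 * t) (1 - t) \<gamma>"
  have Q: "cone ?Q0" "cone ?Q1" using t \<gamma>0 by (auto simp: cone_pt_iff)
  have bc0: "ev v x = 0" if v: "v = ?Q0 \<or> v = ?Q1" and x: "x \<in> A_obj {I2, I3}" "?g x r = 0" for v x
  proof -
    have cone: "cone (pt 0 0 (1 - t) \<gamma>)" using t \<gamma>0 by (simp add: cone_pt_iff)
    have "ev v x = ev (pt 0 0 (1 - t) \<gamma>) x"
      using v cong_bc[OF x(1) Q(1) cone] cong_bc[OF x(1) Q(2) cone] by auto
    also have "\<dots> = (1 - t) / (1 - r) * ?g x r"
      using ev_pt_scale[of "(1 - t) / (1 - r)" 0 0 "1 - r" r x] t r by (simp add: \<gamma>_def)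
    finally show ?thesis using x(2) by simp
  qed
  \<comment> \<open>At \<open>?Q0\<close> the first triangle inequality makes \<open>xca\<close>
    vanish; this carries over to \<open>?Q1\<close>, where the second one forces \<open>xba\<close>
    to vanish.\<close>
  have "ev ?Q0 xba = 0"
    using cong_ab[OF xba Q(1) cf[of t]] t by simp
  moreover have "ev ?Q0 xcb = 0" using bc0 xcb r(4) by blast
  ultimately have "ev ?Q0 xca = 0" using ev_nonzero_sup[OF Q(1) ca] by blast
  then have "ev ?Q1 xca = 0" using cong_ac[OF xca Q] by simp
  moreover have "ev ?Q1 xbc = 0" using bc0 xbc r(3) by blast
  ultimately have zero: "ev ?Q1 xba = 0" using ev_nonzero_sup[OF Q(2) ba] by blast
  \<comment> \<open>The sum 3/4 t + (1 - t) of a and b at \<open>?Q1\<close>. Dividing by it leads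
    to the path \<open>?f\<close> at parameter s, and s < t because c > 3/4.\<close>
  define c where "c = 1 - t / 4"
  define s where "s = 3/4 * t / c"
  have c: "0 < c" using t by (simp add: c_def)
  have cs: "c * s = 3/4 * t" "c * (1 - s) = 1 - t"
    using c by (simp_all add: s_def right_diff_distrib) (simp add: c_def)
  have "3/4 * t < t * c"
  proof -
    have "t * (3/4) < t * c" using t by (intro mult_strict_left_mono) (auto simp: c_def)
    then show ?thesis by simp
  qed
  then have st: "0 \<le> s" "s < t" using t c by (auto simp: s_def field_simps)
  \<comment> \<open>\<open>xba\<close> ignores a' and c, which are reset to the values a and 0 that
    they have on a multiple of \<open>?f\<close>.\<close>
  have "ev ?Q1 xba = ev (pt (c * s) (c * s) (c * (1 - s)) (c * 0)) xba"
    unfolding cs using t by (intro cong_ab[OF xba Q(2)]) (simp add: cone_pt_iff)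
  also have "\<dots> = c * ?f xba s"
    using c by (intro ev_pt_scale) simp
  finally show False using zero c t(5)[OF st] by simp
qed

text \<open>A value outside the supports of all atoms can be added to \<open>w\<close> without
  leaving its atom, and the label of that atom lies below the index of the smaller map.\<close>

lemma step_function_support:
  assumes "F \<in> step_functions"
  obtains E where "finite E" "E \<subseteq> Field omega2"
    "\<And>w w' p \<xi>. X_fun w' = (X_fun w)(p \<mapsto> \<xi>) \<Longrightarrow> X_fun w p = None \<Longrightarrow> \<xi> \<notin> E \<Longrightarrow> F w' \<in> pid ` A_obj (bd w)"
proof -
  obtain A where A: "A \<in> fpX" "adapted A F" using assms by (auto simp: step_functions_def)
  obtain E where E: "finite E" "E \<subseteq> Field omega2" "\<And>b. b \<in> atoms A \<Longrightarrow> supports E b"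
    using finite_common_support[OF finite_atoms[OF A(1)]] by blast
  obtain s where s: "\<And>x. x \<in> atoms A \<Longrightarrow> s x \<in> pid ` A_obj (atom_index A x)"
    "\<And>x v. x \<in> atoms A \<Longrightarrow> v \<in> ext x \<Longrightarrow> F v = s x"
    using adapted_atom_at[OF A] by metis
  have "F w' \<in> pid ` A_obj (bd w)"
    if w': "X_fun w' = (X_fun w)(p \<mapsto> \<xi>)" and new: "X_fun w p = None" and \<xi>: "\<xi> \<notin> E" for w w' p \<xi>
  proof -
    let ?x = "atom_at A w"
    have "w \<le> w'"
      unfolding X_le_iff w' map_le_def using new by auto
    moreover have "u \<le> w" if u: "ran (X_fun u) \<subseteq> E" "u \<le> w'" for u
      unfolding X_le_iff map_le_def
    proof
      fix q assume q: "q \<in> dom (X_fun u)"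
      then have "X_fun u q = X_fun w' q" using u(2) by (auto simp: X_le_iff map_le_def)
      moreover have "X_fun u q \<noteq> Some \<xi>" using u(1) \<xi> by (auto simp: ran_def)
      ultimately show "X_fun u q = X_fun w q" by (auto simp: w' split: if_splits)
    qed
    ultimately have "w' \<in> ext ?x"
      using E(3)[OF atom_at(1)[OF A(1)], of w] atom_at(2)[OF A(1), of w] unfolding supports_def by blast
    then have "F w' = s ?x" using s(2) atom_at(1)[OF A(1)] by blast
    moreover have "s ?x \<in> pid ` A_obj (bd w)"
      using pid_A_obj_mono[OF atom_index_le_bd[OF A(1) atom_at[OF A(1)]]] s(1)[OF atom_at(1)[OF A(1)]]
      by (rule subsetD)
    ultimately show ?thesis by simp
  qed
  then show thesis by (rule that[OF E(1,2)])
qed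

lemma not_cevian_condensateB: "\<not> cevian condensateB"
proof
  assume "cevian condensateB"
  then obtain d where d: "\<And>F G. F \<in> step_functions \<Longrightarrow> G \<in> step_functions \<Longrightarrow> d F G \<in> step_functions"
    "\<And>F G. F \<in> step_functions \<Longrightarrow> G \<in> step_functions \<Longrightarrow> F \<le> sup G (d F G)"
    "\<And>F G. F \<in> step_functions \<Longrightarrow> G \<in> step_functions \<Longrightarrow> inf (d F G) (d G F) = bot"
    "\<And>F G H. F \<in> step_functions \<Longrightarrow> G \<in> step_functions \<Longrightarrow> H \<in> step_functions \<Longrightarrow> d F H \<le> sup (d F G) (d G H)"
    by (rule condensateB.cevianE) blast
  let ?gen = "\<lambda>i. case i of I1 \<Rightarrow> ga | I2 \<Rightarrow> gb | I3 \<Rightarrow> gc"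
  define a where "a i \<xi> = char_step (single i \<xi>) (pid (?gen i))" for i \<xi>
  have a: "a i \<xi> \<in> step_functions" if "\<xi> \<in> Field omega2" for i \<xi>
    unfolding a_def using that gen_in_A_obj by (intro char_step_single_in) (auto split: idx.split)
  \<comment> \<open>Stated for all \<open>F\<close>, with the empty requirement outside
    \<open>step_functions\<close>, so that the supports can be chosen as one total function.\<close>
  have "\<exists>E. finite E \<and> (F \<in> step_functions \<longrightarrow> (\<forall>w w' p \<xi>. X_fun w' = (X_fun w)(p \<mapsto> \<xi>) \<longrightarrow>
      X_fun w p = None \<longrightarrow> \<xi> \<notin> E \<longrightarrow> F w' \<in> pid ` A_obj (bd w)))" for F
  proof (cases "F \<in> step_functions")
    case True
    then show ?thesis using step_function_support[OF True] by metis
  qed auto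
  then obtain supp where supp: "\<And>F. finite (supp F)"
    "\<And>F w w' p \<xi>. F \<in> step_functions \<Longrightarrow> X_fun w' = (X_fun w)(p \<mapsto> \<xi>) \<Longrightarrow> X_fun w p = None \<Longrightarrow>
      \<xi> \<notin> supp F \<Longrightarrow> F w' \<in> pid ` A_obj (bd w)"
    by metis
  define E where "E i j \<xi> \<eta> = supp (d (a i \<xi>) (a j \<eta>)) \<union> supp (d (a j \<eta>) (a i \<xi>))" for i j \<xi> \<eta>
  obtain \<xi>1 \<xi>2 \<xi>3 where \<xi>: "\<xi>1 \<in> Field omega2" "\<xi>2 \<in> Field omega2" "\<xi>3 \<in> Field omega2"
    and free: "\<xi>3 \<notin> E I1 I2 \<xi>1 \<xi>2" "\<xi>2 \<notin> E I1 I3 \<xi>1 \<xi>3" "\<xi>1 \<notin> E I2 I3 \<xi>2 \<xi>3"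
    by (rule free_triple[of "E I1 I2" "E I1 I3" "E I2 I3"]) (auto simp: E_def supp(1))
  \<comment> \<open>The three restrictions of \<open>w\<close> omit one singleton each, and their
    indices are the three pairs. By the choice of supports, each difference at \<open>w\<close>
    takes its value in the lattice of its own pair.\<close>
  define w where "w = mkX [{I1} \<mapsto> \<xi>1, {I2} \<mapsto> \<xi>2, {I3} \<mapsto> \<xi>3]"
  define w12 where "w12 = mkX [{I1} \<mapsto> \<xi>1, {I2} \<mapsto> \<xi>2]"
  define w13 where "w13 = mkX [{I1} \<mapsto> \<xi>1, {I3} \<mapsto> \<xi>3]"
  define w23 where "w23 = mkX [{I2} \<mapsto> \<xi>2, {I3} \<mapsto> \<xi>3]"
  have w: "X_fun w = [{I1} \<mapsto> \<xi>1, {I2} \<mapsto> \<xi>2, {I3} \<mapsto> \<xi>3]"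
    "X_fun w12 = [{I1} \<mapsto> \<xi>1, {I2} \<mapsto> \<xi>2]"
    "X_fun w13 = [{I1} \<mapsto> \<xi>1, {I3} \<mapsto> \<xi>3]"
    "X_fun w23 = [{I2} \<mapsto> \<xi>2, {I3} \<mapsto> \<xi>3]"
    unfolding w_def w12_def w13_def w23_def by (intro X_fun_mkX; use \<xi> in \<open>auto simp: ran_def\<close>)+
  have bd: "bd w12 = {I1, I2}" "bd w13 = {I1, I3}" "bd w23 = {I2, I3}"
    by (auto simp: bd_eq w)
  have upd: "X_fun w = (X_fun w12)({I3} \<mapsto> \<xi>3)" "X_fun w = (X_fun w13)({I2} \<mapsto> \<xi>2)"
    "X_fun w = (X_fun w23)({I1} \<mapsto> \<xi>1)"
    by (auto simp: w fun_eq_iff)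
  let ?A = "a I1 \<xi>1" and ?B = "a I2 \<xi>2" and ?C = "a I3 \<xi>3"
  note in_step = a[OF \<xi>(1), of I1] a[OF \<xi>(2), of I2] a[OF \<xi>(3), of I3]
  have val: "?A w = pid ga" "?B w = pid gb" "?C w = pid gc"
    using \<xi> by (simp_all add: a_def char_step_def single_le_iff w)
  have "d ?A ?B w \<in> pid ` A_obj {I1, I2}" "d ?B ?A w \<in> pid ` A_obj {I1, I2}"
    using supp(2)[OF d(1) upd(1)] free(1) in_step by (auto simp: E_def w bd)
  then obtain xab xba where ab: "xab \<in> A_obj {I1, I2}" "d ?A ?B w = pid xab"
    "xba \<in> A_obj {I1, I2}" "d ?B ?A w = pid xba" by auto
  have "d ?B ?C w \<in> pid ` A_obj {I2, I3}" "d ?C ?B w \<in> pid ` A_obj {I2, I3}"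
    using supp(2)[OF d(1) upd(3)] free(3) in_step by (auto simp: E_def w bd)
  then obtain xbc xcb where bc: "xbc \<in> A_obj {I2, I3}" "d ?B ?C w = pid xbc"
    "xcb \<in> A_obj {I2, I3}" "d ?C ?B w = pid xcb" by auto
  have "d ?C ?A w \<in> pid ` A_obj {I1, I3}"
    using supp(2)[OF d(1) upd(2)] free(2) in_step by (auto simp: E_def w bd)
  then obtain xca where ca: "xca \<in> A_obj {I1, I3}" "d ?C ?A w = pid xca" by auto
  have le: "F w \<le> sup (G w) (d F G w)" if "F \<in> step_functions" "G \<in> step_functions" for F G
    using le_funD[OF d(2)[OF that], of w] by simp
  have disj: "inf (d F G w) (d G F w) = bot" if "F \<in> step_functions" "G \<in> step_functions" for F G
    using fun_cong[OF d(3)[OF that], of w] by simp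
  have tri: "d F H w \<le> sup (d F G w) (d G H w)"
    if "F \<in> step_functions" "G \<in> step_functions" "H \<in> step_functions" for F G H
    using le_funD[OF d(4)[OF that], of w] by simp
  show False
    using no_coherent_differences[OF ab(1,3) bc(1,3) ca(1)]
      le[OF in_step(1,2)] le[OF in_step(2,1)] disj[OF in_step(1,2)]
      le[OF in_step(2,3)] le[OF in_step(3,2)] disj[OF in_step(2,3)]
      tri[OF in_step(3,2,1)] tri[OF in_step(2,3,1)]
    unfolding val ab bc ca by blast
qed

theorem theorem7p2:
  shows "let B = condensate scaled_FX IdcA_obj IdcA_arr in
    distrib_lattice_0 B \<and> completely_normal B \<and> countably_based_differences B \<and>
    \<not> cevian B \<and> |carrier B| =o omega2"
  unfolding Let_def
  by (intro conjI condensateB.distrib_lattice_0 completely_normal_condensateB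
      countably_based_differences_condensateB not_cevian_condensateB card_condensateB)

end
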